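(* For any link $L$, any $L$-generating subset of the set of directed Polyak moves $$\{\Omega1a^\uparrow,\Omega1a^\downarrow,\Omega1b^\uparrow,\Omega1b^\downarrow,\Omega2a^\uparrow,\Omega2a^\downarrow,\Omega3a^\uparrow,\Omega3a^\downarrow\}$$ contains the moves $\Omega2a^\uparrow$ and $\Omega2a^\downarrow$.
   Context: Links are oriented, with at least one component; link diagrams are oriented generic planar diagrams in $\mathbb{R}^2$, up to planar isotopy. Each crossing has a sign $\pm1$. Moves: - $\Omega1a$, $\Omega1b$: forward ($\uparrow$) means a crossingless arc is replaced by an arc with a single curl with one positive crossing; the winding number (total number of counterclockwise full turns of the tangent vector) changes by $-1$ for $\Omega1a^\uparrow$ and by $+1$ for $\Omega1b^\uparrow$. Backward ($\downarrow$) is the inverse. - $\Omega2a$: forward means that of two disjoint neighbouring arcs oriented in the same direction, the left one (with respect to this direction) is pushed over the right one, creating a bigon with two crossings of opposite signs; backward is the inverse. - $\Omega3a$: three strands (top, middle, bottom) pairwise cross once, the top–middle and middle–bottom crossings being positive and the top–bottom crossing negative, and one strand is passed across the crossing of the other two. Orient the triangle formed by the three crossings by the cyclic order bottom$\to$middle$\to$top of its sides; let $n$ be the number of sides on which this orientation agrees with that of the diagram, $q=(-1)^n$. The move is forward ($\uparrow$) if it changes $q=-1$ to $q=+1$, backward ($\downarrow$) otherwise. A set $A$ of directed moves is $L$-generating if for any two diagrams $L_1,L_2$ of $L$, $L_2$ can be obtained from $L_1$ by a finite sequence of moves from $A$ (each used only in its specified direction). *)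

theory Defs
  imports "HOL-Complex_Analysis.Complex_Analysis"
begin

section \<open>Links\<close>

text \<open>
  We work in the \<open>C\<^sup>1\<close> category.  The circle is \<open>\<real>/\<int>\<close>: a closed curve is a function on the reals of
  period 1, and each point of the circle has exactly one parameter in \<open>{0..<1}\<close>.  Three-space is
  \<open>complex \<times> real\<close>: the plane of the diagrams times the height above it.  A component is oriented
  by its parametrization.  Values at component indices \<open>\<ge>\<close> the number of components are irrelevant.
\<close>

definition regular_closed_curve :: "(real \<Rightarrow> 'a::real_normed_vector) \<Rightarrow> bool" where
  "regular_closed_curve c \<longleftrightarrow>
     (\<forall>s. c (s + 1) = c s) \<and> c C1_differentiable_on UNIV \<and>
     (\<forall>s. vector_derivative c (at s) \<noteq> 0)"

definition circle_params :: "nat \<Rightarrow> (nat \<times> real) set" where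
  "circle_params n = {..<n} \<times> {0..<1}"

record link =
  link_comps :: nat
  strand :: "nat \<Rightarrow> real \<Rightarrow> complex \<times> real"

definition is_link :: "link \<Rightarrow> bool" where
  "is_link L \<longleftrightarrow>
     link_comps L \<ge> 1 \<and>
     (\<forall>i<link_comps L. regular_closed_curve (strand L i)) \<and>
     inj_on (\<lambda>(i, s). strand L i s) (circle_params (link_comps L))"

text \<open>
  Isotopy through embedded \<open>C\<^sup>1\<close> links; the joint continuity of the tangent vectors is what
  prevents knotted arcs from being shrunk to a point.  Links are unordered, so the components
  may be renumbered.
\<close>

definition link_isotopic :: "link \<Rightarrow> link \<Rightarrow> bool" where
  "link_isotopic L K \<longleftrightarrow>
     is_link L \<and> is_link K \<and> link_comps K = link_comps L \<and>
     (\<exists>(\<Gamma> :: real \<Rightarrow> link) \<pi>.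
        \<pi> permutes {..<link_comps L} \<and>
        (\<forall>t\<in>{0..1}. is_link (\<Gamma> t) \<and> link_comps (\<Gamma> t) = link_comps L) \<and>
        (\<forall>i<link_comps L.
           strand (\<Gamma> 0) i = strand L i \<and> strand (\<Gamma> 1) i = strand K (\<pi> i) \<and>
           continuous_on ({0..1} \<times> UNIV) (\<lambda>(t, s). strand (\<Gamma> t) i s) \<and>
           continuous_on ({0..1} \<times> UNIV)
             (\<lambda>(t, s). vector_derivative (strand (\<Gamma> t) i) (at s))))"

section \<open>Diagrams\<close>

text \<open>
  \<open>over D i s\<close> says that the branch through parameter \<open>s\<close> of component \<open>i\<close> is the upper one; it
  carries information only at double points.
\<close>

record diagram =
  comps :: nat
  curve :: "nat \<Rightarrow> real \<Rightarrow> complex"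
  over :: "nat \<Rightarrow> real \<Rightarrow> bool"

definition point :: "diagram \<Rightarrow> nat \<times> real \<Rightarrow> complex" where
  "point D p = curve D (fst p) (snd p)"

definition tangent :: "diagram \<Rightarrow> nat \<times> real \<Rightarrow> complex" where
  "tangent D p = vector_derivative (curve D (fst p)) (at (snd p))"

definition is_over :: "diagram \<Rightarrow> nat \<times> real \<Rightarrow> bool" where
  "is_over D p = over D (fst p) (snd p)"

definition double_points :: "diagram \<Rightarrow> ((nat \<times> real) \<times> (nat \<times> real)) set" where
  "double_points D =
     {(p, q). p \<in> circle_params (comps D) \<and> q \<in> circle_params (comps D) \<and>
              p \<noteq> q \<and> point D p = point D q}"

text \<open>For plane vectors, \<open>Im (cnj v * w)\<close> is the determinant of \<open>(v, w)\<close>.\<close>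

definition is_diagram :: "diagram \<Rightarrow> bool" where
  "is_diagram D \<longleftrightarrow>
     comps D \<ge> 1 \<and>
     (\<forall>i<comps D. regular_closed_curve (curve D i) \<and> (\<forall>s. over D i (s + 1) = over D i s)) \<and>
     finite (double_points D) \<and>
     (\<forall>(p, q)\<in>double_points D.
        Im (cnj (tangent D p) * tangent D q) \<noteq> 0 \<and> is_over D p \<noteq> is_over D q) \<and>
     (\<forall>p q r. (p, q) \<in> double_points D \<and> (p, r) \<in> double_points D \<longrightarrow> q = r)"

text \<open>A crossing is represented by the pair (parameter of upper branch, parameter of lower branch).\<close>

definition crossings :: "diagram \<Rightarrow> ((nat \<times> real) \<times> (nat \<times> real)) set" where
  "crossings D = {(p, q) \<in> double_points D. is_over D p \<and> \<not> is_over D q}"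

definition crossing_sign :: "diagram \<Rightarrow> (nat \<times> real) \<times> (nat \<times> real) \<Rightarrow> real" where
  "crossing_sign D c = sgn (Im (cnj (tangent D (fst c)) * tangent D (snd c)))"

text \<open>
  The number of counterclockwise full turns of the tangent vector along a component is the
  winding number about \<open>0\<close> of the derivative.
\<close>

definition total_winding :: "diagram \<Rightarrow> complex" where
  "total_winding D =
     (\<Sum>i<comps D. winding_number (\<lambda>s. vector_derivative (curve D i) (at s)) 0)"

definition projects_to :: "link \<Rightarrow> diagram \<Rightarrow> bool" where
  "projects_to K D \<longleftrightarrow>
     is_link K \<and> is_diagram D \<and> comps D = link_comps K \<and>
     (\<forall>i<comps D. \<forall>s. curve D i s = fst (strand K i s)) \<and>
     (\<forall>((i, s), (j, t))\<in>crossings D. snd (strand K i s) > snd (strand K j t))"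

definition diagram_of :: "link \<Rightarrow> diagram \<Rightarrow> bool" where
  "diagram_of L D \<longleftrightarrow> (\<exists>K. link_isotopic L K \<and> projects_to K D)"

section \<open>Planar isotopy\<close>

definition C1_plane_map :: "(complex \<Rightarrow> complex) \<Rightarrow> bool" where
  "C1_plane_map f \<longleftrightarrow>
     (\<exists>f' :: complex \<Rightarrow> complex \<Rightarrow>\<^sub>L complex.
        (\<forall>z. (f has_derivative blinfun_apply (f' z)) (at z)) \<and> continuous_on UNIV f')"

definition plane_isotopy :: "(real \<Rightarrow> complex \<Rightarrow> complex) \<Rightarrow> bool" where
  "plane_isotopy H \<longleftrightarrow>
     (\<forall>z. H 0 z = z) \<and>
     (\<forall>t\<in>{0..1}. bij (H t) \<and> C1_plane_map (H t) \<and> C1_plane_map (inv (H t))) \<and>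
     continuous_on ({0..1} \<times> UNIV) (\<lambda>(t, z). H t z) \<and>
     (\<exists>H' :: real \<Rightarrow> complex \<Rightarrow> complex \<Rightarrow>\<^sub>L complex.
        (\<forall>t\<in>{0..1}. \<forall>z. (H t has_derivative blinfun_apply (H' t z)) (at z)) \<and>
        continuous_on ({0..1} \<times> UNIV) (\<lambda>(t, z). H' t z))"

definition circle_reparam :: "(real \<Rightarrow> real) \<Rightarrow> bool" where
  "circle_reparam \<phi> \<longleftrightarrow>
     (\<forall>s. \<phi> (s + 1) = \<phi> s + 1) \<and> \<phi> C1_differentiable_on UNIV \<and>
     (\<forall>s. vector_derivative \<phi> (at s) > 0)"

text \<open>
  Diagrams are considered up to ambient isotopy of the plane, renumbering of the components and
  orientation preserving reparametrization of each component.
\<close>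

definition planar_isotopic :: "diagram \<Rightarrow> diagram \<Rightarrow> bool" where
  "planar_isotopic D D' \<longleftrightarrow>
     is_diagram D \<and> is_diagram D' \<and> comps D' = comps D \<and>
     (\<exists>H \<pi> \<phi>.
        plane_isotopy H \<and> \<pi> permutes {..<comps D} \<and>
        (\<forall>i<comps D. circle_reparam (\<phi> i) \<and>
           (\<forall>s. curve D' (\<pi> i) (\<phi> i s) = H 1 (curve D i s))) \<and>
        (\<forall>((i, s), (j, t))\<in>crossings D.
           over D' (\<pi> i) (\<phi> i s) \<and> \<not> over D' (\<pi> j) (\<phi> j t)))"

section \<open>Local moves\<close>

text \<open>
  Up to planar isotopy a move can be made inside the closed unit disc, and, up to reparametrization,
  no arc involved has the base point \<open>0\<close> of its circle in its interior.  The
  moves are therefore stated for diagrams in this position; planar isotopies are interleaved with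
  the moves below.  An arc \<open>(i, a, b)\<close> is the part of component \<open>i\<close> with parameters in \<open>{a..b}\<close>.
\<close>

type_synonym arc = "nat \<times> real \<times> real"

fun arc_params :: "arc \<Rightarrow> (nat \<times> real) set" where
  "arc_params (i, a, b) = {i} \<times> {a..b}"

fun is_arc :: "diagram \<Rightarrow> arc \<Rightarrow> bool" where
  "is_arc D (i, a, b) \<longleftrightarrow> i < comps D \<and> 0 \<le> a \<and> a < b \<and> b < 1"

fun arc_inside :: "diagram \<Rightarrow> arc \<Rightarrow> bool" where
  "arc_inside D (i, a, b) \<longleftrightarrow> (\<forall>s\<in>{a<..<b}. curve D i s \<in> ball 0 1)"

definition meets_disc_in :: "diagram \<Rightarrow> arc set \<Rightarrow> bool" where
  "meets_disc_in D As \<longleftrightarrow>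
     (\<forall>\<alpha>\<in>As. is_arc D \<alpha> \<and> arc_inside D \<alpha>) \<and>
     disjoint_family_on arc_params As \<and>
     {p \<in> circle_params (comps D). point D p \<in> cball 0 1} = (\<Union>\<alpha>\<in>As. arc_params \<alpha>)"

text \<open>
  \<open>D\<close> and \<open>D'\<close> agree outside the arcs \<open>As\<close>; by continuity corresponding arcs have
  the same end points.
\<close>

definition local_replacement :: "arc set \<Rightarrow> diagram \<Rightarrow> diagram \<Rightarrow> bool" where
  "local_replacement As D D' \<longleftrightarrow>
     is_diagram D \<and> is_diagram D' \<and> comps D' = comps D \<and>
     meets_disc_in D As \<and> meets_disc_in D' As \<and>
     (\<forall>p \<in> circle_params (comps D) - (\<Union>\<alpha>\<in>As. arc_params \<alpha>).
        point D' p = point D p \<and> is_over D' p = is_over D p)"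

definition inner_crossings :: "diagram \<Rightarrow> ((nat \<times> real) \<times> (nat \<times> real)) set" where
  "inner_crossings D = {(p, q) \<in> crossings D. point D p \<in> cball 0 1}"

text \<open>Forward first move creating a positive curl and changing the winding number by \<open>\<delta>\<close>.\<close>

definition omega1 :: "complex \<Rightarrow> diagram \<Rightarrow> diagram \<Rightarrow> bool" where
  "omega1 \<delta> D D' \<longleftrightarrow>
     (\<exists>\<alpha> c. local_replacement {\<alpha>} D D' \<and>
        inner_crossings D = {} \<and>
        inner_crossings D' = {c} \<and> crossing_sign D' c = 1 \<and>
        total_winding D' = total_winding D + \<delta>)"

definition omega1a :: "diagram \<Rightarrow> diagram \<Rightarrow> bool" where
  "omega1a = omega1 (- 1)"

definition omega1b :: "diagram \<Rightarrow> diagram \<Rightarrow> bool" where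
  "omega1b = omega1 1"

text \<open>The arc runs through the disc along the vertical line with abscissa \<open>x\<close>, from bottom to top.\<close>

fun upward_chord :: "diagram \<Rightarrow> real \<Rightarrow> arc \<Rightarrow> bool" where
  "upward_chord D x (i, a, b) \<longleftrightarrow>
     (\<forall>s\<in>{a..b}. Re (curve D i s) = x) \<and> Im (curve D i a) < 0 \<and> 0 < Im (curve D i b)"

text \<open>
  Two disjoint neighbouring arcs with the same direction are brought by planar isotopy to
  two parallel upward chords.  The left chord \<open>\<alpha>\<close> is pushed over the right chord \<open>\<beta>\<close>.
  Two simple arcs crossing exactly twice in a disc always bound a bigon there.
\<close>

definition omega2a :: "diagram \<Rightarrow> diagram \<Rightarrow> bool" where
  "omega2a D D' \<longleftrightarrow>
     (\<exists>\<alpha> \<beta> c\<^sub>1 c\<^sub>2. \<alpha> \<noteq> \<beta> \<and> local_replacement {\<alpha>, \<beta>} D D' \<and>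
        upward_chord D (- 1 / 2) \<alpha> \<and> upward_chord D (1 / 2) \<beta> \<and>
        inner_crossings D' = {c\<^sub>1, c\<^sub>2} \<and>
        {c\<^sub>1, c\<^sub>2} \<subseteq> arc_params \<alpha> \<times> arc_params \<beta> \<and>
        crossing_sign D' c\<^sub>1 = 1 \<and> crossing_sign D' c\<^sub>2 = - 1)"

text \<open>
  The arcs \<open>\<tau>\<close>, \<open>\<mu>\<close>, \<open>\<beta>\<close> (top, middle, bottom) cross pairwise exactly once, at
  \<open>(tm, mt)\<close> (top over middle), \<open>(mb, bm)\<close> (middle over bottom) and \<open>(tb, bt)\<close> (top over bottom).
\<close>

record triangle =
  tm :: real
  mt :: real
  mb :: real
  bm :: real
  tb :: real
  bt :: real

definition has_triangle :: "diagram \<Rightarrow> arc \<Rightarrow> arc \<Rightarrow> arc \<Rightarrow> triangle \<Rightarrow> bool" where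
  "has_triangle D \<tau> \<mu> \<beta> \<Delta> \<longleftrightarrow>
     (let t = Pair (fst \<tau>); m = Pair (fst \<mu>); b = Pair (fst \<beta>) in
        {t (tm \<Delta>), t (tb \<Delta>)} \<subseteq> arc_params \<tau> \<and>
        {m (mt \<Delta>), m (mb \<Delta>)} \<subseteq> arc_params \<mu> \<and>
        {b (bt \<Delta>), b (bm \<Delta>)} \<subseteq> arc_params \<beta> \<and>
        inner_crossings D =
          {(t (tm \<Delta>), m (mt \<Delta>)), (m (mb \<Delta>), b (bm \<Delta>)), (t (tb \<Delta>), b (bt \<Delta>))} \<and>
        crossing_sign D (t (tm \<Delta>), m (mt \<Delta>)) = 1 \<and>
        crossing_sign D (m (mb \<Delta>), b (bm \<Delta>)) = 1 \<and>
        crossing_sign D (t (tb \<Delta>), b (bt \<Delta>)) = - 1)"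

text \<open>
  Going around the triangle along bottom, middle, top in this order, the bottom side is traversed
  from its crossing with top to its crossing with middle, and so on cyclically; the side
  agrees with the diagram if its strand meets these two crossings in this order.
\<close>

definition agreeing_sides :: "triangle \<Rightarrow> nat" where
  "agreeing_sides \<Delta> =
     of_bool (bt \<Delta> < bm \<Delta>) + of_bool (mb \<Delta> < mt \<Delta>) + of_bool (tm \<Delta> < tb \<Delta>)"

definition triangle_q :: "triangle \<Rightarrow> int" where
  "triangle_q \<Delta> = (- 1) ^ agreeing_sides \<Delta>"

text \<open>
  Passing a strand across the crossing of the other two reverses, along each of the three strands,
  the order of its two crossings.  Conversely, two arrangements in a disc of three arcs with the
  same end points, pairwise crossing once, differ by such a passage if the orders are reversed.
\<close>

definition omega3a :: "diagram \<Rightarrow> diagram \<Rightarrow> bool" where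
  "omega3a D D' \<longleftrightarrow>
     (\<exists>\<tau> \<mu> \<beta> \<Delta> \<Delta>'. distinct [\<tau>, \<mu>, \<beta>] \<and> local_replacement {\<tau>, \<mu>, \<beta>} D D' \<and>
        has_triangle D \<tau> \<mu> \<beta> \<Delta> \<and> has_triangle D' \<tau> \<mu> \<beta> \<Delta>' \<and>
        (bt \<Delta> < bm \<Delta> \<longleftrightarrow> bm \<Delta>' < bt \<Delta>') \<and>
        (mb \<Delta> < mt \<Delta> \<longleftrightarrow> mt \<Delta>' < mb \<Delta>') \<and>
        (tm \<Delta> < tb \<Delta> \<longleftrightarrow> tb \<Delta>' < tm \<Delta>') \<and>
        triangle_q \<Delta> = - 1 \<and> triangle_q \<Delta>' = 1)"

section \<open>Directed Polyak moves\<close>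

datatype polyak_move =
    Omega1a_up | Omega1a_down
  | Omega1b_up | Omega1b_down
  | Omega2a_up | Omega2a_down
  | Omega3a_up | Omega3a_down

fun performs :: "polyak_move \<Rightarrow> diagram \<Rightarrow> diagram \<Rightarrow> bool" where
  "performs Omega1a_up D D' = omega1a D D'"
| "performs Omega1a_down D D' = omega1a D' D"
| "performs Omega1b_up D D' = omega1b D D'"
| "performs Omega1b_down D D' = omega1b D' D"
| "performs Omega2a_up D D' = omega2a D D'"
| "performs Omega2a_down D D' = omega2a D' D"
| "performs Omega3a_up D D' = omega3a D D'"
| "performs Omega3a_down D D' = omega3a D' D"

definition step :: "polyak_move set \<Rightarrow> diagram \<Rightarrow> diagram \<Rightarrow> bool" where
  "step A D D' \<longleftrightarrow> planar_isotopic D D' \<or> (\<exists>m\<in>A. performs m D D')"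

definition generating :: "link \<Rightarrow> polyak_move set \<Rightarrow> bool" where
  "generating L A \<longleftrightarrow>
     (\<forall>D\<^sub>1 D\<^sub>2. diagram_of L D\<^sub>1 \<and> diagram_of L D\<^sub>2 \<longrightarrow> (step A)\<^sup>*\<^sup>* D\<^sub>1 D\<^sub>2)"

end

theory Submission
  imports Defs
begin

text \<open>
  The monovariant is the number of negative crossings. The first moves create or remove one
  positive crossing, the third move keeps the signs of its three crossings, and planar isotopies
  preserve all signs. Only \<open>\<Omega>2a\<close> changes the number: its forward move adds one
  negative crossing and its backward move removes one. Hence a sequence of moves without
  \<open>\<Omega>2a\<up>\<close> never increases the number and one without
  \<open>\<Omega>2a\<down>\<close> never decreases it
  (\<open>step_card_negative_crossings\<close>). It therefore suffices that every link has two
  diagrams with different numbers of negative crossings (\<open>generating_needs_omega2a\<close>).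

  A first diagram comes from general position. An embedding of compact curves stays an embedding
  under \<open>C\<^sup>1\<close>-small perturbations, which are then isotopies
  (\<open>link_C1_close_isotopic\<close>). Averaging over short parameter intervals makes the
  plane coordinates twice differentiable, and adding a quadratic polynomial of a circular motion,
  with small generic coefficients, removes triple points, tangencies and singular points of the
  projection. The exceptional coefficients are negligible, either as images of lower-dimensional
  spaces or by Sard's theorem (\<open>generic_perturbation\<close>).

  A second diagram has one more negative crossing. Near a point that is not a crossing and where
  the height strictly increases, the link is a graph over the height axis. The straight line
  homotopy from its projection to another plane arc, inside a disc that the rest of the diagram
  avoids, is thus an isotopy, however complicated the new arc is. Choosing an arc with a single
  curl adds a single crossing, and the direction in which the curl turns makes it negative
  (\<open>curl_insertion\<close>).
\<close>

section \<open>Closed curves and their parameters\<close>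

lemma periodic_add_int:
  fixes f :: "real \<Rightarrow> 'a"
  assumes "\<And>s. f (s + 1) = f s"
  shows "f (s + of_int m) = f s"
proof (induction m rule: int_induct[where k = 0])
  case base
  then show ?case by simp
next
  case (step1 m)
  have "f (s + of_int (m + 1)) = f ((s + of_int m) + 1)"
    by (simp add: add.assoc)
  then show ?case
    using assms step1 by simp
next
  case (step2 m)
  have "f ((s + of_int (m - 1)) + 1) = f (s + of_int m)"
    by (simp add: algebra_simps)
  then show ?case
    using assms[of "s + of_int (m - 1)"] step2 by (simp only:)
qed

lemma periodic_frac:
  fixes f :: "real \<Rightarrow> 'a"
  assumes "\<And>s. f (s + 1) = f s"
  shows "f (frac s) = f s"
  using periodic_add_int[of f s "- \<lfloor>s\<rfloor>", OF assms] by (simp add: frac_def)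

lemma periodic_has_vector_derivative_unique:
  fixes c :: "real \<Rightarrow> 'a::real_normed_vector"
  assumes "\<And>s. c (s + 1) = c s" and "\<And>s. (c has_vector_derivative c' s) (at s)"
  shows "c' (s + 1) = c' s"
proof -
  have "((c \<circ> (\<lambda>x. x + 1)) has_vector_derivative 1 *\<^sub>R c' (s + 1)) (at s)"
    by (rule vector_diff_chain_at) (auto intro!: derivative_eq_intros assms)
  moreover have "c \<circ> (\<lambda>x. x + 1) = c"
    using assms by auto
  ultimately show ?thesis
    using assms(2)[of s] by (auto dest: vector_derivative_unique_at)
qed

lemma regular_closed_curveI:
  assumes "\<And>s. c (s + 1) = c s" and "\<And>s. (c has_vector_derivative c' s) (at s)"
    and "continuous_on UNIV c'" and "\<And>s. c' s \<noteq> 0"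
  shows "regular_closed_curve c"
proof -
  have "c C1_differentiable_on UNIV"
    unfolding C1_differentiable_on_def using assms(2,3) by blast
  moreover have "vector_derivative c (at s) \<noteq> 0" for s
    using vector_derivative_at[OF assms(2)] assms(4) by simp
  ultimately show ?thesis
    unfolding regular_closed_curve_def using assms(1) by blast
qed

lemma regular_closed_curveD:
  assumes "regular_closed_curve c"
  shows "c (s + 1) = c s"
    and "(c has_vector_derivative vector_derivative c (at s)) (at s)"
    and "continuous_on UNIV (\<lambda>s. vector_derivative c (at s))"
    and "vector_derivative c (at s) \<noteq> 0"
    and "vector_derivative c (at (s + 1)) = vector_derivative c (at s)"
    and "continuous_on UNIV c"
proof -
  have per: "c (s + 1) = c s" for s
    using assms by (auto simp: regular_closed_curve_def)
  then show "c (s + 1) = c s" .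
  show "vector_derivative c (at s) \<noteq> 0"
    using assms by (auto simp: regular_closed_curve_def)
  obtain c' where c': "\<And>s. (c has_vector_derivative c' s) (at s)" "continuous_on UNIV c'"
    using assms unfolding regular_closed_curve_def C1_differentiable_on_def by blast
  have eq: "vector_derivative c (at s) = c' s" for s
    using c' vector_derivative_at by blast
  show "(c has_vector_derivative vector_derivative c (at s)) (at s)"
    "continuous_on UNIV (\<lambda>s. vector_derivative c (at s))"
    using c' eq by auto
  show "vector_derivative c (at (s + 1)) = vector_derivative c (at s)"
    using periodic_has_vector_derivative_unique[OF per c'(1)] eq by simp
  show "continuous_on UNIV c"
    using c'(1) by (meson continuous_at_imp_continuous_on has_vector_derivative_continuous)
qed

lemma is_diagramD:
  assumes "is_diagram D"
  shows "comps D \<ge> 1"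
    and "\<forall>i<comps D. regular_closed_curve (curve D i) \<and> (\<forall>s. over D i (s + 1) = over D i s)"
    and "finite (double_points D)"
    and "\<forall>(p, q)\<in>double_points D.
        Im (cnj (tangent D p) * tangent D q) \<noteq> 0 \<and> is_over D p \<noteq> is_over D q"
    and "\<forall>p q r. (p, q) \<in> double_points D \<and> (p, r) \<in> double_points D \<longrightarrow> q = r"
proof -
  note d = assms[unfolded is_diagram_def]
  show "comps D \<ge> 1"
    by (rule conjunct1[OF d])
  show "\<forall>i<comps D. regular_closed_curve (curve D i) \<and> (\<forall>s. over D i (s + 1) = over D i s)"
    by (rule conjunct1[OF conjunct2[OF d]])
  show "finite (double_points D)"
    by (rule conjunct1[OF conjunct2[OF conjunct2[OF d]]])
  show "\<forall>(p, q)\<in>double_points D.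
        Im (cnj (tangent D p) * tangent D q) \<noteq> 0 \<and> is_over D p \<noteq> is_over D q"
    by (rule conjunct1[OF conjunct2[OF conjunct2[OF conjunct2[OF d]]]])
  show "\<forall>p q r. (p, q) \<in> double_points D \<and> (p, r) \<in> double_points D \<longrightarrow> q = r"
    by (rule conjunct2[OF conjunct2[OF conjunct2[OF conjunct2[OF d]]]])
qed

lemma is_diagram_curve:
  assumes "is_diagram D" "i < comps D"
  shows "regular_closed_curve (curve D i)" "over D i (s + 1) = over D i s"
  using is_diagramD(2)[OF assms(1)] assms(2) by auto

lemma is_diagram_has_tangent:
  assumes "is_diagram D" "i < comps D"
  shows "(curve D i has_vector_derivative tangent D (i, s)) (at s)"
  using regular_closed_curveD(2)[OF is_diagram_curve(1)[OF assms]] by (simp add: tangent_def)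

lemma double_points_sym: "(p, q) \<in> double_points D \<Longrightarrow> (q, p) \<in> double_points D"
  by (auto simp: double_points_def)

lemma is_diagram_transversal:
  assumes "is_diagram D" "(p, q) \<in> double_points D"
  shows "Im (cnj (tangent D p) * tangent D q) \<noteq> 0" "is_over D p \<noteq> is_over D q"
  using bspec[OF is_diagramD(4)[OF assms(1)] assms(2)] by auto

section \<open>The number of negative crossings\<close>

definition negative_crossings :: "diagram \<Rightarrow> ((nat \<times> real) \<times> (nat \<times> real)) set" where
  "negative_crossings D = {c \<in> crossings D. crossing_sign D c = - 1}"

lemma finite_negative_crossings:
  assumes "is_diagram D"
  shows "finite (negative_crossings D)"
proof (rule finite_subset)
  show "negative_crossings D \<subseteq> double_points D"
    by (auto simp: negative_crossings_def crossings_def)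
  show "finite (double_points D)"
    by (rule is_diagramD(3)[OF assms])
qed

section \<open>Invariance under planar isotopies\<close>

definition jacobian :: "(complex \<Rightarrow> complex) \<Rightarrow> real" where
  "jacobian f = Im (cnj (f 1) * f \<i>)"

lemma jacobian_linear:
  assumes "bounded_linear f"
  shows "Im (cnj (f v) * f w) = jacobian f * Im (cnj v * w)"
proof -
  interpret bounded_linear f by fact
  have eq: "f z = of_real (Re z) * f 1 + of_real (Im z) * f \<i>" for z
  proof -
    have "f (Re z *\<^sub>R 1 + Im z *\<^sub>R \<i>) = of_real (Re z) * f 1 + of_real (Im z) * f \<i>"
      unfolding add scaleR by (simp add: scaleR_conv_of_real)
    moreover have "Re z *\<^sub>R 1 + Im z *\<^sub>R \<i> = z"
      by (simp add: complex_eq_iff)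
    ultimately show ?thesis
      by (simp only:)
  qed
  have "Im (cnj (of_real x * a + of_real y * b) * (of_real x' * a + of_real y' * b)) =
      Im (cnj a * b) * (x * y' - y * x')" for x y x' y' and a b :: complex
    by (simp add: algebra_simps)
  from this[of "Re v" "f 1" "Im v" "f \<i>" "Re w" "Im w"] show ?thesis
    unfolding jacobian_def eq[of v, symmetric] eq[of w, symmetric] by simp
qed

text \<open>
  The determinant of the derivative never vanishes, because the inverse map is differentiable, and
  it is \<open>1\<close> at time \<open>0\<close>. By continuity in time it is positive at time
  \<open>1\<close>.
\<close>

lemma plane_isotopy_jacobian_pos:
  assumes "plane_isotopy H"
  obtains f' where "\<And>z. (H 1 has_derivative f' z) (at z)" "\<And>z. jacobian (f' z) > 0" "bij (H 1)"
proof -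
  obtain H' :: "real \<Rightarrow> complex \<Rightarrow> complex \<Rightarrow>\<^sub>L complex" where
    H': "\<And>t z. t \<in> {0..1} \<Longrightarrow> (H t has_derivative blinfun_apply (H' t z)) (at z)"
    and cont: "continuous_on ({0..1} \<times> UNIV) (\<lambda>(t, z). H' t z)"
    using assms unfolding plane_isotopy_def by blast
  define J where "J = (\<lambda>t z. jacobian (blinfun_apply (H' t z)))"
  have nz: "J t z \<noteq> 0" if t: "t \<in> {0..1}" for t z
  proof -
    have bij: "bij (H t)" and "C1_plane_map (inv (H t))"
      using assms t by (auto simp: plane_isotopy_def)
    then obtain g' where g': "\<And>z. (inv (H t) has_derivative blinfun_apply (g' z)) (at z)"
      unfolding C1_plane_map_def by blast
    have "((inv (H t) \<circ> H t) has_derivative (blinfun_apply (g' (H t z)) \<circ> blinfun_apply (H' t z))) (at z)"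
      by (rule diff_chain_at[OF H'[OF t] g'])
    moreover have "inv (H t) \<circ> H t = id"
      using bij by (simp add: bij_def)
    ultimately have "blinfun_apply (g' (H t z)) \<circ> blinfun_apply (H' t z) = id"
      using has_derivative_unique[of id _ z id] has_derivative_id by simp
    then have inv: "blinfun_apply (g' (H t z)) (blinfun_apply (H' t z) v) = v" for v
      by (metis comp_apply id_apply)
    show ?thesis
    proof
      assume J0: "J t z = 0"
      let ?a = "blinfun_apply (H' t z) 1" and ?b = "blinfun_apply (H' t z) \<i>"
      let ?g = "blinfun_apply (g' (H t z))"
      have "Im (cnj (?g ?a) * ?g ?b) = jacobian ?g * Im (cnj ?a * ?b)"
        by (rule jacobian_linear) (rule blinfun.bounded_linear_right)
      then show False
        using J0 inv by (simp add: J_def jacobian_def)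
    qed
  qed
  have J0: "J 0 z = 1" for z
  proof -
    have "H 0 = (\<lambda>z. z)"
      using assms by (auto simp: plane_isotopy_def)
    then have "((\<lambda>z. z) has_derivative blinfun_apply (H' 0 z)) (at z)"
      using H'[of 0 z] by simp
    then have "blinfun_apply (H' 0 z) = (\<lambda>z. z)"
      by (rule has_derivative_unique) (rule has_derivative_ident)
    then show ?thesis
      by (simp add: J_def jacobian_def)
  qed
  have pos: "J 1 z > 0" for z
  proof (rule ccontr)
    assume neg: "\<not> J 1 z > 0"
    have "continuous_on {0..1} (\<lambda>t. H' t z)"
    proof -
      have "continuous_on {0..1} ((\<lambda>(t, z). H' t z) \<circ> (\<lambda>t. (t, z)))"
        by (rule continuous_on_compose)
          (auto intro!: continuous_intros continuous_on_subset[OF cont])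
      then show ?thesis
        by (simp add: o_def)
    qed
    then have "continuous_on {0..1} (\<lambda>t. J t z)"
      unfolding J_def jacobian_def by (intro continuous_intros)
    then obtain t where "0 \<le> t" "t \<le> 1" "J t z = 0"
      using IVT2'[of "\<lambda>t. J t z" 1 0 0] neg J0 by auto
    then show False
      using nz by auto
  qed
  show ?thesis
    using that[of "\<lambda>z. blinfun_apply (H' 1 z)"] H'[of 1] pos assms
    by (auto simp: J_def plane_isotopy_def)
qed

lemma circle_reparam_add_int:
  assumes "circle_reparam \<phi>"
  shows "\<phi> (s + of_int m) = \<phi> s + of_int m"
  using periodic_add_int[of "\<lambda>s. \<phi> s - s" s m] assms by (simp add: circle_reparam_def algebra_simps)

lemma circle_reparam_has_derivative:
  assumes "circle_reparam \<phi>"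
  shows "(\<phi> has_vector_derivative vector_derivative \<phi> (at s)) (at s)" "vector_derivative \<phi> (at s) > 0"
  using assms unfolding circle_reparam_def C1_differentiable_on_eq
  by (auto simp: vector_derivative_works)

lemma circle_reparam_strict_mono:
  assumes "circle_reparam \<phi>"
  shows "strict_mono \<phi>"
proof (rule strict_monoI)
  fix x y :: real
  assume "x < y"
  moreover have "\<exists>d. (\<phi> has_real_derivative d) (at s) \<and> d > 0" for s
    using circle_reparam_has_derivative[OF assms, of s]
    unfolding has_real_derivative_iff_has_vector_derivative by blast
  ultimately show "\<phi> x < \<phi> y"
    using DERIV_pos_imp_increasing[of x y \<phi>] by metis
qed

lemma circle_reparam_frac_bij:
  assumes "circle_reparam \<phi>"
  shows "bij_betw (\<lambda>s. frac (\<phi> s)) {0..<1} {0..<1}"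
  unfolding bij_betw_def
proof
  note mono = circle_reparam_strict_mono[OF assms]
  show "inj_on (\<lambda>s. frac (\<phi> s)) {0..<1}"
  proof (rule inj_onI)
    fix x y :: real
    assume xy: "x \<in> {0..<1}" "y \<in> {0..<1}" and eq: "frac (\<phi> x) = frac (\<phi> y)"
    define m where "m = \<lfloor>\<phi> x\<rfloor> - \<lfloor>\<phi> y\<rfloor>"
    have "\<phi> x = \<phi> y + of_int m"
      using eq by (simp add: frac_def m_def)
    then have "\<phi> x = \<phi> (y + of_int m)"
      using circle_reparam_add_int[OF assms] by simp
    then have x: "x = y + of_int m"
      using mono by (simp add: strict_mono_eq)
    then have "\<bar>of_int m :: real\<bar> < 1"
      using xy by auto
    then have "m = 0"
      by linarith
    then show "x = y"
      using x by simp
  qed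
  show "(\<lambda>s. frac (\<phi> s)) ` {0..<1} = {0..<1}"
  proof (intro equalityI subsetI)
    fix u :: real
    assume u: "u \<in> {0..<1}"
    have cont: "continuous_on S \<phi>" for S
      using circle_reparam_has_derivative(1)[OF assms]
      by (meson continuous_at_imp_continuous_on has_vector_derivative_continuous)
    define m where "m = \<lfloor>\<phi> 0 - u\<rfloor>"
    have "\<phi> 0 \<le> u + of_int m + 1" "u + of_int m + 1 \<le> \<phi> 1 + 1"
      using circle_reparam_add_int[OF assms, of 0 1] unfolding m_def by simp_all linarith+
    moreover have "\<phi> 2 = \<phi> 1 + 1"
      using circle_reparam_add_int[OF assms, of 1 1] by simp
    ultimately obtain s where s: "\<phi> s = u + of_int m + 1"
      using IVT'[of \<phi> 0 "u + of_int m + 1" 2] cont by auto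
    have "\<phi> (frac s) = \<phi> s - of_int \<lfloor>s\<rfloor>"
      using circle_reparam_add_int[OF assms, of "frac s" "\<lfloor>s\<rfloor>"] by (simp add: frac_def)
    also have "\<dots> = u + of_int (m + 1 - \<lfloor>s\<rfloor>)"
      using s by simp
    finally have "frac (\<phi> (frac s)) = u"
      using u by (simp add: frac_unique_iff)
    moreover have "frac s \<in> {0..<1}"
      by (simp add: frac_lt_1)
    ultimately show "u \<in> (\<lambda>s. frac (\<phi> s)) ` {0..<1}"
      by force
  qed (auto simp: frac_lt_1)
qed

lemma regular_closed_curve_tangent_frac:
  assumes "regular_closed_curve c"
  shows "c (frac s) = c s" "vector_derivative c (at (frac s)) = vector_derivative c (at s)"
  using periodic_frac[of c] periodic_frac[of "\<lambda>s. vector_derivative c (at s)"]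
    regular_closed_curveD(1,5)[OF assms] by simp_all

text \<open>
  Reparametrizations scale tangents by positive factors and plane isotopies multiply determinants
  by positive ones; neither affects the sign of a crossing.
\<close>

lemma sgn_Im_cnj_rescale:
  fixes a b :: complex and k l j :: real
  assumes "k > 0" "l > 0" "j > 0" and "Im (cnj (k *\<^sub>R a) * (l *\<^sub>R b)) = j * x"
  shows "sgn (Im (cnj a * b)) = sgn x"
proof -
  have "Im (cnj (k *\<^sub>R a) * (l *\<^sub>R b)) = (k * l) * Im (cnj a * b)"
    by (simp add: algebra_simps)
  then have "sgn (k * l) * sgn (Im (cnj a * b)) = sgn j * sgn x"
    using arg_cong[OF assms(4), of sgn] by (simp only: sgn_mult)
  then show ?thesis
    using assms(1-3) by simp
qed

text \<open>
  Parameters correspond by a bijection \<open>F\<close> of the circles, which matches double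
  points because the end map of the isotopy is bijective. Over and under information is only
  prescribed at the crossings of \<open>D\<close>; since every double point of \<open>D'\<close>
  comes from one of \<open>D\<close>, it is determined at all crossings of \<open>D'\<close>.
\<close>

lemma planar_isotopic_card_negative_crossings:
  assumes "planar_isotopic D D'"
  shows "card (negative_crossings D') = card (negative_crossings D)"
proof -
  have D: "is_diagram D" and D': "is_diagram D'" and comps: "comps D' = comps D"
    using assms by (auto simp: planar_isotopic_def)
  obtain H \<pi> \<phi> where H: "plane_isotopy H" and \<pi>: "\<pi> permutes {..<comps D}"
    and \<phi>: "\<And>i. i < comps D \<Longrightarrow> circle_reparam (\<phi> i)"
    and curve: "\<And>i s. i < comps D \<Longrightarrow> curve D' (\<pi> i) (\<phi> i s) = H 1 (curve D i s)"
    and over: "\<And>i s j t. ((i, s), (j, t)) \<in> crossings D \<Longrightarrow>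
           over D' (\<pi> i) (\<phi> i s) \<and> \<not> over D' (\<pi> j) (\<phi> j t)"
    using assms unfolding planar_isotopic_def by fast
  obtain f' where f': "\<And>z. (H 1 has_derivative f' z) (at z)" and jac: "\<And>z. jacobian (f' z) > 0"
    and bijH: "bij (H 1)"
    using plane_isotopy_jacobian_pos[OF H] by blast
  define P where "P = circle_params (comps D)"
  define F where "F = (\<lambda>(i, s). (\<pi> i, frac (\<phi> i s)))"
  have \<pi>_lt: "\<pi> i < comps D" if "i < comps D" for i
    using permutes_in_image[OF \<pi>, of i] that by simp
  have bijF: "bij_betw F P P"
    unfolding bij_betw_def
  proof
    show "inj_on F P"
    proof (rule inj_onI)
      fix p q
      assume pq: "p \<in> P" "q \<in> P" "F p = F q"
      obtain i s j t where ij: "p = (i, s)" "q = (j, t)"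
        by (cases p, cases q)
      have "i = j"
        using pq ij permutes_inj[OF \<pi>] by (auto simp: F_def inj_eq)
      moreover have "inj_on (\<lambda>s. frac (\<phi> i s)) {0..<1}" if "i < comps D"
        using circle_reparam_frac_bij[OF \<phi>[OF that]] by (simp add: bij_betw_def)
      ultimately show "p = q"
        using pq ij by (auto simp: F_def P_def circle_params_def dest: inj_onD)
    qed
    show "F ` P = P"
    proof (intro equalityI subsetI)
      fix q
      assume "q \<in> F ` P"
      then show "q \<in> P"
        using \<pi>_lt by (auto simp: F_def P_def circle_params_def frac_lt_1)
    next
      fix q
      assume q: "q \<in> P"
      obtain j t where jt: "q = (j, t)" "j < comps D" "t \<in> {0..<1}"
        using q by (auto simp: P_def circle_params_def)
      then obtain i where i: "i < comps D" "\<pi> i = j"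
        using permutes_image[OF \<pi>] by (metis imageE lessThan_iff)
      have "t \<in> (\<lambda>s. frac (\<phi> i s)) ` {0..<1}"
        using circle_reparam_frac_bij[OF \<phi>[OF i(1)]] jt by (simp add: bij_betw_def)
      then obtain s where "s \<in> {0..<1}" "frac (\<phi> i s) = t"
        by auto
      then have "F (i, s) = q" "(i, s) \<in> P"
        using i jt by (auto simp: F_def P_def circle_params_def)
      then show "q \<in> F ` P"
        by blast
    qed
  qed
  have reg': "regular_closed_curve (curve D' (\<pi> i))" if "i < comps D" for i
    using is_diagram_curve(1)[OF D'] comps \<pi>_lt[OF that] by simp
  have point: "point D' (F p) = H 1 (point D p)" if p: "p \<in> P" for p
  proof -
    obtain i s where ips: "p = (i, s)" "i < comps D"
      using p by (auto simp: P_def circle_params_def)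
    show ?thesis
      using curve[OF ips(2)] regular_closed_curve_tangent_frac(1)[OF reg'[OF ips(2)]]
      by (simp add: ips(1) F_def point_def)
  qed
  have tangent: "\<exists>k>0. k *\<^sub>R tangent D' (F p) = f' (point D p) (tangent D p)" if p: "p \<in> P" for p
  proof -
    obtain i s where ips: "p = (i, s)" "i < comps D"
      using p by (auto simp: P_def circle_params_def)
    have "((curve D' (\<pi> i) \<circ> \<phi> i) has_vector_derivative
        vector_derivative (\<phi> i) (at s) *\<^sub>R tangent D' (\<pi> i, \<phi> i s)) (at s)"
      using circle_reparam_has_derivative(1)[OF \<phi>[OF ips(2)]]
        is_diagram_has_tangent[OF D'] comps \<pi>_lt[OF ips(2)]
      by (intro vector_diff_chain_at) auto
    moreover have "curve D' (\<pi> i) \<circ> \<phi> i = H 1 \<circ> curve D i"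
      using curve[OF ips(2)] by auto
    moreover have "((H 1 \<circ> curve D i) has_vector_derivative f' (point D p) (tangent D p)) (at s)"
      using vector_derivative_diff_chain_within[of "curve D i" "tangent D (i, s)" s UNIV "H 1" "f' (point D p)"]
        is_diagram_has_tangent[OF D ips(2)] has_derivative_at_withinI[OF f']
      by (simp add: ips point_def)
    ultimately have "vector_derivative (\<phi> i) (at s) *\<^sub>R tangent D' (\<pi> i, \<phi> i s) = f' (point D p) (tangent D p)"
      using vector_derivative_unique_at by metis
    moreover have "tangent D' (\<pi> i, \<phi> i s) = tangent D' (F p)"
      using regular_closed_curve_tangent_frac(2)[OF reg'[OF ips(2)]]
      by (simp add: ips tangent_def F_def)
    ultimately show ?thesis
      using circle_reparam_has_derivative(2)[OF \<phi>[OF ips(2)]] by auto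
  qed
  have over_frac: "is_over D' (F (i, s)) = over D' (\<pi> i) (\<phi> i s)" if "i < comps D" for i s
    using periodic_frac[of "over D' (\<pi> i)"] is_diagram_curve(2)[OF D'] comps \<pi>_lt[OF that]
    by (simp add: F_def is_over_def)
  have double: "(F p, F q) \<in> double_points D' \<longleftrightarrow> (p, q) \<in> double_points D" if "p \<in> P" "q \<in> P" for p q
  proof -
    have "F p \<in> P" "F q \<in> P" "F p = F q \<longleftrightarrow> p = q"
      using bijF that by (auto simp: bij_betw_def dest: inj_onD)
    moreover have "H 1 (point D p) = H 1 (point D q) \<longleftrightarrow> point D p = point D q"
      using bijH by (simp add: bij_def inj_eq)
    ultimately show ?thesis
      using point that by (simp add: double_points_def comps flip: P_def)
  qed
  have cross: "(F p, F q) \<in> crossings D'" if "(p, q) \<in> crossings D" for p q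
  proof -
    have "p \<in> P" "q \<in> P" "(p, q) \<in> double_points D"
      using that by (auto simp: crossings_def double_points_def P_def)
    moreover obtain i s j t where "p = (i, s)" "q = (j, t)"
      by (cases p, cases q)
    ultimately show ?thesis
      using over_frac over[of i s j t] that double[of p q]
      by (auto simp: crossings_def P_def circle_params_def)
  qed
  have crossings: "map_prod F F ` crossings D = crossings D'"
  proof (intro equalityI subsetI)
    fix c
    assume "c \<in> map_prod F F ` crossings D"
    then show "c \<in> crossings D'"
      using cross by auto
  next
    fix c
    assume c: "c \<in> crossings D'"
    then obtain p' q' where c': "c = (p', q')" "p' \<in> P" "q' \<in> P" "(p', q') \<in> double_points D'"
      by (auto simp: crossings_def double_points_def P_def comps)
    then obtain p q where pq: "p' = F p" "q' = F q" "p \<in> P" "q \<in> P"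
      using bijF unfolding bij_betw_def by (metis imageE)
    then have dp: "(p, q) \<in> double_points D"
      using double c' by simp
    have "(q, p) \<notin> crossings D"
      using cross[of q p] c c' pq by (auto simp: crossings_def)
    then have "(p, q) \<in> crossings D"
      using dp double_points_sym[OF dp] is_diagram_transversal(2)[OF D dp] by (auto simp: crossings_def)
    then show "c \<in> map_prod F F ` crossings D"
      using c' pq by force
  qed
  have sign: "crossing_sign D' (map_prod F F c) = crossing_sign D c" if "c \<in> crossings D" for c
  proof -
    obtain p q where c: "c = (p, q)" "p \<in> P" "q \<in> P" "point D p = point D q"
      using \<open>c \<in> crossings D\<close> by (auto simp: crossings_def double_points_def P_def)
    let ?f = "f' (point D p)"
    obtain k l where "k > 0" "l > 0" "k *\<^sub>R tangent D' (F p) = ?f (tangent D p)"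
      "l *\<^sub>R tangent D' (F q) = ?f (tangent D q)"
      using tangent c by metis
    moreover have "Im (cnj (?f (tangent D p)) * ?f (tangent D q)) =
        jacobian ?f * Im (cnj (tangent D p) * tangent D q)"
      using f' by (intro jacobian_linear) (rule has_derivative_bounded_linear)
    ultimately show ?thesis
      using sgn_Im_cnj_rescale[of k l "jacobian ?f" "tangent D' (F p)" "tangent D' (F q)"] jac
      by (simp add: crossing_sign_def c(1))
  qed
  have "map_prod F F ` negative_crossings D = negative_crossings D'"
  proof -
    have "negative_crossings D' = {c \<in> map_prod F F ` crossings D. crossing_sign D' c = - 1}"
      by (simp only: negative_crossings_def crossings)
    then show ?thesis
      using sign by (auto simp: negative_crossings_def)
  qed
  moreover have "inj_on (map_prod F F) (negative_crossings D)"
  proof (rule inj_on_subset)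
    show "inj_on (map_prod F F) (P \<times> P)"
      using bijF by (intro map_prod_inj_on) (auto simp: bij_betw_def)
    show "negative_crossings D \<subseteq> P \<times> P"
      by (auto simp: negative_crossings_def crossings_def double_points_def P_def)
  qed
  ultimately show ?thesis
    by (metis card_image)
qed

section \<open>Effect of the moves\<close>

lemma meets_disc_in_arcs:
  assumes "meets_disc_in D As" "p \<in> circle_params (comps D)"
  shows "point D p \<in> cball 0 1 \<longleftrightarrow> p \<in> (\<Union>\<alpha>\<in>As. arc_params \<alpha>)"
proof -
  have "{p \<in> circle_params (comps D). point D p \<in> cball 0 1} = (\<Union>\<alpha>\<in>As. arc_params \<alpha>)"
    using assms(1) by (simp add: meets_disc_in_def)
  then show ?thesis
    using assms(2) by blast
qed

lemma local_replacement_sym: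
  assumes "local_replacement As D D'"
  shows "local_replacement As D' D"
  using assms unfolding local_replacement_def by simp

text \<open>
  The parameters outside the arcs form an open subset of the circle, so two curves that agree
  there have the same tangents. On the line, the two ends of \<open>{0..<1}\<close> must be glued,
  because the derivative at \<open>0\<close> also depends on parameters slightly below
  \<open>1\<close>.
\<close>

lemma local_replacement_tangent:
  assumes "local_replacement As D D'" "finite As"
    and p: "p \<in> circle_params (comps D)" "p \<notin> (\<Union>\<alpha>\<in>As. arc_params \<alpha>)"
  shows "tangent D' p = tangent D p"
proof -
  have D: "is_diagram D" and D': "is_diagram D'" and comps: "comps D' = comps D"
    and arcs: "\<And>\<alpha>. \<alpha> \<in> As \<Longrightarrow> is_arc D \<alpha>"
    and agree: "\<And>p. p \<in> circle_params (comps D) - (\<Union>\<alpha>\<in>As. arc_params \<alpha>) \<Longrightarrow> point D' p = point D p"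
    using assms(1) unfolding local_replacement_def meets_disc_in_def by blast+
  obtain i s where ips: "p = (i, s)" "i < comps D" "0 \<le> s" "s < 1"
    using p by (auto simp: circle_params_def)
  define B where "B = (\<Union>\<alpha>\<in>{\<alpha> \<in> As. fst \<alpha> = i}. {fst (snd \<alpha>)..snd (snd \<alpha>)})"
  have B: "t \<in> B \<longleftrightarrow> (i, t) \<in> (\<Union>\<alpha>\<in>As. arc_params \<alpha>)" for t
    by (force simp: B_def)
  have B01: "B \<subseteq> {0..<1}"
    using arcs by (force simp: B_def)
  have "closed B"
    unfolding B_def using \<open>finite As\<close> by (intro closed_UN) auto
  \<comment> \<open>the parameters of the component outside the arcs, with the two ends of \<open>{0..<1}\<close> glued\<close>
  define U where "U = - B \<inter> - ((\<lambda>t. t - 1) ` B) \<inter> {-1<..<1}"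
  have "open U"
    unfolding U_def using \<open>closed B\<close> closed_translation_subtract[of B 1] by (intro open_Int) auto
  have "s \<in> U"
    using ips B[of s] p B01 by (force simp: U_def)
  have eq: "curve D' i t = curve D i t" if t: "t \<in> U" for t
  proof -
    have per: "curve D' i (frac t) = curve D' i t" "curve D i (frac t) = curve D i t"
      using regular_closed_curve_tangent_frac(1)[OF is_diagram_curve(1)[OF D ips(2)]]
        regular_closed_curve_tangent_frac(1)[OF is_diagram_curve(1)[OF D', of i]] ips(2) comps
      by simp_all
    have "frac t = t \<or> frac t = t + 1"
    proof (cases "t \<ge> 0")
      case True
      then show ?thesis
        using t by (simp add: U_def frac_eq)
    next
      case False
      then have "\<lfloor>t\<rfloor> = - 1"
        using t by (simp add: U_def floor_eq_iff)
      then show ?thesis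
        by (simp add: frac_def)
    qed
    then have "frac t \<notin> B"
      using t by (force simp: U_def)
    then have "point D' (i, frac t) = point D (i, frac t)"
      using B[of "frac t"] ips by (intro agree) (auto simp: circle_params_def frac_lt_1)
    then show ?thesis
      using per by (simp add: point_def)
  qed
  have "(curve D' i has_vector_derivative tangent D (i, s)) (at s)"
    using has_vector_derivative_transform_within_open[OF is_diagram_has_tangent[OF D ips(2)] \<open>open U\<close> \<open>s \<in> U\<close>]
      eq by simp
  moreover have "(curve D' i has_vector_derivative tangent D' (i, s)) (at s)"
    using is_diagram_has_tangent[OF D'] ips comps by simp
  ultimately show ?thesis
    unfolding ips by (rule vector_derivative_unique_at[symmetric])
qed

lemma local_replacement_outer_crossings_subset:
  assumes "local_replacement As D D'" "finite As"
  shows "negative_crossings D - inner_crossings D \<subseteq> negative_crossings D' - inner_crossings D'"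
proof
  fix c
  assume c: "c \<in> negative_crossings D - inner_crossings D"
  have comps: "comps D' = comps D"
    and agree: "\<And>p. p \<in> circle_params (comps D) - (\<Union>\<alpha>\<in>As. arc_params \<alpha>) \<Longrightarrow>
      point D' p = point D p \<and> is_over D' p = is_over D p"
    and disc: "meets_disc_in D As"
    using assms(1) unfolding local_replacement_def by blast+
  obtain p q where pq: "c = (p, q)"
    by (cases c)
  have P: "p \<in> circle_params (comps D)" "q \<in> circle_params (comps D)" "p \<noteq> q" "point D p = point D q"
    "is_over D p" "\<not> is_over D q" "crossing_sign D (p, q) = - 1"
    using c by (auto simp: pq negative_crossings_def crossings_def double_points_def)
  have out: "point D p \<notin> cball 0 1" "point D q \<notin> cball 0 1"
    using c P(4) by (auto simp: pq negative_crossings_def inner_crossings_def)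
  then have arcs: "p \<notin> (\<Union>\<alpha>\<in>As. arc_params \<alpha>)" "q \<notin> (\<Union>\<alpha>\<in>As. arc_params \<alpha>)"
    using meets_disc_in_arcs[OF disc] P(1,2) by blast+
  have "point D' p = point D p" "point D' q = point D q" "is_over D' p = is_over D p"
    "is_over D' q = is_over D q"
    using agree[of p] agree[of q] P arcs by auto
  moreover have "tangent D' p = tangent D p" "tangent D' q = tangent D q"
    using local_replacement_tangent[OF assms] P arcs by auto
  ultimately show "c \<in> negative_crossings D' - inner_crossings D'"
    using P out comps
    by (auto simp: pq negative_crossings_def crossings_def double_points_def inner_crossings_def crossing_sign_def)
qed

definition inner_negative_crossings :: "diagram \<Rightarrow> ((nat \<times> real) \<times> (nat \<times> real)) set" where
  "inner_negative_crossings D = {c \<in> inner_crossings D. crossing_sign D c = - 1}"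

text \<open>
  Crossings outside the disc are common to both diagrams. The difference of the two numbers is
  written with sums because subtraction of natural numbers truncates.
\<close>

lemma local_replacement_card_negative_crossings:
  assumes "local_replacement As D D'" "finite As"
  shows "card (negative_crossings D') + card (inner_negative_crossings D) =
    card (negative_crossings D) + card (inner_negative_crossings D')"
proof -
  have split: "card (negative_crossings E) =
      card (negative_crossings E - inner_crossings E) + card (inner_negative_crossings E)"
    if "is_diagram E" for E
  proof -
    have "negative_crossings E = (negative_crossings E - inner_crossings E) \<union> inner_negative_crossings E"
      by (auto simp: negative_crossings_def inner_negative_crossings_def inner_crossings_def)
    moreover have "inner_negative_crossings E \<subseteq> negative_crossings E"
      by (auto simp: negative_crossings_def inner_negative_crossings_def inner_crossings_def)
    ultimately show ?thesis
      using finite_negative_crossings[OF that] finite_subset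
      by (metis (no_types, lifting) Diff_disjoint Diff_subset card_Un_disjoint
          inner_negative_crossings_def inf.commute disjoint_iff mem_Collect_eq DiffE)
  qed
  have "negative_crossings D - inner_crossings D = negative_crossings D' - inner_crossings D'"
    using local_replacement_outer_crossings_subset assms local_replacement_sym by blast
  moreover have "is_diagram D" "is_diagram D'"
    using assms(1) by (auto simp: local_replacement_def)
  ultimately show ?thesis
    using split by simp
qed

lemma omega1_card_negative_crossings:
  assumes "omega1 \<delta> D D'"
  shows "card (negative_crossings D') = card (negative_crossings D)"
proof -
  obtain \<alpha> c where r: "local_replacement {\<alpha>} D D'"
    and "inner_crossings D = {}" "inner_crossings D' = {c}" "crossing_sign D' c = 1"
    using assms by (auto simp: omega1_def)
  then have "inner_negative_crossings D = {}" "inner_negative_crossings D' = {}"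
    by (auto simp: inner_negative_crossings_def)
  then show ?thesis
    using local_replacement_card_negative_crossings[OF r] by simp
qed

lemma has_triangle_card_inner_negative_crossings:
  assumes "has_triangle D \<tau> \<mu> \<beta> \<Delta>"
  shows "card (inner_negative_crossings D) = 1"
proof -
  define c1 c2 c3 where "c1 = ((fst \<tau>, tm \<Delta>), (fst \<mu>, mt \<Delta>))"
    and "c2 = ((fst \<mu>, mb \<Delta>), (fst \<beta>, bm \<Delta>))" and "c3 = ((fst \<tau>, tb \<Delta>), (fst \<beta>, bt \<Delta>))"
  have "inner_crossings D = {c1, c2, c3}"
    "crossing_sign D c1 = 1" "crossing_sign D c2 = 1" "crossing_sign D c3 = - 1"
    using assms by (simp_all add: has_triangle_def Let_def c1_def c2_def c3_def)
  then have "inner_negative_crossings D = {c3}"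
    by (auto simp: inner_negative_crossings_def)
  then show ?thesis
    by simp
qed

lemma omega3a_card_negative_crossings:
  assumes "omega3a D D'"
  shows "card (negative_crossings D') = card (negative_crossings D)"
proof -
  obtain \<tau> \<mu> \<beta> \<Delta> \<Delta>' where r: "local_replacement {\<tau>, \<mu>, \<beta>} D D'"
    and "has_triangle D \<tau> \<mu> \<beta> \<Delta>" "has_triangle D' \<tau> \<mu> \<beta> \<Delta>'"
    using assms unfolding omega3a_def by blast
  then show ?thesis
    using local_replacement_card_negative_crossings[OF r] has_triangle_card_inner_negative_crossings
    by simp
qed

lemma upward_chord_tangent:
  assumes "is_diagram D" "is_arc D (i, a, b)" "upward_chord D x (i, a, b)" "s \<in> {a..b}"
  shows "Re (tangent D (i, s)) = 0"
proof -
  have ab: "i < comps D" "a < b" and x: "\<And>s. s \<in> {a..b} \<Longrightarrow> Re (curve D i s) = x"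
    using assms by auto
  have "(curve D i has_vector_derivative tangent D (i, s)) (at s within {a..b})"
    using is_diagram_has_tangent[OF assms(1) ab(1)] has_vector_derivative_at_within by blast
  then have "((\<lambda>s. Re (curve D i s)) has_vector_derivative Re (tangent D (i, s))) (at s within {a..b})"
    by (rule bounded_linear.has_vector_derivative[OF bounded_linear_Re])
  moreover have "((\<lambda>s. Re (curve D i s)) has_vector_derivative 0) (at s within {a..b})"
    by (rule has_vector_derivative_transform[OF assms(4) _ has_vector_derivative_const[of x]])
      (simp add: x)
  ultimately show ?thesis
    using vector_derivative_unique_within_closed_interval ab(2) assms(4)
    by (metis cbox_interval)
qed

text \<open>
  The tangents along both chords are vertical, whereas the branches at a crossing are transversal.
\<close>

lemma upward_chords_inner_crossings:
  assumes D: "is_diagram D" and m: "meets_disc_in D {\<alpha>, \<beta>}"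
    and \<alpha>: "upward_chord D x \<alpha>" and \<beta>: "upward_chord D y \<beta>"
  shows "inner_crossings D = {}"
proof (rule ccontr)
  assume "inner_crossings D \<noteq> {}"
  then obtain p q where pq: "(p, q) \<in> double_points D" "point D p \<in> cball 0 1"
    by (auto simp: inner_crossings_def crossings_def)
  then have P: "p \<in> circle_params (comps D)" "q \<in> circle_params (comps D)" "point D p = point D q"
    by (auto simp: double_points_def)
  obtain i a b j c d where ab: "\<alpha> = (i, a, b)" "\<beta> = (j, c, d)"
    by (cases \<alpha>, cases \<beta>)
  have arcs: "is_arc D \<alpha>" "is_arc D \<beta>"
    using m by (auto simp: meets_disc_in_def)
  have "Re (tangent D r) = 0" if "r \<in> {p, q}" for r
  proof -
    have "r \<in> arc_params \<alpha> \<or> r \<in> arc_params \<beta>"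
      using that meets_disc_in_arcs[OF m, of r] P pq(2) by auto
    then show ?thesis
    proof
      assume "r \<in> arc_params \<alpha>"
      then obtain s where "r = (i, s)" "s \<in> {a..b}"
        by (auto simp: ab)
      then show ?thesis
        using upward_chord_tangent[OF D arcs(1)[unfolded ab] \<alpha>[unfolded ab]] by simp
    next
      assume "r \<in> arc_params \<beta>"
      then obtain s where "r = (j, s)" "s \<in> {c..d}"
        by (auto simp: ab)
      then show ?thesis
        using upward_chord_tangent[OF D arcs(2)[unfolded ab] \<beta>[unfolded ab]] by simp
    qed
  qed
  then show False
    using is_diagram_transversal(1)[OF D pq(1)] by simp
qed

lemma omega2a_card_negative_crossings:
  assumes "omega2a D D'"
  shows "card (negative_crossings D') = Suc (card (negative_crossings D))"
proof -
  obtain \<alpha> \<beta> c1 c2 where r: "local_replacement {\<alpha>, \<beta>} D D'"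
    and ch: "upward_chord D (- 1 / 2) \<alpha>" "upward_chord D (1 / 2) \<beta>"
    and c: "inner_crossings D' = {c1, c2}" "crossing_sign D' c1 = 1" "crossing_sign D' c2 = - 1"
    using assms unfolding omega2a_def by blast
  have "inner_crossings D = {}"
    using upward_chords_inner_crossings[OF _ _ ch] r by (simp add: local_replacement_def)
  then have "inner_negative_crossings D = {}"
    by (auto simp: inner_negative_crossings_def)
  moreover have "inner_negative_crossings D' = {c2}"
    using c by (auto simp: inner_negative_crossings_def)
  ultimately show ?thesis
    using local_replacement_card_negative_crossings[OF r] by simp
qed

lemma step_card_negative_crossings:
  assumes "step A D D'"
  shows "Omega2a_up \<notin> A \<Longrightarrow> card (negative_crossings D') \<le> card (negative_crossings D)"
    and "Omega2a_down \<notin> A \<Longrightarrow> card (negative_crossings D) \<le> card (negative_crossings D')"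
proof -
  consider "planar_isotopic D D'" | m where "m \<in> A" "performs m D D'"
    using assms by (auto simp: step_def)
  then have "(Omega2a_up \<notin> A \<longrightarrow> card (negative_crossings D') \<le> card (negative_crossings D)) \<and>
    (Omega2a_down \<notin> A \<longrightarrow> card (negative_crossings D) \<le> card (negative_crossings D'))"
  proof cases
    case 1
    then show ?thesis
      using planar_isotopic_card_negative_crossings by simp
  next
    case 2
    then show ?thesis
      by (cases m) (auto simp: omega1a_def omega1b_def dest: omega1_card_negative_crossings
          omega2a_card_negative_crossings omega3a_card_negative_crossings)
  qed
  then show "Omega2a_up \<notin> A \<Longrightarrow> card (negative_crossings D') \<le> card (negative_crossings D)"
    and "Omega2a_down \<notin> A \<Longrightarrow> card (negative_crossings D) \<le> card (negative_crossings D')"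
    by auto
qed

lemma generating_needs_omega2a:
  assumes "generating L A" "diagram_of L D" "diagram_of L D'"
    and "card (negative_crossings D) < card (negative_crossings D')"
  shows "Omega2a_up \<in> A" "Omega2a_down \<in> A"
proof -
  have steps: "(step A)\<^sup>*\<^sup>* D D'" "(step A)\<^sup>*\<^sup>* D' D"
    using assms by (auto simp: generating_def)
  show "Omega2a_up \<in> A"
  proof (rule ccontr)
    assume n: "Omega2a_up \<notin> A"
    have "card (negative_crossings D') \<le> card (negative_crossings D)"
      using steps(1) by (induction rule: rtranclp_induct)
        (auto dest: step_card_negative_crossings(1)[OF _ n])
    then show False
      using assms by simp
  qed
  show "Omega2a_down \<in> A"
  proof (rule ccontr)
    assume n: "Omega2a_down \<notin> A"
    have "card (negative_crossings D') \<le> card (negative_crossings D)"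
      using steps(2) by (induction rule: rtranclp_induct)
        (auto dest: step_card_negative_crossings(2)[OF _ n])
    then show False
      using assms by simp
  qed
qed

section \<open>Margins of embedded links\<close>

lemma mean_value_vector:
  fixes f :: "real \<Rightarrow> 'a::real_normed_vector"
  assumes "\<And>x. x \<in> closed_segment s t \<Longrightarrow> (f has_vector_derivative f' x) (at x)"
    and "\<And>x. x \<in> closed_segment s t \<Longrightarrow> norm (f' x - v) \<le> B"
  shows "norm (f s - f t - (s - t) *\<^sub>R v) \<le> B * \<bar>s - t\<bar>"
proof -
  have "norm ((\<lambda>x. f x - x *\<^sub>R v) s - (\<lambda>x. f x - x *\<^sub>R v) t) \<le> B * norm (s - t)"
  proof (rule differentiable_bound)
    show "convex (closed_segment s t)"
      by simp
    fix x
    assume x: "x \<in> closed_segment s t"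
    have "((\<lambda>x. f x - x *\<^sub>R v) has_vector_derivative f' x - v) (at x)"
      using assms(1)[OF x] by (auto intro!: derivative_eq_intros)
    then show "((\<lambda>x. f x - x *\<^sub>R v) has_derivative (\<lambda>h. h *\<^sub>R (f' x - v))) (at x within closed_segment s t)"
      unfolding has_vector_derivative_def by (rule has_derivative_at_withinI)
    show "onorm (\<lambda>h. h *\<^sub>R (f' x - v)) \<le> B"
    proof (rule onorm_le)
      fix h :: real
      show "norm (h *\<^sub>R (f' x - v)) \<le> B * norm h"
        using mult_right_mono[OF assms(2)[OF x], of "\<bar>h\<bar>"] by (simp add: mult.commute)
    qed
  qed auto
  then show ?thesis
    by (simp add: algebra_simps)
qed

lemma periodic_uniformly_continuous:
  fixes f :: "real \<Rightarrow> 'a::real_normed_vector"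
  assumes per: "\<And>s. f (s + 1) = f s" and cont: "continuous_on UNIV f"
  shows "uniformly_continuous_on UNIV f"
  unfolding uniformly_continuous_on_def
proof (intro allI impI)
  fix e :: real
  assume "e > 0"
  have "uniformly_continuous_on {- 1..2} f"
    using compact_uniformly_continuous continuous_on_subset[OF cont] by blast
  then obtain d where d: "d > 0" "\<And>x y. x \<in> {- 1..2} \<Longrightarrow> y \<in> {- 1..2} \<Longrightarrow> dist y x < d \<Longrightarrow> dist (f y) (f x) < e"
    using \<open>e > 0\<close> unfolding uniformly_continuous_on_def by metis
  show "\<exists>d>0. \<forall>x\<in>UNIV. \<forall>y\<in>UNIV. dist y x < d \<longrightarrow> dist (f y) (f x) < e"
  proof (intro exI conjI ballI impI)
    fix x y :: real
    assume xy: "dist y x < min d 1"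
    define m where "m = \<lfloor>x\<rfloor>"
    have "f (x + of_int (- m)) = f x" "f (y + of_int (- m)) = f y"
      using periodic_add_int[of f, OF per] by blast+
    moreover have "x + of_int (- m) \<in> {- 1..2}" "y + of_int (- m) \<in> {- 1..2}"
      using xy unfolding m_def dist_real_def by (simp; linarith)+
    ultimately show "dist (f y) (f x) < e"
      using d(2)[of "x + of_int (- m)" "y + of_int (- m)"] xy by (simp add: dist_real_def)
  qed (use d in auto)
qed

lemma periodic_bounded_below:
  fixes f :: "real \<Rightarrow> real"
  assumes per: "\<And>s. f (s + 1) = f s" and cont: "continuous_on UNIV f" and pos: "\<And>s. f s > 0"
  obtains m where "m > 0" "\<And>s. m \<le> f s"
proof -
  obtain x where x: "\<forall>y\<in>{0..1}. f x \<le> f y"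
    using continuous_attains_inf[of "{0..1}" f] continuous_on_subset[OF cont] by auto
  have "f x \<le> f s" for s
    using x[rule_format, of "frac s"] periodic_frac[of f s, OF per] frac_lt_1[of s]
    by (simp add: less_imp_le)
  then show ?thesis
    using that[of "f x"] pos by blast
qed

text \<open>
  On short intervals the velocity is almost constant, so a chord is almost the velocity times the
  elapsed parameter.
\<close>

lemma regular_closed_curve_locally_bilipschitz:
  fixes c :: "real \<Rightarrow> 'a::real_normed_vector"
  assumes "regular_closed_curve c"
  obtains \<eta> m where "\<eta> > 0" "m > 0" "\<And>s t. \<bar>s - t\<bar> < \<eta> \<Longrightarrow> m * \<bar>s - t\<bar> \<le> norm (c s - c t)"
proof -
  note c = regular_closed_curveD[OF assms]
  let ?c' = "\<lambda>s. vector_derivative c (at s)"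
  obtain m where m: "m > 0" "\<And>s. m \<le> norm (?c' s)"
    using periodic_bounded_below[of "\<lambda>s. norm (?c' s)"] c
    by (metis continuous_on_norm zero_less_norm_iff)
  obtain \<eta> where \<eta>: "\<eta> > 0" "\<And>x y. dist x y < \<eta> \<Longrightarrow> dist (?c' x) (?c' y) < m / 2"
    using periodic_uniformly_continuous[of ?c', OF c(5) c(3)] m(1)
    unfolding uniformly_continuous_on_def by (metis UNIV_I half_gt_zero_iff)
  have "m / 2 * \<bar>s - t\<bar> \<le> norm (c s - c t)" if st: "\<bar>s - t\<bar> < \<eta>" for s t
  proof -
    have "norm (?c' x - ?c' t) \<le> m / 2" if "x \<in> closed_segment s t" for x
    proof -
      have "dist x t < \<eta>"
        using segment_bound(2)[OF that] st by (simp add: dist_norm norm_minus_commute)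
      then show ?thesis
        using \<eta>(2) by (simp add: dist_norm less_imp_le)
    qed
    then have "norm (c s - c t - (s - t) *\<^sub>R ?c' t) \<le> m / 2 * \<bar>s - t\<bar>"
      using mean_value_vector[of s t c ?c' "?c' t" "m / 2"] c(2) by blast
    moreover have "m * \<bar>s - t\<bar> \<le> norm ((s - t) *\<^sub>R ?c' t)"
      using mult_right_mono[OF m(2)[of t] abs_ge_zero[of "s - t"]] by (simp add: mult.commute)
    moreover have "norm ((s - t) *\<^sub>R ?c' t) \<le> norm (c s - c t) + norm (c s - c t - (s - t) *\<^sub>R ?c' t)"
      by (metis norm_minus_commute norm_triangle_sub add.commute)
    ultimately show ?thesis
      by simp
  qed
  then show ?thesis
    using that[of \<eta> "m / 2"] \<eta>(1) m(1) by simp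
qed

text \<open>
  Serves to choose one margin for all components of a link and all pairs of components.
\<close>

lemma finite_uniform_pos:
  assumes "finite S" and "\<And>i. i \<in> S \<Longrightarrow> \<exists>m>0. P i m"
    and "\<And>i m m'. P i m \<Longrightarrow> 0 < m' \<Longrightarrow> m' \<le> m \<Longrightarrow> P i (m' :: real)"
  shows "\<exists>m>0. \<forall>i\<in>S. P i m"
  using assms(1,2)
proof (induction S)
  case empty
  show ?case
    by (rule exI[of _ 1]) simp
next
  case (insert j S)
  then obtain m where m: "m > 0" "\<forall>i\<in>S. P i m"
    by blast
  obtain m' where m': "m' > 0" "P j m'"
    using insert by blast
  have "P j (min m m')"
    using assms(3)[OF m'(2), of "min m m'"] m m' by simp
  moreover have "P i (min m m')" if "i \<in> S" for i
    using assms(3)[of i m "min m m'"] m m' that by simp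
  moreover have "min m m' > 0"
    using m m' by simp
  ultimately show ?case
    by blast
qed

text \<open>
  For near parameters this is the local estimate; the chords between distant parameters have a
  positive minimum by compactness.
\<close>

lemma simple_closed_curve_bilipschitz:
  fixes c :: "real \<Rightarrow> 'a::real_normed_vector"
  assumes c: "regular_closed_curve c" and inj: "inj_on c {0..<1}"
  shows "\<exists>m>0. \<forall>s t. \<bar>s - t\<bar> \<le> 1 / 2 \<longrightarrow> m * \<bar>s - t\<bar> \<le> norm (c s - c t)"
proof -
  note cD = regular_closed_curveD[OF c]
  obtain \<eta> m where \<eta>: "\<eta> > 0" "m > 0" "\<And>s t. \<bar>s - t\<bar> < \<eta> \<Longrightarrow> m * \<bar>s - t\<bar> \<le> norm (c s - c t)"
    using regular_closed_curve_locally_bilipschitz[OF c] by blast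
  let ?e = "min \<eta> (1 / 2)"
  let ?f = "\<lambda>(s, d). norm (c (s + d) - c s)"
  have "continuous_on ({0..1} \<times> {?e..1 / 2}) ?f"
    unfolding case_prod_unfold
    by (intro continuous_intros continuous_on_compose2[OF cD(6)]) auto
  moreover have "compact ({0..1::real} \<times> {?e..1 / 2})" "{0..1::real} \<times> {?e..1 / 2} \<noteq> {}"
    by (auto intro: compact_Times)
  ultimately obtain p where p: "p \<in> {0..1} \<times> {?e..1 / 2}" "\<And>q. q \<in> {0..1} \<times> {?e..1 / 2} \<Longrightarrow> ?f p \<le> ?f q"
    using continuous_attains_inf[of "{0..1} \<times> {?e..1 / 2}" ?f] by blast
  have "?f p > 0"
  proof -
    obtain s d where sd: "p = (s, d)" "d \<in> {?e..1 / 2}"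
      using p(1) by auto
    have "frac (s + d) \<noteq> frac s"
    proof
      assume "frac (s + d) = frac s"
      then have "d = of_int (\<lfloor>s + d\<rfloor> - \<lfloor>s\<rfloor>)"
        by (simp add: frac_def)
      moreover have "0 < d" "d < 1"
        using sd(2) \<eta>(1) by auto
      ultimately have "0 < \<lfloor>s + d\<rfloor> - \<lfloor>s\<rfloor>" "\<lfloor>s + d\<rfloor> - \<lfloor>s\<rfloor> < 1"
        by linarith+
      then show False
        by simp
    qed
    moreover have "frac (s + d) \<in> {0..<1}" "frac s \<in> {0..<1}"
      by (simp_all add: frac_lt_1)
    ultimately have "c (frac (s + d)) \<noteq> c (frac s)"
      using inj by (meson inj_onD)
    then show ?thesis
      using periodic_frac[of c, OF cD(1)] by (simp add: sd)
  qed
  have far: "?f p \<le> norm (c (s + d) - c s)" if "d \<in> {?e..1 / 2}" for s d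
  proof -
    have "?f p \<le> norm (c (frac s + d) - c (frac s))"
      using p(2)[of "(frac s, d)"] that frac_lt_1[of s] by (simp add: less_imp_le)
    moreover have "c (frac s + d) = c (s + d)" "c (frac s) = c s"
      using periodic_add_int[of c, OF cD(1), of "s + d" "- \<lfloor>s\<rfloor>"]
        periodic_add_int[of c, OF cD(1), of s "- \<lfloor>s\<rfloor>"] by (simp_all add: frac_def algebra_simps)
    ultimately show ?thesis
      by simp
  qed
  have "min m (?f p) * \<bar>s - t\<bar> \<le> norm (c s - c t)" if st: "\<bar>s - t\<bar> \<le> 1 / 2" for s t
  proof (cases "\<bar>s - t\<bar> < \<eta>")
    case True
    then show ?thesis
      using \<eta>(3)[OF True] mult_right_mono[of "min m (?f p)" m "\<bar>s - t\<bar>"] by linarith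
  next
    case False
    have "?f p \<le> norm (c s - c t)"
    proof (cases "s \<ge> t")
      case True
      then show ?thesis
        using far[of "s - t" t] False st by simp
    next
      case False
      then show ?thesis
        using far[of "t - s" s] \<open>\<not> \<bar>s - t\<bar> < \<eta>\<close> st by (simp add: norm_minus_commute)
    qed
    moreover have "min m (?f p) * \<bar>s - t\<bar> \<le> ?f p * 1"
      using st \<open>?f p > 0\<close> \<eta>(2) by (intro mult_mono) auto
    ultimately show ?thesis
      by linarith
  qed
  moreover have "min m (?f p) > 0"
    using \<open>?f p > 0\<close> \<eta>(2) by simp
  ultimately show ?thesis
    by blast
qed

lemma disjoint_closed_curves_margin:
  fixes c d :: "real \<Rightarrow> 'a::real_normed_vector"
  assumes c: "regular_closed_curve c" and d: "regular_closed_curve d"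
    and disj: "\<And>s t. s \<in> {0..<1} \<Longrightarrow> t \<in> {0..<1} \<Longrightarrow> c s \<noteq> d t"
  shows "\<exists>m>0. \<forall>s t. m \<le> norm (c s - d t)"
proof -
  note cD = regular_closed_curveD[OF c] and dD = regular_closed_curveD[OF d]
  let ?f = "\<lambda>(s, t). norm (c s - d t)"
  have "continuous_on ({0..1} \<times> {0..1}) ?f"
    unfolding case_prod_unfold
    by (intro continuous_intros continuous_on_compose2[OF cD(6)] continuous_on_compose2[OF dD(6)]) auto
  moreover have "compact ({0..1::real} \<times> {0..1::real})"
    by (auto intro: compact_Times)
  ultimately obtain p where p: "\<And>q. q \<in> {0..1} \<times> {0..1} \<Longrightarrow> ?f p \<le> ?f q"
    using continuous_attains_inf[of "{0..1} \<times> {0..1}" ?f] by auto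
  have shift: "c (frac s) = c s" "d (frac s) = d s" for s
    using periodic_frac cD(1) dD(1) by metis+
  have "?f p \<le> norm (c s - d t)" for s t
    using p[of "(frac s, frac t)"] frac_lt_1[of s] frac_lt_1[of t] by (simp add: less_imp_le shift)
  moreover have "?f p > 0"
    using disj[of "frac (fst p)" "frac (snd p)"] by (simp add: case_prod_unfold frac_lt_1 shift)
  ultimately show ?thesis
    by blast
qed

text \<open>
  The margin quantifies embeddedness in such a way that it survives \<open>C\<^sup>1\<close>-small
  perturbations: near the diagonal it bounds chords by the parameter distance, not by a constant.
\<close>

lemma link_margin:
  assumes "is_link L"
  obtains m where "m > 0"
    "\<And>i s t. i < link_comps L \<Longrightarrow> \<bar>s - t\<bar> \<le> 1 / 2 \<Longrightarrow> m * \<bar>s - t\<bar> \<le> norm (strand L i s - strand L i t)"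
    "\<And>i j s t. i < link_comps L \<Longrightarrow> j < link_comps L \<Longrightarrow> i \<noteq> j \<Longrightarrow> m \<le> norm (strand L i s - strand L j t)"
    "\<And>i s. i < link_comps L \<Longrightarrow> m \<le> norm (vector_derivative (strand L i) (at s))"
proof -
  have reg: "\<And>i. i < link_comps L \<Longrightarrow> regular_closed_curve (strand L i)"
    and inj: "inj_on (\<lambda>(i, s). strand L i s) (circle_params (link_comps L))"
    using assms by (auto simp: is_link_def)
  have neq: "strand L i s \<noteq> strand L j t"
    if "i < link_comps L" "j < link_comps L" "s \<in> {0..<1}" "t \<in> {0..<1}" "(i, s) \<noteq> (j, t)" for i j s t
    using inj_onD[OF inj, of "(i, s)" "(j, t)"] that by (auto simp: circle_params_def)
  have "\<exists>m>0. \<forall>i\<in>{..<link_comps L}. \<forall>s t. \<bar>s - t\<bar> \<le> 1 / 2 \<longrightarrow> m * \<bar>s - t\<bar> \<le> norm (strand L i s - strand L i t)"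
  proof (rule finite_uniform_pos)
    fix i
    assume "i \<in> {..<link_comps L}"
    then have i: "i < link_comps L"
      by simp
    have "inj_on (strand L i) {0..<1}"
    proof (rule inj_onI, rule ccontr)
      fix s t :: real
      assume "s \<in> {0..<1}" "t \<in> {0..<1}" "strand L i s = strand L i t" "s \<noteq> t"
      then show False
        using neq[OF i i, of s t] by simp
    qed
    then show "\<exists>m>0. \<forall>s t. \<bar>s - t\<bar> \<le> 1 / 2 \<longrightarrow> m * \<bar>s - t\<bar> \<le> norm (strand L i s - strand L i t)"
      by (rule simple_closed_curve_bilipschitz[OF reg[OF i]])
  next
    fix i :: nat and m m' :: real
    assume *: "\<forall>s t. \<bar>s - t\<bar> \<le> 1 / 2 \<longrightarrow> m * \<bar>s - t\<bar> \<le> norm (strand L i s - strand L i t)" "m' \<le> m"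
    show "\<forall>s t. \<bar>s - t\<bar> \<le> 1 / 2 \<longrightarrow> m' * \<bar>s - t\<bar> \<le> norm (strand L i s - strand L i t)"
      using * mult_right_mono[OF *(2) abs_ge_zero] by (meson order_trans)
  qed simp
  then obtain m1 where m1: "m1 > 0" "\<And>i s t. i < link_comps L \<Longrightarrow> \<bar>s - t\<bar> \<le> 1 / 2 \<Longrightarrow>
      m1 * \<bar>s - t\<bar> \<le> norm (strand L i s - strand L i t)"
    by auto
  have "\<exists>m>0. \<forall>p\<in>{p \<in> {..<link_comps L} \<times> {..<link_comps L}. fst p \<noteq> snd p}.
      \<forall>s t. m \<le> norm (strand L (fst p) s - strand L (snd p) t)"
  proof (rule finite_uniform_pos)
    fix p
    assume "p \<in> {p \<in> {..<link_comps L} \<times> {..<link_comps L}. fst p \<noteq> snd p}"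
    then show "\<exists>m>0. \<forall>s t. m \<le> norm (strand L (fst p) s - strand L (snd p) t)"
      using reg neq by (intro disjoint_closed_curves_margin) auto
  qed (auto intro: order_trans)
  then obtain m2 where m2: "m2 > 0" "\<And>i j s t. i < link_comps L \<Longrightarrow> j < link_comps L \<Longrightarrow> i \<noteq> j \<Longrightarrow>
      m2 \<le> norm (strand L i s - strand L j t)"
    by force
  have "\<exists>m>0. \<forall>i\<in>{..<link_comps L}. \<forall>s. m \<le> norm (vector_derivative (strand L i) (at s))"
  proof (rule finite_uniform_pos)
    fix i
    assume "i \<in> {..<link_comps L}"
    then have i: "regular_closed_curve (strand L i)"
      using reg by simp
    show "\<exists>m>0. \<forall>s. m \<le> norm (vector_derivative (strand L i) (at s))"
      using periodic_bounded_below[of "\<lambda>s. norm (vector_derivative (strand L i) (at s))"]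
        regular_closed_curveD(3-5)[OF i] by (metis continuous_on_norm zero_less_norm_iff)
  qed (auto intro: order_trans)
  then obtain m3 where m3: "m3 > 0" "\<And>i s. i < link_comps L \<Longrightarrow>
      m3 \<le> norm (vector_derivative (strand L i) (at s))"
    by auto
  show ?thesis
  proof (rule that[of "min m1 (min m2 m3)"])
    fix i and s t :: real
    assume "i < link_comps L" "\<bar>s - t\<bar> \<le> 1 / 2"
    then show "min m1 (min m2 m3) * \<bar>s - t\<bar> \<le> norm (strand L i s - strand L i t)"
      using m1(2)[of i s t] mult_right_mono[of "min m1 (min m2 m3)" m1 "\<bar>s - t\<bar>"] by linarith
  qed (use m1(1) m2 m3 in \<open>auto simp: min.coboundedI2 min_le_iff_disj\<close>)
qed

section \<open>Isotopies\<close>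

definition blend :: "real \<Rightarrow> link \<Rightarrow> link \<Rightarrow> link" where
  "blend t L K = \<lparr>link_comps = link_comps L,
     strand = \<lambda>i s. (1 - t) *\<^sub>R strand L i s + t *\<^sub>R strand K i s\<rparr>"

lemma blend_simps [simp]:
  "link_comps (blend t L K) = link_comps L"
  "strand (blend t L K) i s = (1 - t) *\<^sub>R strand L i s + t *\<^sub>R strand K i s"
  by (simp_all add: blend_def)

lemma blend_vector_derivative:
  assumes "(strand L i has_vector_derivative v) (at s)" "(strand K i has_vector_derivative w) (at s)"
  shows "(strand (blend t L K) i has_vector_derivative (1 - t) *\<^sub>R v + t *\<^sub>R w) (at s)"
  using assms by (auto simp: blend_def intro!: derivative_eq_intros)

lemma straight_line_isotopic:
  assumes "link_comps K = link_comps L" and link: "\<And>t. t \<in> {0..1} \<Longrightarrow> is_link (blend t L K)"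
  shows "link_isotopic L K"
proof -
  have blend0: "blend 0 L K = L" and blend1: "blend 1 L K = K"
    using assms(1) by (simp_all add: blend_def)
  have L: "is_link L" and K: "is_link K"
    using link[of 0] link[of 1] by (simp_all add: blend0 blend1)
  have "continuous_on ({0..1} \<times> UNIV) (\<lambda>(t, s). strand (blend t L K) i s)"
    and "continuous_on ({0..1} \<times> UNIV) (\<lambda>(t, s). vector_derivative (strand (blend t L K) i) (at s))"
    if i: "i < link_comps L" for i
  proof -
    have reg: "regular_closed_curve (strand L i)" "regular_closed_curve (strand K i)"
      using L K i assms(1) by (auto simp: is_link_def)
    note l = regular_closed_curveD[OF reg(1)] and k = regular_closed_curveD[OF reg(2)]
    show "continuous_on ({0..1} \<times> UNIV) (\<lambda>(t, s). strand (blend t L K) i s)"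
      unfolding case_prod_unfold blend_simps
      by (intro continuous_intros continuous_on_compose2[OF l(6)] continuous_on_compose2[OF k(6)]) auto
    have "vector_derivative (strand (blend t L K) i) (at s) =
        (1 - t) *\<^sub>R vector_derivative (strand L i) (at s) + t *\<^sub>R vector_derivative (strand K i) (at s)" for t s
      by (rule vector_derivative_at[OF blend_vector_derivative[OF l(2) k(2)]])
    then show "continuous_on ({0..1} \<times> UNIV) (\<lambda>(t, s). vector_derivative (strand (blend t L K) i) (at s))"
      unfolding case_prod_unfold
      by (simp only:)
        (intro continuous_intros continuous_on_compose2[OF l(3)] continuous_on_compose2[OF k(3)]; auto)
  qed
  then have "\<forall>i<link_comps L.
           strand (blend 0 L K) i = strand L i \<and> strand (blend 1 L K) i = strand K (id i) \<and>
           continuous_on ({0..1} \<times> UNIV) (\<lambda>(t, s). strand (blend t L K) i s) \<and>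
           continuous_on ({0..1} \<times> UNIV)
             (\<lambda>(t, s). vector_derivative (strand (blend t L K) i) (at s))"
    by (simp add: blend0 blend1 del: blend_simps)
  moreover have "\<forall>t\<in>{0..1}. is_link (blend t L K) \<and> link_comps (blend t L K) = link_comps L"
    using link by simp
  ultimately show ?thesis
    unfolding link_isotopic_def using L K assms(1) permutes_id[of "{..<link_comps L}"]
    by (intro conjI exI[of _ "\<lambda>t. blend t L K"] exI[of _ id]) assumption+
qed

lemma is_link_renumber:
  assumes "is_link L" "\<pi> permutes {..<link_comps L}"
  shows "is_link \<lparr>link_comps = link_comps L, strand = \<lambda>i. strand L (\<pi> i)\<rparr>"
proof -
  have lt: "\<pi> i < link_comps L" if "i < link_comps L" for i
    using permutes_in_image[OF assms(2), of i] that by simp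
  have "inj_on ((\<lambda>(i, s). strand L i s) \<circ> map_prod \<pi> id) (circle_params (link_comps L))"
  proof (rule comp_inj_on)
    show "inj_on (map_prod \<pi> (id :: real \<Rightarrow> real)) (circle_params (link_comps L))"
      using prod.inj_map[OF permutes_inj[OF assms(2)] inj_on_id] by (rule inj_on_subset) simp
    show "inj_on (\<lambda>(i, s). strand L i s) (map_prod \<pi> id ` circle_params (link_comps L))"
    proof (rule inj_on_subset)
      show "inj_on (\<lambda>(i, s). strand L i s) (circle_params (link_comps L))"
        using assms(1) by (simp add: is_link_def)
    qed (auto simp: circle_params_def lt)
  qed
  moreover have "(\<lambda>(i, s). strand L i s) \<circ> map_prod \<pi> id = (\<lambda>(i, s). strand L (\<pi> i) s)"
    by auto
  ultimately show ?thesis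
    using assms(1) lt by (simp add: is_link_def)
qed

lemma continuous_on_concatenate:
  fixes f g :: "real \<Rightarrow> 'a::topological_space \<Rightarrow> 'b::topological_space"
  assumes f: "continuous_on ({0..1} \<times> UNIV) (\<lambda>(t, s). f t s)"
    and g: "continuous_on ({0..1} \<times> UNIV) (\<lambda>(t, s). g t s)"
    and fg: "\<And>s. f 1 s = g 0 s"
  shows "continuous_on ({0..1} \<times> UNIV) (\<lambda>(t, s). if t \<le> 1 / 2 then f (2 * t) s else g (2 * t - 1) s)"
proof -
  let ?h = "\<lambda>p. if fst p \<le> 1 / 2 then f (2 * fst p) (snd p) else g (2 * fst p - 1) (snd p)"
  have f1: "continuous_on ({0..1 / 2} \<times> UNIV) (\<lambda>p. f (2 * fst p) (snd p))"
  proof -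
    have "continuous_on ({0..1 / 2} \<times> UNIV) ((\<lambda>(t, s). f t s) \<circ> (\<lambda>p. (2 * fst p, snd p)))"
      by (rule continuous_on_compose)
        (auto intro!: continuous_intros continuous_on_subset[OF f])
    then show ?thesis
      by (simp add: o_def)
  qed
  have g1: "continuous_on ({1 / 2..1} \<times> UNIV) (\<lambda>p. g (2 * fst p - 1) (snd p))"
  proof -
    have "continuous_on ({1 / 2..1} \<times> UNIV) ((\<lambda>(t, s). g t s) \<circ> (\<lambda>p. (2 * fst p - 1, snd p)))"
      by (rule continuous_on_compose)
        (auto intro!: continuous_intros continuous_on_subset[OF g])
    then show ?thesis
      by (simp add: o_def)
  qed
  have "continuous_on (({0..1 / 2} \<times> UNIV) \<union> ({1 / 2..1} \<times> UNIV)) ?h"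
  proof (rule continuous_on_cases)
    show "closed ({0..1 / 2 :: real} \<times> (UNIV :: 'a set))" "closed ({1 / 2..1 :: real} \<times> (UNIV :: 'a set))"
      by (auto intro: closed_Times)
    show "\<forall>p. p \<in> {0..1 / 2} \<times> UNIV \<and> \<not> fst p \<le> 1 / 2 \<or> p \<in> {1 / 2..1} \<times> UNIV \<and> fst p \<le> 1 / 2 \<longrightarrow>
        f (2 * fst p) (snd p) = g (2 * fst p - 1) (snd p)"
    proof (intro allI impI)
      fix p :: "real \<times> 'a"
      assume "p \<in> {0..1 / 2} \<times> UNIV \<and> \<not> fst p \<le> 1 / 2 \<or> p \<in> {1 / 2..1} \<times> UNIV \<and> fst p \<le> 1 / 2"
      then have "2 * fst p = 1"
        by auto
      then show "f (2 * fst p) (snd p) = g (2 * fst p - 1) (snd p)"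
        using fg by (simp only: diff_self)
    qed
  qed (use f1 g1 in auto)
  moreover have "({0..1 / 2} \<times> UNIV) \<union> ({1 / 2..1} \<times> UNIV) = ({0..1::real} \<times> (UNIV :: 'a set))"
    by auto
  ultimately show ?thesis
    by (simp only: case_prod_unfold)
qed

lemma link_isotopic_trans:
  assumes "link_isotopic L K" "link_isotopic K M"
  shows "link_isotopic L M"
proof -
  have links: "is_link L" "is_link M" and n: "link_comps K = link_comps L" "link_comps M = link_comps L"
    using assms by (auto simp: link_isotopic_def)
  obtain \<Gamma>1 :: "real \<Rightarrow> link" and \<pi>1 where \<pi>1: "\<pi>1 permutes {..<link_comps L}"
    and \<Gamma>1: "\<And>t. t \<in> {0..1} \<Longrightarrow> is_link (\<Gamma>1 t) \<and> link_comps (\<Gamma>1 t) = link_comps L"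
    and s1: "\<And>i. i < link_comps L \<Longrightarrow> strand (\<Gamma>1 0) i = strand L i \<and> strand (\<Gamma>1 1) i = strand K (\<pi>1 i)"
    and c1: "\<And>i. i < link_comps L \<Longrightarrow> continuous_on ({0..1} \<times> UNIV) (\<lambda>(t, s). strand (\<Gamma>1 t) i s)"
    and d1: "\<And>i. i < link_comps L \<Longrightarrow> continuous_on ({0..1} \<times> UNIV)
             (\<lambda>(t, s). vector_derivative (strand (\<Gamma>1 t) i) (at s))"
    using assms(1) unfolding link_isotopic_def by fast
  obtain \<Gamma>2 :: "real \<Rightarrow> link" and \<pi>2 where \<pi>2: "\<pi>2 permutes {..<link_comps L}"
    and \<Gamma>2: "\<And>t. t \<in> {0..1} \<Longrightarrow> is_link (\<Gamma>2 t) \<and> link_comps (\<Gamma>2 t) = link_comps L"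
    and s2: "\<And>i. i < link_comps L \<Longrightarrow> strand (\<Gamma>2 0) i = strand K i \<and> strand (\<Gamma>2 1) i = strand M (\<pi>2 i)"
    and c2: "\<And>i. i < link_comps L \<Longrightarrow> continuous_on ({0..1} \<times> UNIV) (\<lambda>(t, s). strand (\<Gamma>2 t) i s)"
    and d2: "\<And>i. i < link_comps L \<Longrightarrow> continuous_on ({0..1} \<times> UNIV)
             (\<lambda>(t, s). vector_derivative (strand (\<Gamma>2 t) i) (at s))"
    using assms(2) unfolding link_isotopic_def n by fast
  have lt: "\<pi>1 i < link_comps L" if "i < link_comps L" for i
    using permutes_in_image[OF \<pi>1, of i] that by simp
  define \<Gamma> where "\<Gamma> t = (if t \<le> 1 / 2 then \<Gamma>1 (2 * t)
    else \<lparr>link_comps = link_comps L, strand = \<lambda>i. strand (\<Gamma>2 (2 * t - 1)) (\<pi>1 i)\<rparr>)" for t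
  have "\<forall>t\<in>{0..1}. is_link (\<Gamma> t) \<and> link_comps (\<Gamma> t) = link_comps L"
  proof
    fix t :: real
    assume t: "t \<in> {0..1}"
    show "is_link (\<Gamma> t) \<and> link_comps (\<Gamma> t) = link_comps L"
    proof (cases "t \<le> 1 / 2")
      case True
      then show ?thesis
        using \<Gamma>1[of "2 * t"] t by (simp add: \<Gamma>_def)
    next
      case False
      then have "is_link (\<Gamma>2 (2 * t - 1))" "link_comps (\<Gamma>2 (2 * t - 1)) = link_comps L"
        using \<Gamma>2[of "2 * t - 1"] t by simp_all
      then show ?thesis
        using is_link_renumber[of "\<Gamma>2 (2 * t - 1)" \<pi>1] \<pi>1 False by (simp add: \<Gamma>_def)
    qed
  qed
  moreover have "\<forall>i<link_comps L. strand (\<Gamma> 0) i = strand L i \<and> strand (\<Gamma> 1) i = strand M ((\<pi>2 \<circ> \<pi>1) i) \<and>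
           continuous_on ({0..1} \<times> UNIV) (\<lambda>(t, s). strand (\<Gamma> t) i s) \<and>
           continuous_on ({0..1} \<times> UNIV) (\<lambda>(t, s). vector_derivative (strand (\<Gamma> t) i) (at s))"
  proof (intro allI impI conjI)
    fix i
    assume i: "i < link_comps L"
    have ends: "strand (\<Gamma>1 1) i = strand (\<Gamma>2 0) (\<pi>1 i)"
      using s1[OF i] s2[OF lt[OF i]] by simp
    have eq: "strand (\<Gamma> t) i = (if t \<le> 1 / 2 then strand (\<Gamma>1 (2 * t)) i else strand (\<Gamma>2 (2 * t - 1)) (\<pi>1 i))" for t
      by (simp add: \<Gamma>_def)
    show "strand (\<Gamma> 0) i = strand L i" "strand (\<Gamma> 1) i = strand M ((\<pi>2 \<circ> \<pi>1) i)"
      using s1[OF i] s2[OF lt[OF i]] by (simp_all add: eq)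
    show "continuous_on ({0..1} \<times> UNIV) (\<lambda>(t, s). strand (\<Gamma> t) i s)"
      using continuous_on_concatenate[OF c1[OF i] c2[OF lt[OF i]]] ends
      by (simp add: eq if_distrib[of "\<lambda>f. f _"])
    show "continuous_on ({0..1} \<times> UNIV) (\<lambda>(t, s). vector_derivative (strand (\<Gamma> t) i) (at s))"
      using continuous_on_concatenate[OF d1[OF i] d2[OF lt[OF i]]] ends
      by (simp add: eq if_distrib[of "\<lambda>f. vector_derivative f _"])
  qed
  moreover have "\<pi>2 \<circ> \<pi>1 permutes {..<link_comps L}"
    using \<pi>1 \<pi>2 by (rule permutes_compose)
  ultimately show ?thesis
    unfolding link_isotopic_def using links n(2)
    by (intro conjI exI[of _ \<Gamma>] exI[of _ "\<pi>2 \<circ> \<pi>1"]) assumption+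
qed

text \<open>
  The difference of two \<open>C\<^sup>1\<close>-close curves has a Lipschitz constant that is
  small compared with the margin of the link. It can therefore cancel no chord between near
  parameters, where closeness of the points alone would not suffice.
\<close>

lemma link_C1_close_isotopic:
  assumes L: "is_link L"
  obtains \<delta> where "\<delta> > 0"
    "\<And>K k'. link_comps K = link_comps L \<Longrightarrow>
      (\<And>i s. i < link_comps L \<Longrightarrow> strand K i (s + 1) = strand K i s) \<Longrightarrow>
      (\<And>i s. i < link_comps L \<Longrightarrow> (strand K i has_vector_derivative k' i s) (at s)) \<Longrightarrow>
      (\<And>i. i < link_comps L \<Longrightarrow> continuous_on UNIV (k' i)) \<Longrightarrow>
      (\<And>i s. i < link_comps L \<Longrightarrow> norm (strand K i s - strand L i s) \<le> \<delta>) \<Longrightarrow>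
      (\<And>i s. i < link_comps L \<Longrightarrow> norm (k' i s - vector_derivative (strand L i) (at s)) \<le> \<delta>) \<Longrightarrow>
      link_isotopic L K"
proof -
  obtain m where m: "m > 0"
    "\<And>i s t. i < link_comps L \<Longrightarrow> \<bar>s - t\<bar> \<le> 1 / 2 \<Longrightarrow> m * \<bar>s - t\<bar> \<le> norm (strand L i s - strand L i t)"
    "\<And>i j s t. i < link_comps L \<Longrightarrow> j < link_comps L \<Longrightarrow> i \<noteq> j \<Longrightarrow> m \<le> norm (strand L i s - strand L j t)"
    "\<And>i s. i < link_comps L \<Longrightarrow> m \<le> norm (vector_derivative (strand L i) (at s))"
    using link_margin[OF L] by blast
  show ?thesis
  proof (rule that[of "m / 4"])
    fix K :: link and k'
    assume n: "link_comps K = link_comps L"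
      and per: "\<And>i s. i < link_comps L \<Longrightarrow> strand K i (s + 1) = strand K i s"
      and k': "\<And>i s. i < link_comps L \<Longrightarrow> (strand K i has_vector_derivative k' i s) (at s)"
      and k'_cont: "\<And>i. i < link_comps L \<Longrightarrow> continuous_on UNIV (k' i)"
      and close: "\<And>i s. i < link_comps L \<Longrightarrow> norm (strand K i s - strand L i s) \<le> m / 4"
      and close': "\<And>i s. i < link_comps L \<Longrightarrow> norm (k' i s - vector_derivative (strand L i) (at s)) \<le> m / 4"
    have reg: "regular_closed_curve (strand L i)" if "i < link_comps L" for i
      using L that by (simp add: is_link_def)
    let ?e = "\<lambda>i s. strand K i s - strand L i s"
    let ?l' = "\<lambda>i s. vector_derivative (strand L i) (at s)"
    have e_lip: "norm (?e i s - ?e i t) \<le> m / 4 * \<bar>s - t\<bar>" if i: "i < link_comps L" for i s t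
    proof -
      have "(?e i has_vector_derivative k' i x - ?l' i x) (at x)" for x
        using k'[OF i] regular_closed_curveD(2)[OF reg[OF i]] by (intro has_vector_derivative_diff)
      then show ?thesis
        using mean_value_vector[of s t "?e i" "\<lambda>x. k' i x - ?l' i x" 0 "m / 4"] close'[OF i] by simp
    qed
    have link: "is_link (blend t L K)" if t: "t \<in> {0..1}" for t
    proof -
      have b: "strand (blend t L K) i s = strand L i s + t *\<^sub>R ?e i s" for i s
        by (simp add: algebra_simps)
      have near: "strand (blend t L K) i s \<noteq> strand (blend t L K) i r"
        if i: "i < link_comps L" and sr: "\<bar>s - r\<bar> \<le> 1 / 2" "s \<noteq> r" for i s r
      proof
        assume "strand (blend t L K) i s = strand (blend t L K) i r"
        then have "strand L i s - strand L i r = - (t *\<^sub>R (?e i s - ?e i r))"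
          unfolding b by (simp add: algebra_simps)
        then have "norm (strand L i s - strand L i r) = t * norm (?e i s - ?e i r)"
          using t by simp
        also have "\<dots> \<le> 1 * norm (?e i s - ?e i r)"
          using t by (intro mult_right_mono) auto
        also have "\<dots> \<le> m / 4 * \<bar>s - r\<bar>"
          using e_lip[OF i] by simp
        also have "\<dots> < m * \<bar>s - r\<bar>"
          using m(1) sr(2) by simp
        finally show False
          using m(2)[OF i sr(1)] by simp
      qed
      have far: "strand (blend t L K) i s \<noteq> strand (blend t L K) j r"
        if i: "i < link_comps L" "j < link_comps L" "i \<noteq> j" for i j s r
      proof
        assume "strand (blend t L K) i s = strand (blend t L K) j r"
        then have "strand L i s - strand L j r = t *\<^sub>R (?e j r - ?e i s)"
          unfolding b by (simp add: algebra_simps)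
        then have "norm (strand L i s - strand L j r) = t * norm (?e j r - ?e i s)"
          using t by simp
        also have "\<dots> \<le> 1 * norm (?e j r - ?e i s)"
          using t by (intro mult_right_mono) auto
        also have "\<dots> \<le> m / 4 + m / 4"
          using norm_triangle_ineq4[of "?e j r" "?e i s"] close[OF i(2), of r] close[OF i(1), of s] by linarith
        finally show False
          using m(3)[OF i, of s r] m(1) by simp
      qed
      have per': "strand (blend t L K) i (s + 1) = strand (blend t L K) i s" if "i < link_comps L" for i s
        using per[OF that] regular_closed_curveD(1)[OF reg[OF that]] by simp
      have "regular_closed_curve (strand (blend t L K) i)" if i: "i < link_comps L" for i
      proof (rule regular_closed_curveI)
        show "strand (blend t L K) i (s + 1) = strand (blend t L K) i s" for s
          by (rule per'[OF i])
        show "(strand (blend t L K) i has_vector_derivative (1 - t) *\<^sub>R ?l' i s + t *\<^sub>R k' i s) (at s)" for s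
          by (rule blend_vector_derivative[OF regular_closed_curveD(2)[OF reg[OF i]] k'[OF i]])
        show "continuous_on UNIV (\<lambda>s. (1 - t) *\<^sub>R ?l' i s + t *\<^sub>R k' i s)"
          using k'_cont[OF i] regular_closed_curveD(3)[OF reg[OF i]] by (intro continuous_intros)
        fix s
        have "(1 - t) *\<^sub>R ?l' i s + t *\<^sub>R k' i s = ?l' i s + t *\<^sub>R (k' i s - ?l' i s)"
          by (simp add: algebra_simps)
        moreover have "norm (t *\<^sub>R (k' i s - ?l' i s)) \<le> 1 * (m / 4)"
          unfolding norm_scaleR using t close'[OF i, of s] by (intro mult_mono) auto
        moreover have "norm (?l' i s) > m / 4"
          using m(4)[OF i, of s] m(1) by simp
        ultimately show "(1 - t) *\<^sub>R ?l' i s + t *\<^sub>R k' i s \<noteq> 0"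
          by (metis add_eq_0_iff linorder_not_less mult_1 norm_minus_cancel)
      qed
      moreover have "inj_on (\<lambda>(i, s). strand (blend t L K) i s) (circle_params (link_comps L))"
      proof (rule inj_onI, rule ccontr)
        fix p q
        assume pq: "p \<in> circle_params (link_comps L)" "q \<in> circle_params (link_comps L)" "p \<noteq> q"
          and eq: "(case p of (i, s) \<Rightarrow> strand (blend t L K) i s) = (case q of (i, s) \<Rightarrow> strand (blend t L K) i s)"
        obtain i s j r where ij: "p = (i, s)" "q = (j, r)"
          by (cases p, cases q)
        then have lt: "i < link_comps L" "j < link_comps L" and sr: "0 \<le> s" "s < 1" "0 \<le> r" "r < 1"
          using pq by (auto simp: circle_params_def)
        have eq': "strand (blend t L K) i s = strand (blend t L K) j r"
          using eq ij by (simp del: blend_simps)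
        then have "i = j"
          using far[OF lt] by blast
        then have "s \<noteq> r" "strand (blend t L K) i s = strand (blend t L K) i r"
          using pq ij eq' by simp_all
        moreover have "strand (blend t L K) i (s + 1) = strand (blend t L K) i s"
          "strand (blend t L K) i (r + 1) = strand (blend t L K) i r"
          using per'[OF lt(1)] by blast+
        moreover have "\<bar>s - r\<bar> \<le> 1 / 2 \<or> \<bar>(s + 1) - r\<bar> \<le> 1 / 2 \<or> \<bar>s - (r + 1)\<bar> \<le> 1 / 2"
          using sr by linarith
        moreover have "s + 1 \<noteq> r" "s \<noteq> r + 1"
          using sr by auto
        ultimately show False
          using near[OF lt(1), of s r] near[OF lt(1), of "s + 1" r] near[OF lt(1), of s "r + 1"]
          by (simp del: blend_simps) argo
      qed
      ultimately show ?thesis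
        using L by (simp add: is_link_def del: blend_simps(2))
    qed
    show "link_isotopic L K"
      by (rule straight_line_isotopic[OF n link])
  qed (use m(1) in simp)
qed

section \<open>General position of plane curves\<close>

lemma negligible_iff_AE_lborel: "negligible S \<longleftrightarrow> (AE x in lborel. x \<notin> S)"
proof -
  have "negligible S \<longleftrightarrow> (AE x in lebesgue. x \<notin> S)"
  proof
    assume "negligible S"
    then show "AE x in lebesgue. x \<notin> S"
      by (simp add: negligible_iff_null_sets AE_not_in)
  next
    assume "AE x in lebesgue. x \<notin> S"
    then obtain N where "N \<in> null_sets lebesgue" "S \<subseteq> N"
      unfolding eventually_ae_filter by auto
    then show "negligible S"
      using negligible_iff_null_sets negligible_subset by blast
  qed
  then show ?thesis
    by (simp add: AE_completion_iff)
qed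

text \<open>
  Fubini's theorem for null sets, without measurability assumptions on the set.
\<close>

lemma negligible_slices:
  fixes T :: "('a::euclidean_space \<times> 'b::euclidean_space) set"
  assumes "negligible T"
  shows "negligible {x. \<not> negligible (Pair x -` T)}"
proof -
  have "AE p in lborel \<Otimes>\<^sub>M lborel. p \<notin> T"
    unfolding lborel_prod using assms by (simp only: negligible_iff_AE_lborel)
  then have "AE x in lborel. AE y in lborel. (x, y) \<notin> T"
    by (rule lborel_pair.AE_pair)
  then show ?thesis
    by (simp add: negligible_iff_AE_lborel)
qed

lemma negligible_avoid_ball:
  fixes S :: "'a::euclidean_space set"
  assumes "negligible S" "\<delta> > 0"
  obtains x where "norm x < \<delta>" "x \<notin> S"
proof -
  have "\<not> ball 0 \<delta> \<subseteq> S"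
    using negligible_subset[OF assms(1)] open_not_negligible[of "ball 0 \<delta> :: 'a set"] assms(2) by auto
  then obtain x where "x \<in> ball 0 \<delta>" "x \<notin> S"
    by blast
  then show ?thesis
    using that[of x] by simp
qed

text \<open>
  Plane vectors \<open>A\<close> and \<open>B\<close> with vanishing determinant are linearly
  dependent, so all points of \<open>S\<close> are critical.
\<close>

lemma baby_Sard_plane:
  fixes f :: "real \<times> real \<Rightarrow> complex"
  assumes der: "\<And>p. p \<in> S \<Longrightarrow> (f has_derivative (\<lambda>h. fst h *\<^sub>R A p + snd h *\<^sub>R B p)) (at p)"
    and dep: "\<And>p. p \<in> S \<Longrightarrow> Im (cnj (A p) * B p) = 0"
  shows "negligible (f ` S)"
proof -
  define \<psi> :: "real^2 \<Rightarrow> real \<times> real" where "\<psi> v = (v $ 1, v $ 2)" for v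
  define \<phi> :: "complex \<Rightarrow> real^2" where "\<phi> w = vector [Re w, Im w]" for w
  define \<rho> :: "real^2 \<Rightarrow> complex" where "\<rho> v = Complex (v $ 1) (v $ 2)" for v
  have lin_\<psi>: "bounded_linear \<psi>"
    unfolding \<psi>_def by (intro bounded_linear_Pair bounded_linear_vec_nth)
  have lin_\<phi>: "linear \<phi>" 
    by (rule linearI) (simp_all add: \<phi>_def vec_eq_iff forall_2)
  have lin_\<rho>: "linear \<rho>"
    by (rule linearI) (simp_all add: \<rho>_def complex_eq_iff)
  let ?S = "\<psi> -` S"
  let ?g = "\<lambda>v. \<phi> (f (\<psi> v))"
  let ?g' = "\<lambda>(v :: real^2) (h :: real^2). \<phi> (h $ 1 *\<^sub>R A (\<psi> v) + h $ 2 *\<^sub>R B (\<psi> v))"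
  have "negligible (?g ` ?S)"
  proof (rule baby_Sard)
    fix v
    assume v: "v \<in> ?S"
    have "(f \<circ> \<psi> has_derivative (\<lambda>h. fst h *\<^sub>R A (\<psi> v) + snd h *\<^sub>R B (\<psi> v)) \<circ> \<psi>) (at v)"
      using der[of "\<psi> v"] v lin_\<psi>
      by (intro diff_chain_at bounded_linear_imp_has_derivative) auto
    then have "(\<phi> \<circ> (f \<circ> \<psi>) has_derivative \<phi> \<circ> ((\<lambda>h. fst h *\<^sub>R A (\<psi> v) + snd h *\<^sub>R B (\<psi> v)) \<circ> \<psi>)) (at v)"
      by (rule diff_chain_at[OF _ linear_imp_has_derivative[OF lin_\<phi>]])
    then have d: "(?g has_derivative ?g' v) (at v)"
      by (simp add: o_def \<psi>_def)
    then show "(?g has_derivative ?g' v) (at v within ?S)"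
      by (rule has_derivative_at_withinI)
    have lin: "linear (?g' v)"
      using d by (rule has_derivative_linear)
    let ?a = "A (\<psi> v)" and ?b = "B (\<psi> v)"
    have nz: "(vector [1, 0] :: real^2) \<noteq> 0" "(vector [x, 1] :: real^2) \<noteq> 0" for x
      by (metis vector_2 zero_index zero_neq_one)+
    have "\<exists>h :: real^2. h \<noteq> 0 \<and> ?g' v h = 0"
    proof (cases "?a = 0")
      case True
      then show ?thesis
        by (intro exI[of _ "vector [1, 0]"]) (simp add: nz, simp add: vec_eq_iff forall_2 \<phi>_def)
    next
      case False
      have "Im (cnj ?a * ?b) = 0"
        using dep v by simp
      moreover define r where "r = Re (cnj ?a * ?b) / (cmod ?a)\<^sup>2"
      ultimately have "cnj ?a * ?b = of_real (r * (cmod ?a)\<^sup>2)"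
        using False by (simp add: complex_eq_iff)
      also have "\<dots> = cnj ?a * (of_real r * ?a)"
        by (simp only: of_real_mult complex_norm_square mult.commute mult.left_commute mult.assoc)
      finally have "?b = r *\<^sub>R ?a"
        using False by (simp add: scaleR_conv_of_real)
      then show ?thesis
        by (intro exI[of _ "vector [- r, 1]"]) (simp add: nz, simp add: vec_eq_iff forall_2 \<phi>_def)
    qed
    then have "\<not> inj (?g' v)"
      using lin linear_injective_0 by blast
    moreover have "(*v) (matrix (?g' v)) = ?g' v"
      using matrix_works[of "?g' v"] lin by (simp add: fun_eq_iff)
    ultimately show "rank (matrix (?g' v)) < CARD(2)"
      unfolding less_rank_noninjective by (simp only: not_False_eq_True)
  qed simp
  then have "negligible (\<rho> ` ?g ` ?S)"
    by (intro negligible_differentiable_image_negligible[of "?g ` ?S" \<rho>]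
        linear_imp_differentiable_on lin_\<rho>) simp_all
  moreover have "f ` S \<subseteq> \<rho> ` ?g ` ?S"
  proof
    fix w
    assume "w \<in> f ` S"
    then obtain p where p: "p \<in> S" "w = f p"
      by auto
    then have "vector [fst p, snd p] \<in> ?S" "w = \<rho> (?g (vector [fst p, snd p]))"
      by (simp_all add: \<psi>_def \<rho>_def \<phi>_def)
    then show "w \<in> \<rho> ` ?g ` ?S"
      by blast
  qed
  ultimately show ?thesis
    using negligible_subset by blast
qed

text \<open>
  The components move on concentric circles with different radii. Thus different points of the
  circles have different values \<open>orbit i s\<close>, and Vandermonde determinants in these
  values do not vanish, whichever components the points belong to.
\<close>

definition orbit :: "nat \<Rightarrow> real \<Rightarrow> complex" where
  "orbit i s = of_nat (Suc i) * cis (2 * pi * s)"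

lemma orbit_has_vector_derivative:
  "(orbit i has_vector_derivative 2 * pi * \<i> * orbit i s) (at s)"
proof -
  have "((\<lambda>s. (2 * pi * \<i>) * of_real s) has_vector_derivative 2 * pi * \<i>) (at s)"
    by (auto intro!: derivative_eq_intros)
  then have "((exp \<circ> (\<lambda>s. (2 * pi * \<i>) * of_real s)) has_vector_derivative
      (2 * pi * \<i>) * exp ((2 * pi * \<i>) * of_real s)) (at s)"
    by (rule field_vector_diff_chain_at) (rule DERIV_exp)
  then have "((\<lambda>s. of_nat (Suc i) * exp ((2 * pi * \<i>) * of_real s)) has_vector_derivative
      of_nat (Suc i) * ((2 * pi * \<i>) * exp ((2 * pi * \<i>) * of_real s))) (at s)"
    unfolding o_def by (rule has_vector_derivative_mult_right)
  moreover have "orbit i t = of_nat (Suc i) * exp ((2 * pi * \<i>) * of_real t)" for t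
    by (simp add: orbit_def cis_conv_exp mult_ac)
  ultimately show ?thesis
    by (simp only: orbit_def[abs_def] mult.left_commute)
qed

lemma norm_orbit: "norm (orbit i s) = Suc i"
  by (simp add: orbit_def norm_mult del: of_nat_Suc)

lemma orbit_nonzero: "orbit i s \<noteq> 0"
  using norm_orbit[of i s] by auto

lemma orbit_eq_iff: "orbit i s = orbit j t \<longleftrightarrow> i = j \<and> s - t \<in> \<int>"
proof
  assume eq: "orbit i s = orbit j t"
  then have "i = j"
    using norm_orbit[of i s] norm_orbit[of j t] by simp
  then have "cis (2 * pi * s) = cis (2 * pi * t)"
    using eq by (simp add: orbit_def del: of_nat_Suc)
  then have "cis (2 * pi * s) / cis (2 * pi * t) = 1"
    by simp
  then have "cis (2 * pi * (s - t)) = 1"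
    by (simp add: cis_divide algebra_simps)
  then have "cos (2 * pi * (s - t)) = 1"
    by (metis cis.sel(1) one_complex.sel(1))
  then obtain m :: int where "2 * pi * (s - t) = of_int m * 2 * pi"
    unfolding cos_one_2pi_int by blast
  then have "s - t = of_int m"
    by simp
  then show "i = j \<and> s - t \<in> \<int>"
    using \<open>i = j\<close> by simp
next
  assume st: "i = j \<and> s - t \<in> \<int>"
  then obtain m where "s - t = of_int m"
    by (auto elim: Ints_cases)
  then have "s = t + of_int m"
    by simp
  then have "cis (2 * pi * s) = cis (2 * pi * t) * cis (2 * pi * of_int m)"
    by (simp add: cis_mult algebra_simps)
  then show "orbit i s = orbit j t"
    using st by (simp add: orbit_def)
qed

lemma negligible_finite_UN:
  assumes "finite I" "\<And>i. i \<in> I \<Longrightarrow> negligible (S i)"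
  shows "negligible (\<Union>i\<in>I. S i)"
  using assms by (intro negligible_Union) auto

definition perturbed :: "(nat \<Rightarrow> real \<Rightarrow> complex) \<Rightarrow> complex \<Rightarrow> complex \<Rightarrow> nat \<Rightarrow> real \<Rightarrow> complex" where
  "perturbed z a b i s = z i s + a * orbit i s + b * (orbit i s)\<^sup>2"

definition perturbed_deriv :: "(nat \<Rightarrow> real \<Rightarrow> complex) \<Rightarrow> complex \<Rightarrow> complex \<Rightarrow> nat \<Rightarrow> real \<Rightarrow> complex" where
  "perturbed_deriv z' a b i s = z' i s + 2 * pi * \<i> * (a * orbit i s + 2 * b * (orbit i s)\<^sup>2)"

text \<open>
  The three conditions exclude singular points, tangential double points and triple points;
  comparing values of \<open>orbit\<close> compares points of the circles. The function
  \<open>y'\<close> stands for the derivative of \<open>y\<close>.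
\<close>

definition general_position :: "nat \<Rightarrow> (nat \<Rightarrow> real \<Rightarrow> complex) \<Rightarrow> (nat \<Rightarrow> real \<Rightarrow> complex) \<Rightarrow> bool" where
  "general_position n y y' \<longleftrightarrow>
     (\<forall>i<n. \<forall>s. y' i s \<noteq> 0) \<and>
     (\<forall>i<n. \<forall>j<n. \<forall>s t. orbit i s \<noteq> orbit j t \<and> y i s = y j t \<longrightarrow> Im (cnj (y' i s) * y' j t) \<noteq> 0) \<and>
     (\<forall>i<n. \<forall>j<n. \<forall>k<n. \<forall>s t u. orbit i s \<noteq> orbit j t \<and> orbit i s \<noteq> orbit k u \<and> orbit j t \<noteq> orbit k u \<and>
        y i s = y j t \<longrightarrow> y i s \<noteq> y k u)"

text \<open>
  A triple point imposes two linear equations on \<open>(a, b)\<close> that can be solved because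
  the values of \<open>orbit\<close> are distinct. The exceptional pairs are thus differentiable
  functions of three real parameters and negligible in a space of real dimension four, and by
  Fubini's theorem \<open>b\<close> can be fixed such that the exceptional \<open>a\<close> are
  negligible. For this \<open>b\<close>, branches \<open>i\<close> and \<open>j\<close> meet at
  the parameters \<open>(s, t)\<close> exactly if \<open>a = F i j (s, t)\<close>, and the partial
  derivatives of \<open>F i j\<close> are the tangents of the two branches up to a common complex
  factor and a sign. Tangential double points thus belong to critical values of \<open>F i
  j\<close>. Singular points exclude finitely many curves of values of \<open>a\<close>; these are
  differentiable because \<open>z\<close> is twice differentiable.
\<close>

lemma generic_perturbation:
  fixes z z' z'' :: "nat \<Rightarrow> real \<Rightarrow> complex"
  assumes z: "\<And>i s. i < n \<Longrightarrow> (z i has_vector_derivative z' i s) (at s)"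
    and z': "\<And>i s. i < n \<Longrightarrow> (z' i has_vector_derivative z'' i s) (at s)"
    and "\<delta> > 0"
  shows "\<exists>a b. norm a < \<delta> \<and> norm b < \<delta> \<and> general_position n (perturbed z a b) (perturbed_deriv z' a b)"
proof -
  let ?y = "perturbed z" and ?y' = "perturbed_deriv z'"
  have diff: "(\<lambda>p. f (g p)) differentiable (at p within S)"
    if "(f has_vector_derivative v) (at (g p))" "g differentiable (at p within S)"
    for f :: "real \<Rightarrow> complex" and g :: "'x::real_normed_vector \<Rightarrow> real" and v p S
    using differentiable_compose[OF _ that(2), of f] that(1)
    by (auto simp: has_vector_derivative_def differentiable_def)
  note diff_orbit = diff[OF orbit_has_vector_derivative]
  \<comment> \<open>the pairs that create a triple point; \<open>b\<close> comes first because slices for fixed \<open>b\<close> are needed\<close>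
  define d where "d = (\<lambda>i s j t. (z i s - z j t) / (orbit i s - orbit j t))"
  define G where "G = (\<lambda>i j k (s, t, u).
    let b = - (d i s j t - d i s k u) / (orbit j t - orbit k u)
    in (b, - d i s j t - b * (orbit i s + orbit j t)))"
  define T where "T = (\<Union>i<n. \<Union>j<n. \<Union>k<n. G i j k `
    {(s, t, u). orbit i s \<noteq> orbit j t \<and> orbit i s \<noteq> orbit k u \<and> orbit j t \<noteq> orbit k u})"
  have "negligible T"
    unfolding T_def
  proof (intro negligible_finite_UN finite_lessThan)
    fix i j k
    assume "i \<in> {..<n}" "j \<in> {..<n}" "k \<in> {..<n}"
    then have ijk: "i < n" "j < n" "k < n"
      by auto
    let ?S = "{(s, t, u). orbit i s \<noteq> orbit j t \<and> orbit i s \<noteq> orbit k u \<and> orbit j t \<noteq> orbit k u}"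
    show "negligible (G i j k ` ?S)"
    proof (rule negligible_differentiable_image_lowdim)
      show "G i j k differentiable_on ?S"
        unfolding differentiable_on_def
      proof
        fix p
        assume p: "p \<in> ?S"
        have proj: "fst differentiable (at p within ?S)" "(\<lambda>p. fst (snd p)) differentiable (at p within ?S)"
          "(\<lambda>p. snd (snd p)) differentiable (at p within ?S)"
          by (intro bounded_linear_imp_differentiable bounded_linear_intros)+
        note dz = diff[OF z[OF ijk(1)] proj(1)] diff[OF z[OF ijk(2)] proj(2)] diff[OF z[OF ijk(3)] proj(3)]
          diff_orbit[OF proj(1), of i] diff_orbit[OF proj(2), of j] diff_orbit[OF proj(3), of k]
        have "(\<lambda>p. let b = - (d i (fst p) j (fst (snd p)) - d i (fst p) k (snd (snd p))) /
              (orbit j (fst (snd p)) - orbit k (snd (snd p)))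
            in (b, - d i (fst p) j (fst (snd p)) - b * (orbit i (fst p) + orbit j (fst (snd p)))))
          differentiable (at p within ?S)"
          unfolding Let_def d_def using p
          by (intro differentiable_Pair differentiable_diff differentiable_minus differentiable_mult
              differentiable_divide differentiable_add dz) auto
        then show "G i j k differentiable (at p within ?S)"
          by (simp add: G_def case_prod_unfold)
      qed
    qed simp
  qed
  then obtain b where b: "norm b < \<delta>" "negligible (Pair b -` T)"
    using negligible_avoid_ball[OF negligible_slices \<open>\<delta> > 0\<close>] by blast
  \<comment> \<open>the values of \<open>a\<close> that create a singular point\<close>
  define N where "N = (\<Union>i<n. range (\<lambda>s. - z' i s / (2 * pi * \<i> * orbit i s) - 2 * b * orbit i s))"
  have "negligible N"
    unfolding N_def
  proof (intro negligible_finite_UN finite_lessThan negligible_differentiable_image_lowdim)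
    fix i
    assume "i \<in> {..<n}"
    then have i: "i < n"
      by simp
    show "(\<lambda>s. - z' i s / (2 * pi * \<i> * orbit i s) - 2 * b * orbit i s) differentiable_on UNIV"
      unfolding differentiable_on_def using orbit_nonzero
      by (intro ballI differentiable_diff differentiable_divide differentiable_minus differentiable_mult
          differentiable_const diff[OF z'[OF i]] diff_orbit differentiable_ident) auto
  qed simp
  \<comment> \<open>the values of \<open>a\<close> that create a double point are those of \<open>F\<close>, the tangential ones its critical values\<close>
  define F where "F = (\<lambda>i j p. - d i (fst p) j (snd p) - b * (orbit i (fst p) + orbit j (snd p)))"
  define C where "C = (\<lambda>i j. {p. orbit i (fst p) \<noteq> orbit j (snd p) \<and>
    Im (cnj (?y' (F i j p) b i (fst p)) * ?y' (F i j p) b j (snd p)) = 0})"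
  have F_eq: "F i j (s, t) = a \<longleftrightarrow> ?y a b i s = ?y a b j t" if "orbit i s \<noteq> orbit j t" for a i s j t
    using that by (simp add: F_def d_def perturbed_def field_simps power2_eq_square) auto
  have crit: "negligible (F i j ` C i j)" if ij: "i < n" "j < n" for i j
  proof (rule baby_Sard_plane)
    fix p
    assume p: "p \<in> C i j"
    let ?o = "orbit i (fst p) - orbit j (snd p)"
    let ?A = "- ?y' (F i j p) b i (fst p) / ?o" and ?B = "?y' (F i j p) b j (snd p) / ?o"
    have o: "?o \<noteq> 0"
      using p by (simp add: C_def)
    have dz: "((\<lambda>p. z i (fst p)) has_derivative (\<lambda>h. fst h *\<^sub>R z' i (fst p))) (at p)"
      "((\<lambda>p. z j (snd p)) has_derivative (\<lambda>h. snd h *\<^sub>R z' j (snd p))) (at p)"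
      "((\<lambda>p. orbit i (fst p)) has_derivative (\<lambda>h. fst h *\<^sub>R (2 * pi * \<i> * orbit i (fst p)))) (at p)"
      "((\<lambda>p. orbit j (snd p)) has_derivative (\<lambda>h. snd h *\<^sub>R (2 * pi * \<i> * orbit j (snd p)))) (at p)"
      using z[OF ij(1)] z[OF ij(2)] orbit_has_vector_derivative[of i] orbit_has_vector_derivative[of j]
      unfolding has_vector_derivative_def
      by (auto intro!: has_derivative_compose[of fst fst] has_derivative_compose[of snd snd] has_derivative_fst has_derivative_snd)
    let ?D = "\<lambda>h. - (((fst h *\<^sub>R z' i (fst p) - snd h *\<^sub>R z' j (snd p)) * ?o -
        (z i (fst p) - z j (snd p)) *
        (fst h *\<^sub>R (2 * pi * \<i> * orbit i (fst p)) - snd h *\<^sub>R (2 * pi * \<i> * orbit j (snd p)))) / (?o * ?o)) -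
      b * (fst h *\<^sub>R (2 * pi * \<i> * orbit i (fst p)) + snd h *\<^sub>R (2 * pi * \<i> * orbit j (snd p)))"
    have D: "(F i j has_derivative ?D) (at p)"
      unfolding F_def d_def using o
      by (intro has_derivative_diff has_derivative_minus has_derivative_divide' has_derivative_mult_right
          has_derivative_add dz)
    have DD: "?D h = fst h *\<^sub>R ?A + snd h *\<^sub>R ?B" for h
    proof -
      have O: "?o * ?o \<noteq> 0"
        using o by simp
      define Z where "Z = z i (fst p) - z j (snd p)"
      have F: "F i j p = - (Z / ?o) - b * (orbit i (fst p) + orbit j (snd p))"
        by (simp add: F_def d_def Z_def)
      have "- ((v * ?o - Z * (K * orbit i (fst p))) / (?o * ?o)) - b * (K * orbit i (fst p)) =
          - (v + K * (F i j p * orbit i (fst p) + 2 * b * (orbit i (fst p))\<^sup>2)) / ?o" for v K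
        unfolding F using o by (simp add: divide_simps) (simp add: algebra_simps power2_eq_square)
      moreover have "- ((- v * ?o + Z * (K * orbit j (snd p))) / (?o * ?o)) - b * (K * orbit j (snd p)) =
          (v + K * (F i j p * orbit j (snd p) + 2 * b * (orbit j (snd p))\<^sup>2)) / ?o" for v K
        unfolding F using o by (simp add: divide_simps) (simp add: algebra_simps power2_eq_square)
      moreover have "?D h =
          fst h *\<^sub>R (- ((z' i (fst p) * ?o - Z * (2 * pi * \<i> * orbit i (fst p))) / (?o * ?o)) - b * (2 * pi * \<i> * orbit i (fst p))) +
          snd h *\<^sub>R (- ((- z' j (snd p) * ?o + Z * (2 * pi * \<i> * orbit j (snd p))) / (?o * ?o)) - b * (2 * pi * \<i> * orbit j (snd p)))"
        using O by (simp add: Z_def[symmetric] scaleR_conv_of_real divide_simps) (simp add: algebra_simps)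
      ultimately show ?thesis
        by (simp only: perturbed_deriv_def)
    qed
    show "(F i j has_derivative (\<lambda>h. fst h *\<^sub>R ?A + snd h *\<^sub>R ?B)) (at p)"
      by (rule has_derivative_eq_rhs[OF D]) (rule ext, rule DD)
    have "cnj ?A * ?B = - (cnj (?y' (F i j p) b i (fst p)) * ?y' (F i j p) b j (snd p)) / of_real ((cmod ?o)\<^sup>2)"
      using o by (simp add: complex_norm_square mult.commute[of ?o] del: of_real_power)
    moreover have "Im (cnj (?y' (F i j p) b i (fst p)) * ?y' (F i j p) b j (snd p)) = 0"
      using p by (simp add: C_def)
    ultimately show "Im (cnj ?A * ?B) = 0"
      by (simp only: Im_divide_of_real uminus_complex.sel)
  qed
  have "negligible (Pair b -` T \<union> N \<union> (\<Union>i<n. \<Union>j<n. F i j ` C i j))"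
    using b(2) \<open>negligible N\<close> crit by (intro negligible_Un negligible_finite_UN finite_lessThan) auto
  then obtain a where a: "norm a < \<delta>" "a \<notin> Pair b -` T \<union> N \<union> (\<Union>i<n. \<Union>j<n. F i j ` C i j)"
    using negligible_avoid_ball[OF _ \<open>\<delta> > 0\<close>] by blast
  have "general_position n (?y a b) (?y' a b)"
    unfolding general_position_def
  proof (intro conjI allI impI; (elim conjE)?)
    fix i s
    assume "i < n"
    show "?y' a b i s \<noteq> 0"
    proof
      assume "?y' a b i s = 0"
      then have "a = - z' i s / (2 * pi * \<i> * orbit i s) - 2 * b * orbit i s"
        using orbit_nonzero[of i s] by (simp add: perturbed_deriv_def field_simps power2_eq_square) algebra
      then show False
        using a(2) \<open>i < n\<close> by (auto simp: N_def)
    qed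
  next
    fix i j s t
    assume ij: "i < n" "j < n" and o: "orbit i s \<noteq> orbit j t" and eq: "?y a b i s = ?y a b j t"
    show "Im (cnj (?y' a b i s) * ?y' a b j t) \<noteq> 0"
    proof
      assume "Im (cnj (?y' a b i s) * ?y' a b j t) = 0"
      then have "(s, t) \<in> C i j" "a = F i j (s, t)"
        using o eq F_eq[OF o, of a] by (auto simp: C_def)
      then show False
        using a(2) ij by blast
    qed
  next
    fix i j k s t u
    assume ijk: "i < n" "j < n" "k < n"
      and o: "orbit i s \<noteq> orbit j t" "orbit i s \<noteq> orbit k u" "orbit j t \<noteq> orbit k u"
      and eq: "?y a b i s = ?y a b j t"
    show "?y a b i s \<noteq> ?y a b k u"
    proof
      assume eq': "?y a b i s = ?y a b k u"
      have 1: "a = - d i s j t - b * (orbit i s + orbit j t)"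
        using F_eq[OF o(1), THEN iffD2, OF eq] unfolding F_def fst_conv snd_conv by (rule sym)
      have "a = - d i s k u - b * (orbit i s + orbit k u)"
        using F_eq[OF o(2), THEN iffD2, OF eq'] unfolding F_def fst_conv snd_conv by (rule sym)
      then have "- d i s j t - b * (orbit i s + orbit j t) = - d i s k u - b * (orbit i s + orbit k u)"
        using 1 by simp
      then have "b * (orbit j t - orbit k u) = - (d i s j t - d i s k u)"
        by (simp add: algebra_simps)
      then have "b = - (d i s j t - d i s k u) / (orbit j t - orbit k u)"
        using o(3) by (simp add: field_simps)
      then have "(b, a) = G i j k (s, t, u)"
        using 1 by (simp add: G_def Let_def)
      then have "(b, a) \<in> T"
        unfolding T_def using ijk o by blast
      then show False
        using a(2) by simp
    qed
  qed
  then show ?thesis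
    using a(1) b(1) by blast
qed

section \<open>Links in general position\<close>

text \<open>
  Averages of \<open>z\<close> over intervals of a fixed short length gain one derivative, and
  they are close to \<open>z\<close>, with close derivatives, by uniform continuity.
\<close>

lemma periodic_C1_smoothing:
  fixes z :: "real \<Rightarrow> 'a::euclidean_space"
  assumes per: "\<And>s. z (s + 1) = z s" and z': "\<And>s. (z has_vector_derivative z' s) (at s)"
    and cont: "continuous_on UNIV z'" and "\<delta> > 0"
  shows "\<exists>y y' y''. (\<forall>s. y (s + 1) = y s) \<and> (\<forall>s. (y has_vector_derivative y' s) (at s)) \<and>
    (\<forall>s. (y' has_vector_derivative y'' s) (at s)) \<and>
    (\<forall>s. norm (y s - z s) \<le> \<delta>) \<and> (\<forall>s. norm (y' s - z' s) \<le> \<delta>)"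
proof -
  have z_cont: "continuous_on UNIV z"
    using z' by (meson continuous_at_imp_continuous_on has_vector_derivative_continuous)
  have "\<exists>Z. \<forall>x. -\<infinity> < ereal x \<longrightarrow> ereal x < \<infinity> \<longrightarrow> (Z has_vector_derivative z x) (at x)"
    using z_cont by (intro einterval_antiderivative) (auto simp: continuous_on_eq_continuous_at)
  then obtain Z where Z: "\<And>x. (Z has_vector_derivative z x) (at x)"
    by auto
  obtain e1 where e1: "e1 > 0" "\<And>x y. dist x y < e1 \<Longrightarrow> dist (z x) (z y) < \<delta>"
    using periodic_uniformly_continuous[of z, OF per z_cont] \<open>\<delta> > 0\<close>
    unfolding uniformly_continuous_on_def by (metis UNIV_I)
  obtain e2 where e2: "e2 > 0" "\<And>x y. dist x y < e2 \<Longrightarrow> dist (z' x) (z' y) < \<delta>"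
    using periodic_uniformly_continuous[of z', OF periodic_has_vector_derivative_unique[OF per z'] cont] \<open>\<delta> > 0\<close>
    unfolding uniformly_continuous_on_def by (metis UNIV_I)
  define e where "e = min e1 e2 / 2"
  have e: "e > 0" "e < e1" "e < e2"
    using e1(1) e2(1) by (auto simp: e_def)
  \<comment> \<open>difference quotients of a primitive are averages\<close>
  have average: "norm ((1 / e) *\<^sub>R (F (s + e) - F s) - f s) \<le> \<delta>"
    if "\<And>x. (F has_vector_derivative f x) (at x)" "\<And>x y. dist x y \<le> e \<Longrightarrow> dist (f x) (f y) < \<delta>"
    for F f :: "real \<Rightarrow> 'a" and s
  proof -
    have "norm (F (s + e) - F s - (s + e - s) *\<^sub>R f s) \<le> \<delta> * \<bar>s + e - s\<bar>"
    proof (rule mean_value_vector[OF that(1)])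
      fix x
      assume "x \<in> closed_segment (s + e) s"
      then have "dist x s \<le> e"
        using e(1) by (auto simp: closed_segment_eq_real_ivl dist_real_def)
      then show "norm (f x - f s) \<le> \<delta>"
        using that(2) by (simp add: dist_norm less_imp_le)
    qed
    then have "norm (F (s + e) - F s - e *\<^sub>R f s) \<le> \<delta> * e"
      using e(1) by simp
    moreover have "(1 / e) *\<^sub>R (F (s + e) - F s) - f s = (1 / e) *\<^sub>R (F (s + e) - F s - e *\<^sub>R f s)"
      using e(1) by (simp add: scaleR_diff_right)
    ultimately show ?thesis
      using e(1) by (simp only: norm_scaleR) (simp add: field_simps)
  qed
  have shift: "((\<lambda>s. (1 / e) *\<^sub>R (F (s + e) - F s)) has_vector_derivative (1 / e) *\<^sub>R (f (s + e) - f s)) (at s)"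
    if F: "\<And>x. (F has_vector_derivative f x) (at x)" for F f :: "real \<Rightarrow> 'a" and s
  proof -
    have "((F \<circ> (\<lambda>s. s + e)) has_vector_derivative 1 *\<^sub>R f (s + e)) (at s)"
      by (rule vector_diff_chain_at) (auto intro!: derivative_eq_intros F)
    then have "((\<lambda>s. F (s + e)) has_vector_derivative f (s + e)) (at s)"
      by (simp add: o_def)
    then have "((\<lambda>s. F (s + e) - F s) has_vector_derivative f (s + e) - f s) (at s)"
      using F by (intro has_vector_derivative_diff)
    then show ?thesis
      by (rule bounded_linear.has_vector_derivative[OF bounded_linear_scaleR_right])
  qed
  let ?y = "\<lambda>s. (1 / e) *\<^sub>R (Z (s + e) - Z s)"
  let ?y' = "\<lambda>s. (1 / e) *\<^sub>R (z (s + e) - z s)"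
  let ?y'' = "\<lambda>s. (1 / e) *\<^sub>R (z' (s + e) - z' s)"
  have "?y (s + 1) = ?y s" for s
  proof -
    have d: "((\<lambda>s. Z (s + 1) - Z s) has_vector_derivative 0) (at s)" for s
    proof -
      have "((Z \<circ> (\<lambda>s. s + 1)) has_vector_derivative 1 *\<^sub>R z (s + 1)) (at s)"
        by (rule vector_diff_chain_at) (auto intro!: derivative_eq_intros Z)
      then have "((\<lambda>s. Z (s + 1)) has_vector_derivative z s) (at s)"
        by (simp add: o_def per)
      then show ?thesis
        using has_vector_derivative_diff[OF _ Z[of s]] by fastforce
    qed
    have "norm ((Z (s + e + 1) - Z (s + e)) - (Z (s + 1) - Z s) - (s + e - s) *\<^sub>R 0) \<le> 0 * \<bar>s + e - s\<bar>"
      by (rule mean_value_vector[OF d]) simp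
    then have "Z (s + e + 1) - Z (s + e) = Z (s + 1) - Z s"
      by simp
    then have "Z (s + 1 + e) - Z (s + 1) = Z (s + e) - Z s"
      by (simp add: algebra_simps)
    then show ?thesis
      by simp
  qed
  moreover have "norm (?y s - z s) \<le> \<delta>" for s
    using e1(2) e(2) by (intro average[OF Z]) (meson le_less_trans)
  moreover have "norm (?y' s - z' s) \<le> \<delta>" for s
    using e2(2) e(3) by (intro average[OF z']) (meson le_less_trans)
  moreover have "(?y has_vector_derivative ?y' s) (at s)" for s
    by (rule shift[OF Z])
  moreover have "(?y' has_vector_derivative ?y'' s) (at s)" for s
    by (rule shift[OF z'])
  ultimately show ?thesis
    by (intro exI[of _ ?y] exI[of _ ?y'] exI[of _ ?y''] conjI allI)
qed

lemma has_derivative_inj_isolated: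
  fixes g :: "'a::real_normed_vector \<Rightarrow> 'b::euclidean_space"
  assumes "(g has_derivative g') (at x)" "inj g'"
  obtains d where "d > 0" "\<And>y. dist y x < d \<Longrightarrow> g y = g x \<Longrightarrow> y = x"
proof -
  have lin: "linear g'"
    using assms(1) by (rule has_derivative_linear)
  obtain B where B: "B > 0" "\<And>h. B * norm h \<le> norm (g' h)"
    using linear_inj_bounded_below_pos[OF lin assms(2)] by blast
  obtain d where d: "d > 0" "\<And>y. norm (y - x) < d \<Longrightarrow> norm (g y - g x - g' (y - x)) \<le> B / 2 * norm (y - x)"
    using assms(1) B(1) unfolding has_derivative_at_alt by (metis half_gt_zero)
  show ?thesis
  proof (rule that[OF d(1)])
    fix y
    assume y: "dist y x < d" "g y = g x"
    then have "norm (g' (y - x)) \<le> B / 2 * norm (y - x)"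
      using d(2)[of y] by (simp add: dist_norm)
    then have "B * norm (y - x) \<le> B / 2 * norm (y - x)"
      using B(2)[of "y - x"] by linarith
    then show "y = x"
      using B(1) by (simp add: mult_le_cancel_right)
  qed
qed

text \<open>
  An infinite set of double points would accumulate at some pair of parameters. If these belong to
  different points of the circles, the branches meet transversally and the double point is
  isolated; if they belong to the same point, local injectivity of a regular curve is violated.
\<close>

lemma finite_double_points:
  assumes reg: "\<And>i. i < comps D \<Longrightarrow> regular_closed_curve (curve D i)"
    and trans: "\<And>p q. (p, q) \<in> double_points D \<Longrightarrow> Im (cnj (tangent D p) * tangent D q) \<noteq> 0"
  shows "finite (double_points D)"
proof -
  define E where "E = (\<lambda>i j. {p. fst p \<in> {0..<1} \<and> snd p \<in> {0..<1} \<and> (i, fst p) \<noteq> (j, snd p) \<and>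
    curve D i (fst p) = curve D j (snd p)})"
  have fin: "finite (E i j)" if ij: "i < comps D" "j < comps D" for i j
  proof (rule ccontr)
    assume inf: "infinite (E i j)"
    have "compact ({0..1::real} \<times> {0..1::real})"
      by (intro compact_Times) auto
    moreover have "E i j \<subseteq> {0..1} \<times> {0..1}"
      by (auto simp: E_def)
    ultimately obtain x where x: "x islimpt E i j"
      using Heine_Borel_imp_Bolzano_Weierstrass[OF _ inf] by blast
    let ?g = "\<lambda>p. curve D i (fst p) - curve D j (snd p)"
    note ci = regular_closed_curveD[OF reg[OF ij(1)]] and cj = regular_closed_curveD[OF reg[OF ij(2)]]
    have "closed {p. ?g p = 0}"
    proof (rule closed_Collect_eq)
      show "continuous_on UNIV ?g"
        by (intro continuous_intros continuous_on_compose2[OF ci(6)] continuous_on_compose2[OF cj(6)]) auto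
    qed simp
    moreover have "x islimpt {p. ?g p = 0}"
      using x by (rule islimpt_subset) (auto simp: E_def)
    ultimately have "x \<in> {p. ?g p = 0}"
      unfolding closed_limpt by blast
    then have x0: "curve D i (fst x) = curve D j (snd x)"
      by simp
    note fi = regular_closed_curve_tangent_frac[OF reg[OF ij(1)]] and fj = regular_closed_curve_tangent_frac[OF reg[OF ij(2)]]
    show False
    proof (cases "(i, frac (fst x)) = (j, frac (snd x))")
      case True
      obtain \<eta> m where \<eta>: "\<eta> > 0" "m > 0" "\<And>s t. \<bar>s - t\<bar> < \<eta> \<Longrightarrow> m * \<bar>s - t\<bar> \<le> norm (curve D i s - curve D i t)"
        using regular_closed_curve_locally_bilipschitz[OF reg[OF ij(1)]] by blast
      obtain p where p: "p \<in> E i j" "dist p x < \<eta> / 2"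
        using x \<eta>(1) unfolding islimpt_approachable by (meson half_gt_zero)
      define k where "k = \<lfloor>fst x\<rfloor> - \<lfloor>snd x\<rfloor>"
      have k: "fst x = snd x + of_int k"
        using True by (simp add: frac_def k_def)
      have "\<bar>fst p - fst x\<bar> < \<eta> / 2" "\<bar>snd p - snd x\<bar> < \<eta> / 2"
        using dist_fst_le[of p x] dist_snd_le[of p x] p(2) by (auto simp: dist_real_def)
      then have "\<bar>fst p - (snd p + of_int k)\<bar> < \<eta>"
        using k by linarith
      then have "m * \<bar>fst p - (snd p + of_int k)\<bar> \<le> norm (curve D i (fst p) - curve D i (snd p + of_int k))"
        by (rule \<eta>(3))
      also have "curve D i (snd p + of_int k) = curve D i (fst p)"
        using periodic_add_int[of "curve D i", OF ci(1)] p(1) True by (simp add: E_def)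
      finally have "m * \<bar>fst p - (snd p + of_int k)\<bar> \<le> 0"
        by simp
      then have eq: "fst p = snd p + of_int k"
        using \<eta>(2) by (simp add: mult_le_0_iff)
      moreover have "fst p \<in> {0..<1}" "snd p \<in> {0..<1}"
        using p(1) by (auto simp: E_def)
      ultimately have "\<bar>of_int k :: real\<bar> < 1"
        by auto
      then have "k = 0"
        by linarith
      then show False
        using eq p(1) True by (simp add: E_def)
    next
      case False
      define v where "v = vector_derivative (curve D i) (at (fst x))"
      define w where "w = vector_derivative (curve D j) (at (snd x))"
      have "((i, frac (fst x)), (j, frac (snd x))) \<in> double_points D"
        using False ij x0 fi(1) fj(1) by (auto simp: double_points_def circle_params_def point_def frac_lt_1)
      then have vw: "Im (cnj v * w) \<noteq> 0"
        using trans fi(2) fj(2) by (force simp: tangent_def v_def w_def)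
      have "((\<lambda>p. curve D i (fst p)) has_derivative (\<lambda>h. fst h *\<^sub>R v)) (at x)"
        "((\<lambda>p. curve D j (snd p)) has_derivative (\<lambda>h. snd h *\<^sub>R w)) (at x)"
        using ci(2)[of "fst x"] cj(2)[of "snd x"] unfolding has_vector_derivative_def v_def w_def
        by (auto intro!: has_derivative_compose[of fst fst] has_derivative_compose[of snd snd] has_derivative_fst has_derivative_snd)
      then have d: "(?g has_derivative (\<lambda>h. fst h *\<^sub>R v - snd h *\<^sub>R w)) (at x)"
        by (rule has_derivative_diff)
      have "inj (\<lambda>h. fst h *\<^sub>R v - snd h *\<^sub>R w)"
      proof -
        have "h = 0" if h: "fst h *\<^sub>R v - snd h *\<^sub>R w = 0" for h
        proof -
          have "Im (cnj v * (fst h *\<^sub>R v - snd h *\<^sub>R w)) = - snd h * Im (cnj v * w)"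
            "Im (cnj w * (fst h *\<^sub>R v - snd h *\<^sub>R w)) = - fst h * Im (cnj v * w)"
            by (simp_all add: algebra_simps)
          then show ?thesis
            using h vw by (simp add: prod_eq_iff)
        qed
        then show ?thesis
          using linear_injective_0[OF has_derivative_linear[OF d]] by blast
      qed
      then obtain e where e: "e > 0" "\<And>y. dist y x < e \<Longrightarrow> ?g y = ?g x \<Longrightarrow> y = x"
        using has_derivative_inj_isolated[OF d] by blast
      obtain p where p: "p \<in> E i j" "p \<noteq> x" "dist p x < e"
        using x e(1) unfolding islimpt_approachable by meson
      then show False
        using e(2)[of p] x0 by (simp add: E_def)
    qed
  qed
  have "double_points D \<subseteq> (\<Union>i<comps D. \<Union>j<comps D. (\<lambda>p. ((i, fst p), (j, snd p))) ` E i j)"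
  proof
    fix c
    assume c: "c \<in> double_points D"
    obtain i s j t where "c = ((i, s), (j, t))"
      by (cases c) auto
    then have "(s, t) \<in> E i j" "i < comps D" "j < comps D" "c = (\<lambda>p. ((i, fst p), (j, snd p))) (s, t)"
      using c by (auto simp: double_points_def circle_params_def point_def E_def)
    then show "c \<in> (\<Union>i<comps D. \<Union>j<comps D. (\<lambda>p. ((i, fst p), (j, snd p))) ` E i j)"
      by blast
  qed
  then show ?thesis
    using fin by (auto intro: finite_subset)
qed

definition height :: "link \<Rightarrow> nat \<times> real \<Rightarrow> real" where
  "height K p = snd (strand K (fst p) (snd p))"

text \<open>
  The upper branch is determined by comparing with the heights of all branches over the same
  point, for arbitrary real parameters; in this way \<open>over\<close> has period
  \<open>1\<close> by construction.
\<close>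

definition shadow :: "link \<Rightarrow> diagram" where
  "shadow K = \<lparr>comps = link_comps K, curve = \<lambda>i s. fst (strand K i s),
     over = \<lambda>i s. \<exists>j<link_comps K. \<exists>t. fst (strand K j t) = fst (strand K i s) \<and>
       snd (strand K j t) < snd (strand K i s)\<rparr>"

lemma shadow_simps [simp]:
  "comps (shadow K) = link_comps K" "curve (shadow K) i s = fst (strand K i s)"
  by (simp_all add: shadow_def)

lemma shadow_is_over:
  assumes K: "is_link K" and uniq: "\<And>r. (p, r) \<in> double_points (shadow K) \<Longrightarrow> r = q"
    and pq: "(p, q) \<in> double_points (shadow K)"
  shows "is_over (shadow K) p \<longleftrightarrow> height K q < height K p"
proof
  assume "is_over (shadow K) p"
  then obtain j t where j: "j < link_comps K" and eq: "fst (strand K j t) = fst (strand K (fst p) (snd p))"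
    and less: "snd (strand K j t) < snd (strand K (fst p) (snd p))"
    by (auto simp: is_over_def shadow_def)
  have "regular_closed_curve (strand K j)"
    using K j by (simp add: is_link_def)
  then have t: "strand K j (frac t) = strand K j t"
    by (rule regular_closed_curve_tangent_frac)
  have "(j, frac t) \<noteq> p"
    using less t by auto
  then have "(p, (j, frac t)) \<in> double_points (shadow K)"
    using pq j eq t by (auto simp: double_points_def point_def circle_params_def frac_lt_1)
  then have "(j, frac t) = q"
    by (rule uniq)
  then show "height K q < height K p"
    using less t by (auto simp: height_def)
next
  assume "height K q < height K p"
  moreover have "fst q < link_comps K" "fst (strand K (fst q) (snd q)) = fst (strand K (fst p) (snd p))"
    using pq by (auto simp: double_points_def point_def circle_params_def)
  ultimately show "is_over (shadow K) p"
    unfolding is_over_def shadow_def height_def by auto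
qed

lemma shadow_projects_to:
  assumes K: "is_link K" and reg: "\<And>i. i < link_comps K \<Longrightarrow> regular_closed_curve (\<lambda>s. fst (strand K i s))"
    and trans: "\<And>p q. (p, q) \<in> double_points (shadow K) \<Longrightarrow>
      Im (cnj (tangent (shadow K) p) * tangent (shadow K) q) \<noteq> 0"
    and uniq: "\<And>p q r. (p, q) \<in> double_points (shadow K) \<Longrightarrow> (p, r) \<in> double_points (shadow K) \<Longrightarrow> q = r"
  shows "projects_to K (shadow K)"
    and "crossings (shadow K) = {(p, q) \<in> double_points (shadow K). height K q < height K p}"
proof -
  have over: "is_over (shadow K) p \<longleftrightarrow> height K q < height K p" if "(p, q) \<in> double_points (shadow K)" for p q
    using shadow_is_over[OF K uniq[OF _ that] that] .
  have neq: "height K p \<noteq> height K q" if pq: "(p, q) \<in> double_points (shadow K)" for p q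
  proof
    assume "height K p = height K q"
    then have "(\<lambda>(i, s). strand K i s) p = (\<lambda>(i, s). strand K i s) q"
      using pq by (auto simp: double_points_def point_def height_def prod_eq_iff case_prod_unfold)
    moreover have "inj_on (\<lambda>(i, s). strand K i s) (circle_params (link_comps K))"
      using K by (simp add: is_link_def)
    ultimately show False
      using pq by (auto simp: double_points_def dest: inj_onD)
  qed
  show cross: "crossings (shadow K) = {(p, q) \<in> double_points (shadow K). height K q < height K p}"
    using over double_points_sym neq by (fastforce simp: crossings_def)
  have curve: "curve (shadow K) i = (\<lambda>s. fst (strand K i s))" for i
    by auto
  have per: "over (shadow K) i (s + 1) = over (shadow K) i s" if "i < link_comps K" for i s
  proof -
    have "strand K i (s + 1) = strand K i s"
      using K that by (auto simp: is_link_def regular_closed_curve_def)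
    then show ?thesis
      by (simp add: shadow_def)
  qed
  have "is_diagram (shadow K)"
    unfolding is_diagram_def
  proof (intro conjI)
    show "1 \<le> comps (shadow K)"
      using K by (simp add: is_link_def)
    show "\<forall>i<comps (shadow K). regular_closed_curve (curve (shadow K) i) \<and>
        (\<forall>s. over (shadow K) i (s + 1) = over (shadow K) i s)"
      using reg per by (simp add: curve)
    show "finite (double_points (shadow K))"
      using reg trans by (intro finite_double_points) (simp_all add: curve)
    show "\<forall>(p, q)\<in>double_points (shadow K).
        Im (cnj (tangent (shadow K) p) * tangent (shadow K) q) \<noteq> 0 \<and> is_over (shadow K) p \<noteq> is_over (shadow K) q"
    proof (intro ballI, clarify)
      fix i s j t
      assume pq: "((i, s), (j, t)) \<in> double_points (shadow K)"
      show "Im (cnj (tangent (shadow K) (i, s)) * tangent (shadow K) (j, t)) \<noteq> 0 \<and>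
          is_over (shadow K) (i, s) \<noteq> is_over (shadow K) (j, t)"
        using trans[OF pq] over[OF pq] over[OF double_points_sym[OF pq]] neq[OF pq] by auto
    qed
    show "\<forall>p q r. (p, q) \<in> double_points (shadow K) \<and> (p, r) \<in> double_points (shadow K) \<longrightarrow> q = r"
      using uniq by blast
  qed
  then show "projects_to K (shadow K)"
    using K by (auto simp: projects_to_def cross height_def)
qed

text \<open>
  A small multiple of a sine is added to the heights, so that the first component is not
  horizontal; a curl can be inserted only where the height changes.
\<close>

lemma link_isotopic_general_position:
  assumes L: "is_link L"
  obtains K where "link_isotopic L K" "projects_to K (shadow K)"
    "\<And>i. i < link_comps K \<Longrightarrow> regular_closed_curve (\<lambda>s. fst (strand K i s))"
    "height K (0, 1 / 4) \<noteq> height K (0, 0)"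
proof -
  define n where "n = link_comps L"
  have reg: "regular_closed_curve (strand L i)" if "i < n" for i
    using L that by (simp add: is_link_def n_def)
  obtain \<delta> where \<delta>: "\<delta> > 0" and isotopic: "\<And>K k'. link_comps K = n \<Longrightarrow>
      (\<And>i s. i < n \<Longrightarrow> strand K i (s + 1) = strand K i s) \<Longrightarrow>
      (\<And>i s. i < n \<Longrightarrow> (strand K i has_vector_derivative k' i s) (at s)) \<Longrightarrow>
      (\<And>i. i < n \<Longrightarrow> continuous_on UNIV (k' i)) \<Longrightarrow>
      (\<And>i s. i < n \<Longrightarrow> norm (strand K i s - strand L i s) \<le> \<delta>) \<Longrightarrow>
      (\<And>i s. i < n \<Longrightarrow> norm (k' i s - vector_derivative (strand L i) (at s)) \<le> \<delta>) \<Longrightarrow>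
      link_isotopic L K"
    using link_C1_close_isotopic[OF L] unfolding n_def by blast
  define l' where "l' = (\<lambda>i s. vector_derivative (strand L i) (at s))"
  have l': "(strand L i has_vector_derivative l' i s) (at s)" "continuous_on UNIV (l' i)"
    "strand L i (s + 1) = strand L i s" if "i < n" for i s
    using regular_closed_curveD[OF reg[OF that]] by (simp_all add: l'_def)
  have fst_l': "((\<lambda>s. fst (strand L i s)) has_vector_derivative fst (l' i s)) (at s)"
    and snd_l': "((\<lambda>s. snd (strand L i s)) has_vector_derivative snd (l' i s)) (at s)" if "i < n" for i s
    using l'(1)[OF that] bounded_linear.has_vector_derivative[OF bounded_linear_fst]
      bounded_linear.has_vector_derivative[OF bounded_linear_snd] by blast+
  have "\<exists>y y' y''. (\<forall>s. y (s + 1) = y s) \<and> (\<forall>s. (y has_vector_derivative y' s) (at s)) \<and>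
    (\<forall>s. (y' has_vector_derivative y'' s) (at s)) \<and>
    (\<forall>s. norm (y s - fst (strand L i s)) \<le> \<delta> / 4) \<and> (\<forall>s. norm (y' s - fst (l' i s)) \<le> \<delta> / 4)"
    if "i < n" for i
    using l'[OF that] fst_l'[OF that] \<delta> by (intro periodic_C1_smoothing continuous_on_fst) auto
  then obtain z z' z'' where z: "\<And>i s. i < n \<Longrightarrow> z i (s + 1) = z i s"
      "\<And>i s. i < n \<Longrightarrow> (z i has_vector_derivative z' i s) (at s)"
      "\<And>i s. i < n \<Longrightarrow> (z' i has_vector_derivative z'' i s) (at s)"
      "\<And>i s. i < n \<Longrightarrow> norm (z i s - fst (strand L i s)) \<le> \<delta> / 4"
      "\<And>i s. i < n \<Longrightarrow> norm (z' i s - fst (l' i s)) \<le> \<delta> / 4"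
    by metis
  define M :: real where "M = 2 * pi * (n + 2 * n\<^sup>2)"
  have M: "real n + n\<^sup>2 \<le> M" "M \<ge> 0"
  proof -
    have "1 * (real n + 2 * n\<^sup>2) \<le> M"
      unfolding M_def using pi_gt3 by (simp only: of_nat_add, intro mult_right_mono) auto
    moreover have "real n + n\<^sup>2 \<le> 1 * (real n + 2 * n\<^sup>2)"
      by simp
    ultimately show "real n + n\<^sup>2 \<le> M"
      by (rule order_trans[rotated])
    show "M \<ge> 0"
      by (simp add: M_def)
  qed
  define \<epsilon> where "\<epsilon> = \<delta> / 4 / (M + 1)"
  have \<epsilon>: "\<epsilon> > 0" "\<epsilon> * M \<le> \<delta> / 4"
    using \<delta> M(2) by (auto simp: \<epsilon>_def field_simps)
  define y where "y = perturbed z"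
  define y' where "y' = perturbed_deriv z'"
  have "\<exists>a b. norm a < \<epsilon> \<and> norm b < \<epsilon> \<and> general_position n (y a b) (y' a b)"
    unfolding y_def y'_def by (rule generic_perturbation[of n z z' z'' \<epsilon>]) (fact z(2), fact z(3), fact \<epsilon>(1))
  then obtain a b where ab: "norm a < \<epsilon>" "norm b < \<epsilon>" and gp: "general_position n (y a b) (y' a b)"
    by blast
  have immersed: "y' a b i s \<noteq> 0" if "i < n" for i s
    using gp that by (simp add: general_position_def)
  have transversal: "Im (cnj (y' a b i s) * y' a b j t) \<noteq> 0"
    if "i < n" "j < n" "orbit i s \<noteq> orbit j t" "y a b i s = y a b j t" for i s j t
    using gp that unfolding general_position_def by blast
  have no_triple: "y a b i s \<noteq> y a b k u"
    if "i < n" "j < n" "k < n" "orbit i s \<noteq> orbit j t" "orbit i s \<noteq> orbit k u" "orbit j t \<noteq> orbit k u"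
      "y a b i s = y a b j t" for i s j t k u
    using gp that unfolding general_position_def by blast
  \<comment> \<open>at most one multiple of the sine makes the two heights agree\<close>
  define c0 where "c0 = \<delta> / 4 / (2 * pi)"
  have c0: "c0 > 0" "2 * pi * c0 \<le> \<delta> / 4"
    using \<delta> by (simp_all add: c0_def)
  obtain c where c: "c \<in> {c0, c0 / 2}"
    and heights: "snd (strand L 0 (1 / 4)) + c \<noteq> snd (strand L 0 0)"
  proof (cases "snd (strand L 0 (1 / 4)) + c0 = snd (strand L 0 0)")
    case True
    then have "snd (strand L 0 (1 / 4)) + c0 / 2 \<noteq> snd (strand L 0 0)"
      using c0(1) by linarith
    then show ?thesis
      using that[of "c0 / 2"] by simp
  next
    case False
    then show ?thesis
      using that[of c0] by simp
  qed
  have c_bound: "\<bar>c\<bar> \<le> c0" "c0 \<le> \<delta> / 4" "2 * pi * \<bar>c\<bar> \<le> \<delta> / 4"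
  proof -
    show "\<bar>c\<bar> \<le> c0"
      using c c0(1) by auto
    then have "2 * pi * \<bar>c\<bar> \<le> 2 * pi * c0"
      by (intro mult_left_mono) auto
    then show "2 * pi * \<bar>c\<bar> \<le> \<delta> / 4"
      using c0(2) by (rule order_trans)
    show "c0 \<le> \<delta> / 4"
      using order_trans[OF mult_right_mono[of 1 "2 * pi" c0] c0(2)] c0(1) pi_gt3 by simp
  qed
  define K where "K = \<lparr>link_comps = n,
    strand = \<lambda>i s. (y a b i s, snd (strand L i s) + c * sin (2 * pi * s))\<rparr>"
  define k' where "k' = (\<lambda>i s. (y' a b i s, snd (l' i s) + c * (2 * pi * cos (2 * pi * s))))"
  have comps: "link_comps K = n"
    by (simp add: K_def)
  have strand: "strand K i s = (y a b i s, snd (strand L i s) + c * sin (2 * pi * s))" for i s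
    by (simp add: K_def)
  have y_deriv: "(y a b i has_vector_derivative y' a b i s) (at s)" if i: "i < n" for i s
  proof -
    have "((\<lambda>s. z i s + a * orbit i s + b * (orbit i s * orbit i s)) has_vector_derivative
        z' i s + a * (2 * pi * \<i> * orbit i s) +
        b * (orbit i s * (2 * pi * \<i> * orbit i s) + 2 * pi * \<i> * orbit i s * orbit i s)) (at s)"
      by (intro has_vector_derivative_add has_vector_derivative_mult_right has_vector_derivative_mult
          z(2)[OF i] orbit_has_vector_derivative)
    moreover have "y a b i = (\<lambda>s. z i s + a * orbit i s + b * (orbit i s * orbit i s))"
      by (simp add: y_def perturbed_def fun_eq_iff power2_eq_square)
    ultimately show ?thesis
      by (simp add: y'_def perturbed_deriv_def power2_eq_square algebra_simps)
  qed
  have y_per: "y a b i (s + 1) = y a b i s" if "i < n" for i s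
    using z(1)[OF that] orbit_eq_iff[of i "s + 1" i s] by (simp add: y_def perturbed_def)
  have orbit_bound: "norm (orbit i s) \<le> n" if "i < n" for i s
    using that by (simp add: norm_orbit)
  have perturb_bound: "norm (a * orbit i s + r *\<^sub>R (b * (orbit i s)\<^sup>2)) \<le> \<epsilon> * (n + r * n\<^sup>2)"
    if "i < n" "r \<ge> 0" for i s r
  proof -
    have "norm (a * orbit i s) \<le> \<epsilon> * n"
      unfolding norm_mult using ab(1) \<epsilon>(1) orbit_bound[OF that(1)] by (intro mult_mono) auto
    moreover have "norm (b * (orbit i s)\<^sup>2) \<le> \<epsilon> * n\<^sup>2"
      unfolding norm_mult norm_power using ab(2) \<epsilon>(1) orbit_bound[OF that(1), of s]
      by (intro mult_mono) (auto intro: power_mono)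
    then have "norm (r *\<^sub>R (b * (orbit i s)\<^sup>2)) \<le> r * (\<epsilon> * n\<^sup>2)"
      using that(2) by (simp add: mult_left_mono)
    ultimately show ?thesis
      by (intro norm_triangle_le) (simp add: algebra_simps)
  qed
  have y_close: "norm (y a b i s - fst (strand L i s)) \<le> \<delta> / 4 + \<delta> / 4" if i: "i < n" for i s
  proof -
    have "\<epsilon> * (n + 1 * n\<^sup>2) \<le> \<epsilon> * M"
      using M(1) \<epsilon>(1) by (intro mult_left_mono) auto
    then have "norm (a * orbit i s + b * (orbit i s)\<^sup>2) \<le> \<delta> / 4"
      using perturb_bound[OF i, of 1 s] \<epsilon>(2) by simp
    moreover have "y a b i s - fst (strand L i s) =
        (z i s - fst (strand L i s)) + (a * orbit i s + b * (orbit i s)\<^sup>2)"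
      by (simp add: y_def perturbed_def)
    ultimately show ?thesis
      using z(4)[OF i, of s] by (metis add_mono norm_triangle_le)
  qed
  have y'_close: "norm (y' a b i s - fst (l' i s)) \<le> \<delta> / 4 + \<delta> / 4" if i: "i < n" for i s
  proof -
    have "norm (2 * pi * \<i> * (a * orbit i s + 2 * b * (orbit i s)\<^sup>2)) =
        2 * pi * norm (a * orbit i s + 2 *\<^sub>R (b * (orbit i s)\<^sup>2))"
      by (simp add: norm_mult scaleR_conv_of_real mult.assoc)
    also have "\<dots> \<le> 2 * pi * (\<epsilon> * (n + 2 * n\<^sup>2))"
      using perturb_bound[OF i, of 2 s] by (intro mult_left_mono) auto
    also have "\<dots> \<le> \<delta> / 4"
      using \<epsilon>(2) by (simp add: M_def mult_ac)
    finally have "norm (2 * pi * \<i> * (a * orbit i s + 2 * b * (orbit i s)\<^sup>2)) \<le> \<delta> / 4" .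
    moreover have "y' a b i s - fst (l' i s) =
        (z' i s - fst (l' i s)) + 2 * pi * \<i> * (a * orbit i s + 2 * b * (orbit i s)\<^sup>2)"
      by (simp add: y'_def perturbed_deriv_def)
    ultimately show ?thesis
      using z(5)[OF i, of s] by (metis add_mono norm_triangle_le)
  qed
  have iso: "link_isotopic L K"
  proof (rule isotopic[OF comps, of k'])
    fix i s
    assume i: "i < n"
    show "strand K i (s + 1) = strand K i s"
    proof -
      have "sin (2 * pi * (s + 1)) = sin (2 * pi * s)"
        using sin_periodic[of "2 * pi * s"] by (simp add: distrib_left)
      then show ?thesis
        using y_per[OF i] l'(3)[OF i] by (simp only: strand)
    qed
    have "((\<lambda>s. sin (2 * pi * s)) has_vector_derivative 2 * pi * cos (2 * pi * s)) (at s)"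
      unfolding has_real_derivative_iff_has_vector_derivative[symmetric]
      by (auto intro!: derivative_eq_intros)
    then have "((\<lambda>s. snd (strand L i s) + c * sin (2 * pi * s)) has_vector_derivative
        snd (l' i s) + c * (2 * pi * cos (2 * pi * s))) (at s)"
      by (intro has_vector_derivative_add has_vector_derivative_mult_right snd_l'[OF i])
    then show "(strand K i has_vector_derivative k' i s) (at s)"
      unfolding K_def k'_def link.simps by (intro has_vector_derivative_Pair y_deriv[OF i])
    have "\<bar>c * sin (2 * pi * s)\<bar> \<le> \<delta> / 4"
    proof -
      have "\<bar>c\<bar> * \<bar>sin (2 * pi * s)\<bar> \<le> c0 * 1"
        using c_bound(1) c0(1) by (intro mult_mono) auto
      then show ?thesis
        using c_bound(2) by (simp add: abs_mult)
    qed
    moreover have "strand K i s - strand L i s = (y a b i s - fst (strand L i s), c * sin (2 * pi * s))"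
      by (simp add: strand prod_eq_iff)
    ultimately show "norm (strand K i s - strand L i s) \<le> \<delta>"
      using norm_Pair_le[of "y a b i s - fst (strand L i s)" "c * sin (2 * pi * s)"] y_close[OF i, of s] \<delta>
      by simp
    have "\<bar>c * (2 * pi * cos (2 * pi * s))\<bar> \<le> \<delta> / 4"
    proof -
      have "\<bar>c * (2 * pi * cos (2 * pi * s))\<bar> = 2 * pi * \<bar>c\<bar> * \<bar>cos (2 * pi * s)\<bar>"
        by (simp add: abs_mult)
      also have "\<dots> \<le> \<delta> / 4 * 1"
        using c_bound(3) \<delta> by (intro mult_mono) auto
      finally show ?thesis
        by simp
    qed
    moreover have "k' i s - l' i s = (y' a b i s - fst (l' i s), c * (2 * pi * cos (2 * pi * s)))"
      by (simp add: k'_def prod_eq_iff)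
    ultimately have "norm (k' i s - l' i s) \<le> \<delta>"
      using norm_Pair_le[of "y' a b i s - fst (l' i s)" "c * (2 * pi * cos (2 * pi * s))"] y'_close[OF i, of s] \<delta>
      by simp
    then show "norm (k' i s - vector_derivative (strand L i) (at s)) \<le> \<delta>"
      by (simp add: l'_def)
  next
    fix i
    assume i: "i < n"
    have "continuous_on UNIV (z' i)"
      using z(3)[OF i] by (meson continuous_at_imp_continuous_on has_vector_derivative_continuous)
    moreover have "continuous_on UNIV (orbit i)"
      using orbit_has_vector_derivative by (meson continuous_at_imp_continuous_on has_vector_derivative_continuous)
    ultimately show "continuous_on UNIV (k' i)"
      using l'(2)[OF i] unfolding k'_def y'_def perturbed_deriv_def by (intro continuous_intros)
  qed
  have K: "is_link K"
    using iso by (simp add: link_isotopic_def)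
  have fst_strand: "(\<lambda>s. fst (strand K i s)) = y a b i" for i
    by (simp add: strand)
  have reg_y: "regular_closed_curve (\<lambda>s. fst (strand K i s))" if i: "i < n" for i
    unfolding fst_strand
  proof (rule regular_closed_curveI)
    have "continuous_on UNIV (z' i)"
      using z(3)[OF i] by (meson continuous_at_imp_continuous_on has_vector_derivative_continuous)
    moreover have "continuous_on UNIV (orbit i)"
      using orbit_has_vector_derivative by (meson continuous_at_imp_continuous_on has_vector_derivative_continuous)
    ultimately show "continuous_on UNIV (y' a b i)"
      unfolding y'_def perturbed_deriv_def by (intro continuous_intros)
  qed (use y_per[OF i] y_deriv[OF i] immersed[OF i] in auto)
  have curve: "curve (shadow K) i = y a b i" for i
    by (auto simp: strand)
  have tan: "tangent (shadow K) (i, s) = y' a b i s" if "i < n" for i s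
    using vector_derivative_at[OF y_deriv[OF that]] by (simp add: tangent_def curve)
  have distinct: "orbit (fst p) (snd p) \<noteq> orbit (fst q) (snd q)"
    if pq: "p \<in> circle_params n" "q \<in> circle_params n" "p \<noteq> q" for p q
  proof
    assume "orbit (fst p) (snd p) = orbit (fst q) (snd q)"
    then have "fst p = fst q" "snd p - snd q \<in> \<int>"
      by (auto simp: orbit_eq_iff)
    moreover have "\<bar>snd p - snd q\<bar> < 1"
      using pq(1,2) by (auto simp: circle_params_def)
    ultimately show False
      using pq(3) Ints_nonzero_abs_less1[of "snd p - snd q"] by (auto simp: prod_eq_iff)
  qed
  have dp: "p \<in> circle_params n \<and> q \<in> circle_params n \<and> p \<noteq> q \<and> fst p < n \<and> fst q < n \<and>
      y a b (fst p) (snd p) = y a b (fst q) (snd q)"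
    if "(p, q) \<in> double_points (shadow K)" for p q
    using that by (auto simp: double_points_def point_def curve comps circle_params_def)
  have "projects_to K (shadow K)"
  proof (rule shadow_projects_to(1)[OF K])
    show "regular_closed_curve (\<lambda>s. fst (strand K i s))" if "i < link_comps K" for i
      using reg_y that comps by simp
    fix p q
    assume pq: "(p, q) \<in> double_points (shadow K)"
    have "tangent (shadow K) p = y' a b (fst p) (snd p)" "tangent (shadow K) q = y' a b (fst q) (snd q)"
      using tan[of "fst p" "snd p"] tan[of "fst q" "snd q"] dp[OF pq] by simp_all
    then show "Im (cnj (tangent (shadow K) p) * tangent (shadow K) q) \<noteq> 0"
      using transversal[of "fst p" "fst q" "snd p" "snd q"] dp[OF pq] distinct[of p q] by simp
    fix r
    assume pr: "(p, r) \<in> double_points (shadow K)"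
    show "q = r"
    proof (rule ccontr)
      assume "q \<noteq> r"
      then show False
        using no_triple[of "fst p" "fst q" "fst r" "snd p" "snd q" "snd r"] dp[OF pq] dp[OF pr]
          distinct[of p q] distinct[of p r] distinct[of q r] by auto
    qed
  qed
  moreover have "height K (0, 1 / 4) \<noteq> height K (0, 0)"
    using heights by (simp add: height_def strand)
  ultimately show ?thesis
    using that[OF iso] reg_y comps by blast
qed

section \<open>A curve with one curl\<close>

text \<open>
  The plane curve with coordinates \<open>loop\<close> and \<open>- bump\<close> is the first axis
  outside \<open>{-1..1}\<close> and a single curl inside. Since \<open>loop\<close> is odd and
  \<open>bump\<close> is even, its double point has parameters \<open>\<plusminus>x\<close> with
  \<open>loop x = 0\<close>; the factor \<open>4\<close> in \<open>loop\<close> puts it at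
  \<open>x\<^sup>2 = 1 / 2\<close>.
\<close>

definition bump :: "real \<Rightarrow> real" where
  "bump x = (max 0 (1 - x\<^sup>2))\<^sup>2"

definition bump_deriv :: "real \<Rightarrow> real" where
  "bump_deriv x = - (4 * x * max 0 (1 - x\<^sup>2))"

definition loop :: "real \<Rightarrow> real" where
  "loop x = x - 4 * x * bump x"

definition loop_deriv :: "real \<Rightarrow> real" where
  "loop_deriv x = 1 - 4 * (bump x + x * bump_deriv x)"

lemma max_0_square_has_derivative:
  "((\<lambda>r :: real. (max 0 r)\<^sup>2) has_real_derivative 2 * max 0 r) (at r)"
proof -
  have bound: "\<bar>(max 0 s)\<^sup>2 - (max 0 r)\<^sup>2 - 2 * max 0 r * (s - r)\<bar> \<le> (s - r)\<^sup>2" for s :: real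
  proof (cases "r \<ge> 0"; cases "s \<ge> 0")
    assume "r \<ge> 0" "s \<ge> 0"
    then have "(max 0 s)\<^sup>2 - (max 0 r)\<^sup>2 - 2 * max 0 r * (s - r) = (s - r)\<^sup>2"
      by (simp add: power2_eq_square algebra_simps)
    then show ?thesis
      by simp
  next
    assume rs: "r \<ge> 0" "\<not> s \<ge> 0"
    then have "(max 0 s)\<^sup>2 - (max 0 r)\<^sup>2 - 2 * max 0 r * (s - r) = (s - r)\<^sup>2 - s\<^sup>2"
      by (simp add: power2_eq_square algebra_simps)
    moreover have "(s - r)\<^sup>2 - s\<^sup>2 = r\<^sup>2 - 2 * (r * s)"
      by (simp add: power2_eq_square algebra_simps)
    moreover have "r * s \<le> 0"
      using rs by (simp add: mult_nonneg_nonpos)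
    ultimately have "\<bar>(max 0 s)\<^sup>2 - (max 0 r)\<^sup>2 - 2 * max 0 r * (s - r)\<bar> = (s - r)\<^sup>2 - s\<^sup>2"
      using zero_le_power2[of r] by linarith
    then show ?thesis
      by simp
  next
    assume rs: "\<not> r \<ge> 0" "s \<ge> 0"
    then have "(max 0 s)\<^sup>2 - (max 0 r)\<^sup>2 - 2 * max 0 r * (s - r) = s\<^sup>2"
      by simp
    moreover have "s\<^sup>2 \<le> (s - r)\<^sup>2"
      using rs by (intro power_mono) auto
    ultimately show ?thesis
      by simp
  next
    assume "\<not> r \<ge> 0" "\<not> s \<ge> 0"
    then show ?thesis
      by simp
  qed
  show ?thesis
    unfolding has_field_derivative_def has_derivative_at_alt
  proof (intro conjI allI impI)
    show "bounded_linear ((*) (2 * max 0 r))"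
      by (rule bounded_linear_mult_right)
    fix e :: real
    assume "e > 0"
    show "\<exists>d>0. \<forall>s. norm (s - r) < d \<longrightarrow>
        norm ((max 0 s)\<^sup>2 - (max 0 r)\<^sup>2 - 2 * max 0 r * (s - r)) \<le> e * norm (s - r)"
    proof (intro exI conjI allI impI)
      fix s
      assume "norm (s - r) < e"
      then have "\<bar>s - r\<bar> * \<bar>s - r\<bar> \<le> e * \<bar>s - r\<bar>"
        by (intro mult_right_mono) auto
      then show "norm ((max 0 s)\<^sup>2 - (max 0 r)\<^sup>2 - 2 * max 0 r * (s - r)) \<le> e * norm (s - r)"
        using bound[of s] by (simp add: power2_eq_square)
    qed (fact \<open>e > 0\<close>)
  qed
qed

lemma bump_has_derivative: "(bump has_real_derivative bump_deriv x) (at x)"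
proof -
  have "((\<lambda>x. 1 - x\<^sup>2) has_real_derivative - (2 * x)) (at x)"
    by (auto intro!: derivative_eq_intros)
  from DERIV_chain2[OF max_0_square_has_derivative this] show ?thesis
    by (simp add: bump_def[abs_def] bump_deriv_def mult_ac)
qed

lemma loop_has_derivative: "(loop has_real_derivative loop_deriv x) (at x)"
proof -
  have "((\<lambda>x. x - 4 * x * bump x) has_real_derivative 1 - (4 * bump x + bump_deriv x * (4 * x))) (at x)"
    using bump_has_derivative[of x] by (auto intro!: derivative_eq_intros)
  then show ?thesis
    by (simp add: loop_def[abs_def] loop_deriv_def algebra_simps)
qed

lemma bump_deriv_continuous: "continuous_on UNIV bump_deriv"
  unfolding bump_deriv_def by (intro continuous_intros)

lemma loop_deriv_continuous: "continuous_on UNIV loop_deriv"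
  unfolding loop_deriv_def bump_deriv_def bump_def by (intro continuous_intros)

lemma bump_outside:
  assumes "\<bar>x\<bar> \<ge> 1"
  shows "bump x = 0" "bump_deriv x = 0" "loop x = x" "loop_deriv x = 1"
proof -
  have "1 \<le> x\<^sup>2"
    using assms by (simp add: abs_le_square_iff[of 1 x, simplified])
  then show "bump x = 0" "bump_deriv x = 0"
    by (simp_all add: bump_def bump_deriv_def)
  then show "loop x = x" "loop_deriv x = 1"
    by (simp_all add: loop_def loop_deriv_def)
qed

lemma bump_inside:
  assumes "\<bar>x\<bar> < 1"
  shows "bump x = (1 - x\<^sup>2)\<^sup>2" "bump x > 0" "bump_deriv x = - (4 * x * (1 - x\<^sup>2))"
proof -
  have "x\<^sup>2 < 1"
    using assms by (simp add: abs_square_less_1)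
  then show "bump x = (1 - x\<^sup>2)\<^sup>2" "bump x > 0" "bump_deriv x = - (4 * x * (1 - x\<^sup>2))"
    by (simp_all add: bump_def bump_deriv_def)
qed

lemma bump_bounds: "0 \<le> bump x" "bump x \<le> 1"
proof -
  show "0 \<le> bump x"
    by (simp add: bump_def)
  have "max 0 (1 - x\<^sup>2) \<le> 1"
    by simp
  then have "(max 0 (1 - x\<^sup>2))\<^sup>2 \<le> 1\<^sup>2"
    by (intro power_mono) auto
  then show "bump x \<le> 1"
    by (simp add: bump_def)
qed

lemma loop_bound:
  assumes "\<bar>x\<bar> \<le> 1"
  shows "\<bar>loop x\<bar> \<le> 3"
proof -
  have "loop x = x * (1 - 4 * bump x)"
    by (simp add: loop_def algebra_simps)
  moreover have "\<bar>x\<bar> * \<bar>1 - 4 * bump x\<bar> \<le> 1 * 3"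
    using assms bump_bounds[of x] by (intro mult_mono) auto
  ultimately show ?thesis
    by (simp add: abs_mult)
qed

lemma loop_bump_immersed: "loop_deriv x \<noteq> 0 \<or> bump_deriv x \<noteq> 0"
proof (cases "\<bar>x\<bar> < 1")
  case True
  then have "x\<^sup>2 < 1"
    by (simp add: abs_square_less_1)
  then show ?thesis
    using bump_inside[OF True] by (cases "x = 0") (auto simp: loop_deriv_def)
next
  case False
  then show ?thesis
    using bump_outside[of x] by simp
qed

text \<open>
  The values of \<open>bump\<close> inside \<open>{-1<..<1}\<close> determine the parameter up to
  its sign, and then \<open>loop\<close> vanishes by oddness.
\<close>

lemma loop_bump_double_point:
  assumes "\<bar>x\<bar> < 1" "x \<noteq> t" "loop x = loop t" "bump x = bump t"
  shows "\<bar>x\<bar> = 1 / sqrt 2" "t = - x"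
proof -
  have t: "\<bar>t\<bar> < 1"
    using assms(1,4) bump_inside(2)[OF assms(1)] bump_outside(1)[of t] by force
  have "1 - x\<^sup>2 = 1 - t\<^sup>2"
  proof (rule power2_eq_imp_eq)
    show "(1 - x\<^sup>2)\<^sup>2 = (1 - t\<^sup>2)\<^sup>2"
      using assms(4) bump_inside(1)[OF assms(1)] bump_inside(1)[OF t] by simp
    show "0 \<le> 1 - x\<^sup>2" "0 \<le> 1 - t\<^sup>2"
      using assms(1) t by (simp_all add: abs_square_le_1)
  qed
  then show tx: "t = - x"
    using assms(2) by (simp add: power2_eq_iff)
  then have "x \<noteq> 0" "loop x = - loop x"
    using assms by (auto simp: loop_def)
  then have "bump x = 1 / 4"
    by (simp add: loop_def)
  then have "(1 - x\<^sup>2)\<^sup>2 = (1 / 2)\<^sup>2"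
    using bump_inside(1)[OF assms(1)] by (simp add: power2_eq_square)
  then have "1 - x\<^sup>2 = 1 / 2"
    by (rule power2_eq_imp_eq) (use assms(1) in \<open>simp_all add: abs_square_le_1\<close>)
  then have "x\<^sup>2 = 1 / 2"
    by simp
  then have "\<bar>x\<bar> = sqrt (1 / 2)"
    using real_sqrt_abs[of x] by (simp only:)
  then show "\<bar>x\<bar> = 1 / sqrt 2"
    by (simp add: real_sqrt_divide)
qed

lemma loop_bump_at_double_point:
  assumes "x = 1 / sqrt 2 \<or> x = - (1 / sqrt 2)"
  shows "\<bar>x\<bar> < 1" "loop x = 0" "bump x = 1 / 4" "loop_deriv x = 4" "bump_deriv x = - (2 * x)"
proof -
  have x2: "x\<^sup>2 = 1 / 2"
    using assms by (auto simp: power_divide)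
  then have "x\<^sup>2 < 1"
    by simp
  then show x: "\<bar>x\<bar> < 1"
    by (simp add: abs_square_less_1)
  show b: "bump x = 1 / 4"
    unfolding bump_inside(1)[OF x] x2 by (simp add: power2_eq_square)
  show d: "bump_deriv x = - (2 * x)"
    unfolding bump_inside(3)[OF x] x2 by simp
  show "loop x = 0"
    by (simp add: loop_def b)
  have "loop_deriv x = 1 - 4 * (1 / 4 - 2 * x\<^sup>2)"
    unfolding loop_deriv_def b d by (simp add: power2_eq_square)
  then show "loop_deriv x = 4"
    unfolding x2 by simp
qed

section \<open>Splicing an arc into a closed curve\<close>

text \<open>
  The fractional part jumps only at integers, near which \<open>f\<close> agrees with the periodic
  function \<open>c\<close>. So near every parameter the spliced function is a translate of
  \<open>f\<close>, and smoothness carries over.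
\<close>

lemma splice_locally:
  fixes c f :: "real \<Rightarrow> 'a"
  assumes per: "\<And>s. c (s + 1) = c s" and ab: "0 < a" "a \<le> b" "b < 1"
    and eq: "\<And>s. s \<notin> {a..b} \<Longrightarrow> f s = c s"
    and s: "s \<in> {of_int m + b - 1<..<of_int m + a + 1}"
  shows "f (frac s) = f (s - of_int m)"
proof -
  have cs: "c (frac s) = c (s - of_int m)"
    using periodic_frac[of c, OF per] periodic_add_int[of c, OF per, of s "- m"] by simp
  consider "s - of_int m < 0" | "0 \<le> s - of_int m" "s - of_int m < 1" | "1 \<le> s - of_int m"
    by linarith
  then show ?thesis
  proof cases
    case 1
    then have "\<lfloor>s\<rfloor> = m - 1"
      using s ab by (simp add: floor_eq_iff)
    then have "frac s \<notin> {a..b}" "s - of_int m \<notin> {a..b}"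
      using s ab 1 by (auto simp: frac_def)
    then show ?thesis
      using eq cs by simp
  next
    case 2
    then have "frac s = s - of_int m"
      by (simp add: frac_unique_iff)
    then show ?thesis
      by simp
  next
    case 3
    then have "\<lfloor>s\<rfloor> = m + 1"
      using s ab by (simp add: floor_eq_iff)
    then have "frac s \<notin> {a..b}" "s - of_int m \<notin> {a..b}"
      using s ab 3 by (auto simp: frac_def)
    then show ?thesis
      using eq cs by simp
  qed
qed

lemma splice_has_vector_derivative:
  fixes c f :: "real \<Rightarrow> 'a::real_normed_vector"
  assumes per: "\<And>s. c (s + 1) = c s" and ab: "0 < a" "a \<le> b" "b < 1"
    and eq: "\<And>s. s \<notin> {a..b} \<Longrightarrow> f s = c s"
    and f': "\<And>s. (f has_vector_derivative f' s) (at s)"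
  shows "((\<lambda>s. f (frac s)) has_vector_derivative f' (frac s)) (at s)"
proof -
  let ?m = "\<lfloor>s\<rfloor>"
  have "((f \<circ> (\<lambda>s. s - of_int ?m)) has_vector_derivative 1 *\<^sub>R f' (s - of_int ?m)) (at s)"
    by (rule vector_diff_chain_at) (auto intro!: derivative_eq_intros f')
  then have "((\<lambda>s. f (s - of_int ?m)) has_vector_derivative f' (frac s)) (at s)"
    by (simp add: o_def frac_def)
  then show ?thesis
  proof (rule has_vector_derivative_transform_within_open)
    show "open {of_int ?m + b - 1<..<of_int ?m + a + 1}"
      by simp
    show "s \<in> {of_int ?m + b - 1<..<of_int ?m + a + 1}"
      using ab by (simp; linarith)
    show "f (t - of_int ?m) = f (frac t)" if "t \<in> {of_int ?m + b - 1<..<of_int ?m + a + 1}" for t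
      using splice_locally[of c a b f, OF per ab eq that] by simp
  qed
qed

lemma splice_continuous:
  fixes c f :: "real \<Rightarrow> 'a::topological_space"
  assumes per: "\<And>s. c (s + 1) = c s" and ab: "0 < a" "a \<le> b" "b < 1"
    and eq: "\<And>s. s \<notin> {a..b} \<Longrightarrow> f s = c s"
    and f: "continuous_on UNIV f"
  shows "continuous_on UNIV (\<lambda>s. f (frac s))"
proof -
  have "isCont (\<lambda>s. f (frac s)) s" for s
  proof -
    let ?m = "\<lfloor>s\<rfloor>"
    let ?U = "{of_int ?m + b - 1<..<of_int ?m + a + 1}"
    have "continuous_on ?U (\<lambda>s. f (s - of_int ?m))"
      by (intro continuous_on_compose2[OF f] continuous_intros) auto
    then have "continuous_on ?U (\<lambda>s. f (frac s))"
      by (rule continuous_on_eq) (rule splice_locally[of c a b f, OF per ab eq, symmetric])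
    moreover have "s \<in> ?U"
      using ab by (simp; linarith)
    ultimately show ?thesis
      by (simp add: continuous_on_eq_continuous_at)
  qed
  then show ?thesis
    by (simp add: continuous_on_eq_continuous_at)
qed

section \<open>Adding a negative curl\<close>

text \<open>
  Around the parameter \<open>s0\<close> of the first component, for parameters at distance at
  most \<open>\<eta>0\<close>, the projection advances in the direction of \<open>y' s0\<close>
  and the height rises. Points of the diagram with other parameters have distance at least
  \<open>\<rho>\<close> from \<open>y s0\<close>. The curl occupies the parameters at distance
  less than \<open>\<eta>\<close>; the factor \<open>3\<close> is the bound of
  \<open>\<bar>loop\<bar>\<close> on \<open>{-1..1}\<close>.
\<close>

locale curl_site =
  fixes K :: link and y y' :: "real \<Rightarrow> complex" and h h' :: "real \<Rightarrow> real" and s0 \<eta>0 \<eta> \<rho> :: real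
  assumes K: "is_link K"
    and reg: "\<And>i. i < link_comps K \<Longrightarrow> regular_closed_curve (\<lambda>s. fst (strand K i s))"
    and trans: "\<And>p q. (p, q) \<in> double_points (shadow K) \<Longrightarrow>
      Im (cnj (tangent (shadow K) p) * tangent (shadow K) q) \<noteq> 0"
    and uniq: "\<And>p q r. (p, q) \<in> double_points (shadow K) \<Longrightarrow> (p, r) \<in> double_points (shadow K) \<Longrightarrow> q = r"
    and strand0: "\<And>s. strand K 0 s = (y s, h s)"
    and y': "\<And>s. (y has_vector_derivative y' s) (at s)"
    and h': "\<And>s. (h has_vector_derivative h' s) (at s)"
    and \<eta>: "0 < \<eta>" "3 * \<eta> \<le> \<eta>0" and inside: "0 < s0 - \<eta>0" "s0 + \<eta>0 < 1"
    and advancing: "\<And>s. \<bar>s - s0\<bar> \<le> \<eta>0 \<Longrightarrow> Re (cnj (y' s0) * y' s) > 0"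
    and rising: "\<And>s. \<bar>s - s0\<bar> \<le> \<eta>0 \<Longrightarrow> h' s > 0"
    and isolated: "\<And>i s. (i, s) \<in> circle_params (link_comps K) \<Longrightarrow> i \<noteq> 0 \<or> \<eta>0 \<le> \<bar>s - s0\<bar> \<Longrightarrow>
      \<rho> \<le> dist (fst (strand K i s)) (y s0)"
    and small: "\<And>s. \<bar>s - s0\<bar> \<le> 3 * \<eta> \<Longrightarrow> dist (y s) (y s0) < \<rho> / 2" "\<eta> * norm (y' s0) < \<rho> / 2"
begin

definition scaled :: "real \<Rightarrow> real" where
  "scaled s = (s - s0) / \<eta>"

text \<open>
  The map that sends \<open>(u, v)\<close> to \<open>y (s0 + \<eta> u) + \<eta> v \<i> y'
  s0\<close> takes the first axis to the given arc. The new curve is the image of the standard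
  curl under this map; outside of the curl it equals \<open>y\<close>, and its double points are
  those of the standard curl, with no need to straighten the arc first.
\<close>

definition curled :: "real \<Rightarrow> complex" where
  "curled s = y (s0 + \<eta> * loop (scaled s)) - (\<eta> * bump (scaled s)) *\<^sub>R (\<i> * y' s0)"

definition curled_deriv :: "real \<Rightarrow> complex" where
  "curled_deriv s = loop_deriv (scaled s) *\<^sub>R y' (s0 + \<eta> * loop (scaled s)) - bump_deriv (scaled s) *\<^sub>R (\<i> * y' s0)"

definition curled_link :: link where
  "curled_link = \<lparr>link_comps = link_comps K,
     strand = (strand K)(0 := \<lambda>s. (curled (frac s), h s))\<rparr>"

lemma comps_pos: "0 < link_comps K"
  using K by (simp add: is_link_def)

lemma y_eq: "y = (\<lambda>s. fst (strand K 0 s))" and h_eq: "h = (\<lambda>s. snd (strand K 0 s))"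
  by (simp_all add: strand0)

lemma y_per: "y (s + 1) = y s" and h_per: "h (s + 1) = h s"
proof -
  have "strand K 0 (s + 1) = strand K 0 s"
    using K comps_pos by (auto simp: is_link_def regular_closed_curve_def)
  then show "y (s + 1) = y s" "h (s + 1) = h s"
    by (simp_all add: strand0)
qed

lemma y'_per: "y' (s + 1) = y' s" and h'_per: "h' (s + 1) = h' s"
  using periodic_has_vector_derivative_unique[of y, OF y_per y']
    periodic_has_vector_derivative_unique[of h, OF h_per h'] by simp_all

lemma y'_eq: "y' = (\<lambda>s. vector_derivative y (at s))" and h'_eq: "h' = (\<lambda>s. vector_derivative h (at s))"
  using vector_derivative_at[OF y'] vector_derivative_at[OF h'] by simp_all

lemma y'_continuous: "continuous_on UNIV y'"
  using regular_closed_curveD(3)[OF reg[OF comps_pos]] unfolding y'_eq y_eq .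

lemma y'_nonzero: "y' s \<noteq> 0"
  using regular_closed_curveD(4)[OF reg[OF comps_pos]] unfolding y'_eq y_eq .

lemma h'_continuous: "continuous_on UNIV h'"
proof -
  have reg0: "regular_closed_curve (strand K 0)"
    using K comps_pos by (simp add: is_link_def)
  have "(h has_vector_derivative snd (vector_derivative (strand K 0) (at s))) (at s)" for s
    unfolding h_eq using regular_closed_curveD(2)[OF reg0]
    by (rule bounded_linear.has_vector_derivative[OF bounded_linear_snd])
  then have "h' s = snd (vector_derivative (strand K 0) (at s))" for s
    using h' vector_derivative_unique_at by blast
  then show ?thesis
    using regular_closed_curveD(3)[OF reg0] by (simp add: continuous_on_snd)
qed

lemma curled_has_derivative: "(curled has_vector_derivative curled_deriv s) (at s)"
proof -
  have sc: "(scaled has_real_derivative 1 / \<eta>) (at s)"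
    unfolding scaled_def[abs_def] using \<eta>(1) by (auto intro!: derivative_eq_intros)
  have "((\<lambda>s. loop (scaled s)) has_real_derivative loop_deriv (scaled s) * (1 / \<eta>)) (at s)"
    by (rule DERIV_chain2[OF loop_has_derivative sc])
  then have "((\<lambda>s. s0 + \<eta> * loop (scaled s)) has_real_derivative loop_deriv (scaled s)) (at s)"
    using \<eta>(1) by (auto intro!: derivative_eq_intros)
  then have "((\<lambda>s. s0 + \<eta> * loop (scaled s)) has_vector_derivative loop_deriv (scaled s)) (at s)"
    by (simp add: has_real_derivative_iff_has_vector_derivative)
  from vector_diff_chain_at[OF this y']
  have 1: "((\<lambda>s. y (s0 + \<eta> * loop (scaled s))) has_vector_derivative
      loop_deriv (scaled s) *\<^sub>R y' (s0 + \<eta> * loop (scaled s))) (at s)"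
    by (simp add: o_def)
  have "((\<lambda>s. bump (scaled s)) has_real_derivative bump_deriv (scaled s) * (1 / \<eta>)) (at s)"
    by (rule DERIV_chain2[OF bump_has_derivative sc])
  then have "((\<lambda>s. \<eta> * bump (scaled s)) has_real_derivative bump_deriv (scaled s)) (at s)"
    using \<eta>(1) by (auto intro!: derivative_eq_intros)
  then have "((\<lambda>s. \<eta> * bump (scaled s)) has_vector_derivative bump_deriv (scaled s)) (at s)"
    by (simp add: has_real_derivative_iff_has_vector_derivative)
  then have "((\<lambda>s. (\<eta> * bump (scaled s)) *\<^sub>R (\<i> * y' s0)) has_vector_derivative
      bump_deriv (scaled s) *\<^sub>R (\<i> * y' s0)) (at s)"
    by (rule bounded_linear.has_vector_derivative[OF bounded_linear_scaleR_left])
  from has_vector_derivative_diff[OF 1 this] show ?thesis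
    by (simp only: curled_def[abs_def] curled_deriv_def)
qed

lemma curled_deriv_continuous: "continuous_on UNIV curled_deriv"
proof -
  have sc: "continuous_on UNIV scaled"
    unfolding scaled_def using \<eta>(1) by (intro continuous_intros) auto
  have "continuous_on UNIV loop"
    using loop_has_derivative by (meson DERIV_isCont continuous_at_imp_continuous_on)
  then have "continuous_on UNIV (\<lambda>s. s0 + \<eta> * loop (scaled s))"
    by (intro continuous_intros continuous_on_compose2[OF _ sc]) auto
  then have "continuous_on UNIV (\<lambda>s. y' (s0 + \<eta> * loop (scaled s)))"
    by (rule continuous_on_compose2[OF y'_continuous]) auto
  moreover have "continuous_on UNIV (\<lambda>s. loop_deriv (scaled s))" "continuous_on UNIV (\<lambda>s. bump_deriv (scaled s))"
    using continuous_on_compose2[OF loop_deriv_continuous sc] continuous_on_compose2[OF bump_deriv_continuous sc]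
    by auto
  ultimately show ?thesis
    unfolding curled_deriv_def by (intro continuous_intros)
qed

lemma scaled_ge_1: "\<eta> \<le> \<bar>s - s0\<bar> \<longleftrightarrow> 1 \<le> \<bar>scaled s\<bar>"
  using \<eta>(1) by (simp add: scaled_def field_simps)

lemma curled_outside:
  assumes "\<eta> \<le> \<bar>s - s0\<bar>"
  shows "curled s = y s" "curled_deriv s = y' s"
proof -
  have "1 \<le> \<bar>scaled s\<bar>"
    using assms scaled_ge_1 by blast
  moreover have "s0 + \<eta> * scaled s = s"
    using \<eta>(1) by (simp add: scaled_def)
  ultimately show "curled s = y s" "curled_deriv s = y' s"
    by (simp_all add: curled_def curled_deriv_def bump_outside)
qed

lemma curled_outside':
  assumes "s \<notin> {s0 - \<eta>..s0 + \<eta>}"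
  shows "curled s = y s" "curled_deriv s = y' s"
  using curled_outside[of s] assms by auto

lemma splice_range: "0 < s0 - \<eta>" "s0 - \<eta> \<le> s0 + \<eta>" "s0 + \<eta> < 1"
  using \<eta> inside by auto

lemma arc_foot:
  assumes "\<bar>s - s0\<bar> \<le> \<eta>0"
  shows "\<bar>s0 + \<eta> * loop (scaled s) - s0\<bar> \<le> \<eta>0"
proof (cases "\<eta> \<le> \<bar>s - s0\<bar>")
  case True
  then have "loop (scaled s) = scaled s"
    using scaled_ge_1 bump_outside by blast
  then show ?thesis
    using assms \<eta>(1) by (simp add: scaled_def)
next
  case False
  then have "\<bar>scaled s\<bar> \<le> 1"
    using scaled_ge_1[of s] by linarith
  then have "\<eta> * \<bar>loop (scaled s)\<bar> \<le> \<eta> * 3"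
    using loop_bound \<eta>(1) by (intro mult_left_mono) auto
  then have "\<eta> * \<bar>loop (scaled s)\<bar> \<le> \<eta>0"
    using \<eta>(2) by linarith
  then show ?thesis
    using \<eta>(1) by (simp add: abs_mult)
qed

lemma y_advances:
  assumes "\<bar>s - s0\<bar> \<le> \<eta>0" "\<bar>t - s0\<bar> \<le> \<eta>0" "s < t"
  shows "Re (cnj (y' s0) * y s) < Re (cnj (y' s0) * y t)"
proof (rule DERIV_pos_imp_increasing[of s t "\<lambda>s. Re (cnj (y' s0) * y s)", OF assms(3)])
  fix x
  assume "s \<le> x" "x \<le> t"
  then have "\<bar>x - s0\<bar> \<le> \<eta>0"
    using assms by auto
  moreover have "((\<lambda>s. Re (cnj (y' s0) * y s)) has_vector_derivative Re (cnj (y' s0) * y' x)) (at x)"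
    by (intro bounded_linear.has_vector_derivative[OF bounded_linear_Re] has_vector_derivative_mult_right y')
  ultimately show "\<exists>d. ((\<lambda>s. Re (cnj (y' s0) * y s)) has_real_derivative d) (at x) \<and> d > 0"
    using advancing unfolding has_real_derivative_iff_has_vector_derivative by blast
qed

lemma h_rises:
  assumes "\<bar>s - s0\<bar> \<le> \<eta>0" "\<bar>t - s0\<bar> \<le> \<eta>0" "s < t"
  shows "h s < h t"
proof (rule DERIV_pos_imp_increasing[of s t h, OF assms(3)])
  fix x
  assume "s \<le> x" "x \<le> t"
  then have "\<bar>x - s0\<bar> \<le> \<eta>0"
    using assms by auto
  then show "\<exists>d. (h has_real_derivative d) (at x) \<and> d > 0"
    using rising h' unfolding has_real_derivative_iff_has_vector_derivative by blast
qed

text \<open>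
  The displacement is orthogonal to \<open>y' s0\<close>, so the component along \<open>y'
  s0\<close> determines the foot point on the arc, by monotonicity, and then the displacement.
\<close>

lemma curled_eq_imp:
  assumes s: "\<bar>s - s0\<bar> \<le> \<eta>0" and t: "\<bar>t - s0\<bar> \<le> \<eta>0" and eq: "curled s = curled t"
  shows "loop (scaled s) = loop (scaled t)" "bump (scaled s) = bump (scaled t)"
proof -
  have "Re (cnj (y' s0) * curled s) = Re (cnj (y' s0) * y (s0 + \<eta> * loop (scaled s)))" for s
    by (simp add: curled_def algebra_simps)
  then have "Re (cnj (y' s0) * y (s0 + \<eta> * loop (scaled s))) = Re (cnj (y' s0) * y (s0 + \<eta> * loop (scaled t)))"
    using eq by metis
  then have "s0 + \<eta> * loop (scaled s) = s0 + \<eta> * loop (scaled t)"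
    using y_advances[OF arc_foot[OF s] arc_foot[OF t]] y_advances[OF arc_foot[OF t] arc_foot[OF s]]
    by (metis less_irrefl linorder_neqE_linordered_idom)
  then show l: "loop (scaled s) = loop (scaled t)"
    using \<eta>(1) by simp
  have "(\<eta> * bump (scaled s)) *\<^sub>R (\<i> * y' s0) = (\<eta> * bump (scaled t)) *\<^sub>R (\<i> * y' s0)"
    using eq by (simp add: curled_def l)
  then show "bump (scaled s) = bump (scaled t)"
    using y'_nonzero \<eta>(1) by (simp add: scaleR_cancel_right)
qed

lemma near_site:
  assumes "\<bar>s - s0\<bar> < \<eta>"
  shows "y s \<in> ball (y s0) \<rho>" "curled s \<in> ball (y s0) \<rho>"
proof -
  have \<rho>: "\<rho> > 0"
    using small(2) \<eta>(1) by (smt (verit) divide_eq_0_iff half_gt_zero_iff mult_nonneg_nonneg norm_ge_zero)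
  have "\<bar>s - s0\<bar> \<le> 3 * \<eta>"
    using assms \<eta>(1) by simp
  then show "y s \<in> ball (y s0) \<rho>"
    using small(1)[of s] \<rho> by (simp add: dist_commute)
  have x: "\<bar>scaled s\<bar> \<le> 1"
    using assms scaled_ge_1[of s] by linarith
  then have "\<eta> * \<bar>loop (scaled s)\<bar> \<le> \<eta> * 3"
    using loop_bound \<eta>(1) by (intro mult_left_mono) auto
  then have foot: "dist (y (s0 + \<eta> * loop (scaled s))) (y s0) < \<rho> / 2"
    using \<eta>(1) by (intro small(1)) (simp add: abs_mult)
  have side: "norm ((\<eta> * bump (scaled s)) *\<^sub>R (\<i> * y' s0)) < \<rho> / 2"
  proof -
    have "norm ((\<eta> * bump (scaled s)) *\<^sub>R (\<i> * y' s0)) = bump (scaled s) * (\<eta> * norm (y' s0))"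
      using \<eta>(1) bump_bounds(1) by (simp add: norm_mult abs_mult)
    also have "\<dots> \<le> 1 * (\<eta> * norm (y' s0))"
      using \<eta>(1) bump_bounds(2) by (intro mult_right_mono) auto
    finally show ?thesis
      using small(2) by simp
  qed
  have "curled s - y s0 = (y (s0 + \<eta> * loop (scaled s)) - y s0) - (\<eta> * bump (scaled s)) *\<^sub>R (\<i> * y' s0)"
    by (simp add: curled_def)
  then have "norm (curled s - y s0) \<le>
      dist (y (s0 + \<eta> * loop (scaled s))) (y s0) + norm ((\<eta> * bump (scaled s)) *\<^sub>R (\<i> * y' s0))"
    unfolding dist_norm by (metis norm_triangle_ineq4)
  then have "norm (curled s - y s0) < \<rho>"
    using foot side by linarith
  then show "curled s \<in> ball (y s0) \<rho>"
    by (simp add: dist_norm norm_minus_commute)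
qed

lemma curled_splice:
  "((\<lambda>s. curled (frac s)) has_vector_derivative curled_deriv (frac s)) (at s)"
  "continuous_on UNIV (\<lambda>s. curled_deriv (frac s))"
proof -
  show "((\<lambda>s. curled (frac s)) has_vector_derivative curled_deriv (frac s)) (at s)"
    by (rule splice_has_vector_derivative[of y, OF y_per splice_range curled_outside'(1) curled_has_derivative])
  show "continuous_on UNIV (\<lambda>s. curled_deriv (frac s))"
    by (rule splice_continuous[of y', OF y'_per splice_range curled_outside'(2) curled_deriv_continuous])
qed

lemma curled_link_simps:
  "link_comps curled_link = link_comps K"
  "strand curled_link 0 s = (curled (frac s), h s)"
  "i \<noteq> 0 \<Longrightarrow> strand curled_link i = strand K i"
  by (simp_all add: curled_link_def)

lemma strand_curled_link_outside:
  assumes "p \<in> circle_params (link_comps K)" "fst p \<noteq> 0 \<or> \<eta> \<le> \<bar>snd p - s0\<bar>"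
  shows "strand curled_link (fst p) (snd p) = strand K (fst p) (snd p)"
proof (cases "fst p = 0")
  case True
  have "frac (snd p) = snd p"
    using assms(1) by (auto simp: circle_params_def frac_eq)
  then show ?thesis
    using True assms(2) curled_outside(1)[of "snd p"] by (simp add: curled_link_simps strand0)
qed (simp add: curled_link_simps)

lemma strand_curled_link_inside:
  assumes "\<bar>s - s0\<bar> \<le> \<eta>0"
  shows "strand curled_link 0 s = (curled s, h s)"
proof -
  have "0 \<le> s" "s < 1"
    using assms inside by linarith+
  then have "frac s = s"
    by (simp add: frac_eq)
  then show ?thesis
    by (simp add: curled_link_simps)
qed

lemma height_curled_link: "height curled_link p = height K p"
  by (cases "fst p = 0") (simp_all add: height_def curled_link_simps strand0)

lemma blend_is_link:
  assumes t: "t \<in> {0..1}"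
  shows "is_link (blend t K curled_link)"
proof -
  let ?B = "blend t K curled_link"
  have reg0: "regular_closed_curve (strand ?B 0)"
  proof (rule regular_closed_curveI)
    have b: "strand ?B 0 = (\<lambda>s. ((1 - t) *\<^sub>R y s + t *\<^sub>R curled (frac s), h s))"
    proof
      fix s
      have "(1 - t) * h s + t * h s = h s"
        by (simp add: algebra_simps)
      then show "strand ?B 0 s = ((1 - t) *\<^sub>R y s + t *\<^sub>R curled (frac s), h s)"
        by (simp add: strand0 curled_link_simps)
    qed
    let ?b' = "\<lambda>s. ((1 - t) *\<^sub>R y' s + t *\<^sub>R curled_deriv (frac s), h' s)"
    show "strand ?B 0 (s + 1) = strand ?B 0 s" for s
      unfolding b using y_per h_per frac_1_eq[of s] by simp
    show "(strand ?B 0 has_vector_derivative ?b' s) (at s)" for s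
      unfolding b by (intro has_vector_derivative_Pair has_vector_derivative_add h' y' curled_splice(1)
          bounded_linear.has_vector_derivative[OF bounded_linear_scaleR_right])
    show "continuous_on UNIV ?b'"
      by (intro continuous_intros y'_continuous curled_splice(2) h'_continuous)
    fix s
    have fr: "y' (frac s) = y' s" "h' (frac s) = h' s"
      using periodic_frac[of y', OF y'_per] periodic_frac[of h', OF h'_per] by simp_all
    show "?b' s \<noteq> 0"
    proof (cases "\<eta> \<le> \<bar>frac s - s0\<bar>")
      case True
      then have "(1 - t) *\<^sub>R y' s + t *\<^sub>R curled_deriv (frac s) = y' s"
        using curled_outside(2)[OF True] fr by (simp add: algebra_simps)
      then show ?thesis
        using y'_nonzero[of s] by (simp add: prod_eq_iff)
    next
      case False
      then have "h' s > 0"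
        using rising[of "frac s"] \<eta> fr by simp
      then show ?thesis
        by (simp add: prod_eq_iff)
    qed
  qed
  have regi: "regular_closed_curve (strand ?B i)" if "i < link_comps K" "i \<noteq> 0" for i
  proof -
    have "strand ?B i = strand K i"
      using that by (simp add: fun_eq_iff curled_link_simps flip: scaleR_add_left)
    then show ?thesis
      using K that by (simp add: is_link_def)
  qed
  have out: "strand ?B (fst p) (snd p) = strand K (fst p) (snd p)"
    if "p \<in> circle_params (link_comps K)" "fst p \<noteq> 0 \<or> \<eta> \<le> \<bar>snd p - s0\<bar>" for p
    using strand_curled_link_outside[OF that] by (simp flip: scaleR_add_left)
  \<comment> \<open>an arc point collides neither with the rest of the diagram, which is far away in the plane,
     nor with the neighbouring part of its component, which has other heights\<close>
  have arc: "strand ?B 0 s \<noteq> strand ?B (fst q) (snd q)"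
    if s: "\<bar>s - s0\<bar> < \<eta>" and q: "q \<in> circle_params (link_comps K)" "q \<noteq> (0, s)" for s q
  proof (cases "fst q = 0 \<and> \<bar>snd q - s0\<bar> \<le> \<eta>0")
    case True
    have "snd (strand ?B 0 x) = h x" for x
      by (simp add: strand0 curled_link_simps algebra_simps)
    moreover have "snd q \<noteq> s"
      using q(2) True by (auto simp: prod_eq_iff)
    moreover have "\<bar>s - s0\<bar> \<le> \<eta>0"
      using s \<eta> by simp
    ultimately show ?thesis
      using h_rises[of s "snd q"] h_rises[of "snd q" s] True
      by (metis less_irrefl linorder_neqE_linordered_idom)
  next
    case False
    then have q0: "fst q \<noteq> 0 \<or> \<eta>0 \<le> \<bar>snd q - s0\<bar>"
      by auto
    then have "fst (strand K (fst q) (snd q)) \<notin> ball (y s0) \<rho>"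
      using isolated[of "fst q" "snd q"] q(1) by (simp add: dist_commute)
    moreover have "strand ?B (fst q) (snd q) = strand K (fst q) (snd q)"
      using out[OF q(1)] q0 \<eta> by auto
    moreover have "fst (strand ?B 0 s) \<in> ball (y s0) \<rho>"
    proof -
      have "fst (strand ?B 0 s) = (1 - t) *\<^sub>R y s + t *\<^sub>R curled s"
        using strand_curled_link_inside[of s] s \<eta> by (simp add: strand0)
      then show ?thesis
        using convexD[OF convex_ball near_site[OF s], of "1 - t" t] t by simp
    qed
    ultimately show ?thesis
      by metis
  qed
  have "inj_on (\<lambda>(i, s). strand ?B i s) (circle_params (link_comps K))"
  proof (rule inj_onI, rule ccontr)
    fix p q
    assume p: "p \<in> circle_params (link_comps K)" and q: "q \<in> circle_params (link_comps K)" and "p \<noteq> q"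
      and "(\<lambda>(i, s). strand ?B i s) p = (\<lambda>(i, s). strand ?B i s) q"
    then have eq: "strand ?B (fst p) (snd p) = strand ?B (fst q) (snd q)"
      by (simp only: case_prod_unfold)
    consider "fst p = 0" "\<bar>snd p - s0\<bar> < \<eta>" | "fst q = 0" "\<bar>snd q - s0\<bar> < \<eta>"
      | "fst p \<noteq> 0 \<or> \<eta> \<le> \<bar>snd p - s0\<bar>" "fst q \<noteq> 0 \<or> \<eta> \<le> \<bar>snd q - s0\<bar>"
      by linarith
    then show False
    proof cases
      case 1
      then show False
        using arc[OF 1(2) q] eq \<open>p \<noteq> q\<close> by (metis prod.collapse)
    next
      case 2
      then show False
        using arc[OF 2(2) p] eq \<open>p \<noteq> q\<close> by (metis prod.collapse)
    next
      case 3
      then have "strand K (fst p) (snd p) = strand K (fst q) (snd q)"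
        using eq out[OF p] out[OF q] by metis
      moreover have "inj_on (\<lambda>(i, s). strand K i s) (circle_params (link_comps K))"
        using K by (simp add: is_link_def)
      ultimately show False
        using p q \<open>p \<noteq> q\<close> by (auto simp: case_prod_unfold dest: inj_onD)
    qed
  qed
  moreover have "regular_closed_curve (strand ?B i)" if "i < link_comps K" for i
    using reg0 regi that by (cases "i = 0") auto
  ultimately show ?thesis
    using K unfolding is_link_def blend_simps(1) by blast
qed

lemma curled_link_isotopic: "link_isotopic K curled_link"
  by (rule straight_line_isotopic[OF curled_link_simps(1) blend_is_link])

lemma is_link_curled_link: "is_link curled_link"
  using curled_link_isotopic by (simp add: link_isotopic_def)

definition curl_params :: "nat \<times> real \<Rightarrow> bool" where
  "curl_params p \<longleftrightarrow> fst p = 0 \<and> \<bar>snd p - s0\<bar> < \<eta>"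

definition upper_curl_point :: "nat \<times> real" where
  "upper_curl_point = (0, s0 + \<eta> / sqrt 2)"

definition lower_curl_point :: "nat \<times> real" where
  "lower_curl_point = (0, s0 - \<eta> / sqrt 2)"

lemma scaled_curl_points:
  "scaled (snd upper_curl_point) = 1 / sqrt 2" "scaled (snd lower_curl_point) = - (1 / sqrt 2)"
  using \<eta>(1) by (simp_all add: scaled_def upper_curl_point_def lower_curl_point_def)

lemma curl_params_curl_points: "curl_params upper_curl_point" "curl_params lower_curl_point"
proof -
  have "\<bar>scaled (snd upper_curl_point)\<bar> < 1" "\<bar>scaled (snd lower_curl_point)\<bar> < 1"
    using loop_bump_at_double_point(1) by (simp_all add: scaled_curl_points)
  then show "curl_params upper_curl_point" "curl_params lower_curl_point"
    using scaled_ge_1[of "snd upper_curl_point"] scaled_ge_1[of "snd lower_curl_point"]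
    by (auto simp: curl_params_def upper_curl_point_def lower_curl_point_def)
qed

lemma curl_params_in_circle_params: "curl_params p \<Longrightarrow> p \<in> circle_params (link_comps K)"
  using comps_pos inside \<eta> by (cases p) (auto simp: curl_params_def circle_params_def)

lemma point_curled_link_outside:
  assumes "p \<in> circle_params (link_comps K)" "\<not> curl_params p"
  shows "point (shadow curled_link) p = point (shadow K) p"
  using strand_curled_link_outside[OF assms(1)] assms(2) by (auto simp: point_def curl_params_def)

lemma point_curled_link_inside:
  assumes "fst p = 0" "\<bar>snd p - s0\<bar> \<le> \<eta>0"
  shows "point (shadow curled_link) p = curled (snd p)"
  using strand_curled_link_inside[OF assms(2)] assms(1) by (simp add: point_def)

lemma curl_params_double_points:
  assumes "curl_params p" "(p, q) \<in> double_points (shadow curled_link)"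
  shows "(p, q) = (upper_curl_point, lower_curl_point) \<or> (p, q) = (lower_curl_point, upper_curl_point)"
proof -
  have p: "fst p = 0" "\<bar>snd p - s0\<bar> < \<eta>" "\<bar>snd p - s0\<bar> \<le> \<eta>0"
    using assms(1) \<eta> by (auto simp: curl_params_def)
  have q: "q \<in> circle_params (link_comps K)" "p \<noteq> q"
    and eq: "point (shadow curled_link) p = point (shadow curled_link) q"
    using assms(2) by (auto simp: double_points_def curled_link_simps)
  have pt: "point (shadow curled_link) p = curled (snd p)"
    by (rule point_curled_link_inside[OF p(1,3)])
  have q': "fst q = 0 \<and> \<bar>snd q - s0\<bar> \<le> \<eta>0"
  proof (rule ccontr)
    assume "\<not> (fst q = 0 \<and> \<bar>snd q - s0\<bar> \<le> \<eta>0)"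
    then have q0: "fst q \<noteq> 0 \<or> \<eta>0 \<le> \<bar>snd q - s0\<bar>"
      by auto
    then have "point (shadow K) q \<notin> ball (y s0) \<rho>"
      using isolated[of "fst q" "snd q"] q(1) by (simp add: dist_commute point_def)
    moreover have "\<not> curl_params q"
      using q0 \<eta> by (auto simp: curl_params_def)
    ultimately show False
      using point_curled_link_outside[OF q(1)] near_site(2)[OF p(2)] eq pt by simp
  qed
  have c: "curled (snd p) = curled (snd q)"
    using eq pt point_curled_link_inside[of q] q' by simp
  have x: "\<bar>scaled (snd p)\<bar> < 1" "scaled (snd p) \<noteq> scaled (snd q)"
  proof -
    show "\<bar>scaled (snd p)\<bar> < 1"
      using scaled_ge_1[of "snd p"] p(2) by linarith
    show "scaled (snd p) \<noteq> scaled (snd q)"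
      using q(2) p(1) q' \<eta>(1) by (auto simp: scaled_def prod_eq_iff)
  qed
  have dp: "\<bar>scaled (snd p)\<bar> = 1 / sqrt 2" "scaled (snd q) = - scaled (snd p)"
    using loop_bump_double_point[OF x] curled_eq_imp[OF p(3) _ c] q' by auto
  have unscale: "r = (0, s0 + \<eta> * scaled (snd r))" if "fst r = 0" for r :: "nat \<times> real"
    using \<eta>(1) that by (simp add: scaled_def prod_eq_iff)
  have "scaled (snd p) = 1 / sqrt 2 \<or> scaled (snd p) = - (1 / sqrt 2)"
    using dp(1) by (auto simp: abs_if split: if_splits)
  then show ?thesis
    using unscale[OF p(1)] unscale[of q] q' dp(2)
    by (auto simp: upper_curl_point_def lower_curl_point_def)
qed

lemma curl_points_double:
  "(upper_curl_point, lower_curl_point) \<in> double_points (shadow curled_link)"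
proof -
  have near: "\<bar>snd upper_curl_point - s0\<bar> \<le> \<eta>0" "\<bar>snd lower_curl_point - s0\<bar> \<le> \<eta>0"
    using curl_params_curl_points \<eta> by (auto simp: curl_params_def)
  have "curled (snd upper_curl_point) = curled (snd lower_curl_point)"
    by (simp add: curled_def scaled_curl_points loop_bump_at_double_point(2,3))
  then have "point (shadow curled_link) upper_curl_point = point (shadow curled_link) lower_curl_point"
    using near point_curled_link_inside by (simp add: upper_curl_point_def lower_curl_point_def)
  moreover have "upper_curl_point \<noteq> lower_curl_point"
    using \<eta>(1) by (simp add: upper_curl_point_def lower_curl_point_def)
  ultimately show ?thesis
    using curl_params_in_circle_params curl_params_curl_points
    by (simp add: double_points_def curled_link_simps)
qed

lemma not_curl_params_double_points:
  assumes "(p, q) \<in> double_points (shadow K)"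
  shows "\<not> curl_params p"
proof
  assume "curl_params p"
  then have p: "fst p = 0" "\<bar>snd p - s0\<bar> < \<eta>" "\<bar>snd p - s0\<bar> \<le> \<eta>0"
    using \<eta> by (auto simp: curl_params_def)
  have q: "q \<in> circle_params (link_comps K)" "p \<noteq> q" and eq: "point (shadow K) p = point (shadow K) q"
    using assms by (auto simp: double_points_def)
  have pt: "point (shadow K) p = y (snd p)"
    using p(1) by (simp add: point_def strand0)
  show False
  proof (cases "fst q = 0 \<and> \<bar>snd q - s0\<bar> \<le> \<eta>0")
    case True
    then have "y (snd p) = y (snd q)"
      using eq pt by (simp add: point_def strand0)
    moreover have "snd p \<noteq> snd q"
      using q(2) p(1) True by (auto simp: prod_eq_iff)
    ultimately show False
      using y_advances[of "snd p" "snd q"] y_advances[of "snd q" "snd p"] p(3) True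
      by (metis less_irrefl linorder_neqE_linordered_idom)
  next
    case False
    then have "point (shadow K) q \<notin> ball (y s0) \<rho>"
      using isolated[of "fst q" "snd q"] q(1) by (auto simp: dist_commute point_def)
    then show False
      using near_site(1)[OF p(2)] eq pt by simp
  qed
qed

lemma double_points_curled_link:
  "double_points (shadow curled_link) = double_points (shadow K) \<union>
     {(upper_curl_point, lower_curl_point), (lower_curl_point, upper_curl_point)}"
proof -
  have outside: "(p, q) \<in> double_points (shadow curled_link) \<longleftrightarrow> (p, q) \<in> double_points (shadow K)"
    if "\<not> curl_params p" "\<not> curl_params q" for p q
    using point_curled_link_outside[of p] point_curled_link_outside[of q] that
    by (auto simp: double_points_def curled_link_simps)
  have old: "\<not> curl_params p \<and> \<not> curl_params q" if "(p, q) \<in> double_points (shadow K)" for p q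
    using not_curl_params_double_points[OF that] not_curl_params_double_points[OF double_points_sym[OF that]] by blast
  have new: "(p, q) \<in> {(upper_curl_point, lower_curl_point), (lower_curl_point, upper_curl_point)}"
    if "(p, q) \<in> double_points (shadow curled_link)" "curl_params p \<or> curl_params q" for p q
    using curl_params_double_points[OF _ that(1)] curl_params_double_points[OF _ double_points_sym[OF that(1)]] that(2)
    by auto
  show ?thesis
  proof (rule set_eqI)
    fix c :: "(nat \<times> real) \<times> (nat \<times> real)"
    obtain p q where c: "c = (p, q)"
      by (cases c)
    show "c \<in> double_points (shadow curled_link) \<longleftrightarrow> c \<in> double_points (shadow K) \<union>
        {(upper_curl_point, lower_curl_point), (lower_curl_point, upper_curl_point)}"
      unfolding c
    proof (cases "curl_params p \<or> curl_params q")
      case True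
      then have "(p, q) \<notin> double_points (shadow K)"
        using old by blast
      then show "(p, q) \<in> double_points (shadow curled_link) \<longleftrightarrow> (p, q) \<in> double_points (shadow K) \<union>
          {(upper_curl_point, lower_curl_point), (lower_curl_point, upper_curl_point)}"
        using new[OF _ True] curl_points_double double_points_sym[OF curl_points_double] by auto
    next
      case False
      then have "(p, q) \<notin> {(upper_curl_point, lower_curl_point), (lower_curl_point, upper_curl_point)}"
        using curl_params_curl_points by auto
      then show "(p, q) \<in> double_points (shadow curled_link) \<longleftrightarrow> (p, q) \<in> double_points (shadow K) \<union>
          {(upper_curl_point, lower_curl_point), (lower_curl_point, upper_curl_point)}"
        using outside[of p q] False by (simp only: Un_iff de_Morgan_disj simp_thms)
    qed
  qed
qed

lemma tangent_curled_link_outside: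
  assumes "p \<in> circle_params (link_comps K)" "\<not> curl_params p"
  shows "tangent (shadow curled_link) p = tangent (shadow K) p"
proof (cases "fst p = 0")
  case True
  have "frac (snd p) = snd p"
    using assms(1) by (auto simp: circle_params_def frac_eq)
  moreover have "curve (shadow curled_link) 0 = (\<lambda>s. curled (frac s))" "curve (shadow K) 0 = y"
    by (auto simp: curled_link_simps strand0)
  ultimately show ?thesis
    using True assms(2) curled_outside(2)[of "snd p"]
      vector_derivative_at[OF curled_splice(1), of "snd p"] vector_derivative_at[OF y', of "snd p"]
    by (auto simp: tangent_def curl_params_def)
next
  case False
  then have "curve (shadow curled_link) (fst p) = curve (shadow K) (fst p)"
    by (auto simp: curled_link_simps)
  then show ?thesis
    by (simp add: tangent_def)
qed

lemma tangent_curl_points: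
  "tangent (shadow curled_link) upper_curl_point = Complex 4 (2 / sqrt 2) * y' s0"
  "tangent (shadow curled_link) lower_curl_point = Complex 4 (- 2 / sqrt 2) * y' s0"
proof -
  have "tangent (shadow curled_link) p = loop_deriv (scaled (snd p)) *\<^sub>R y' s0 - bump_deriv (scaled (snd p)) *\<^sub>R (\<i> * y' s0)"
    if "curl_params p" "loop (scaled (snd p)) = 0" for p
  proof -
    have "frac (snd p) = snd p"
      using curl_params_in_circle_params[OF that(1)] by (auto simp: circle_params_def frac_eq)
    moreover have "curve (shadow curled_link) 0 = (\<lambda>s. curled (frac s))"
      by (auto simp: curled_link_simps)
    ultimately have "tangent (shadow curled_link) p = curled_deriv (snd p)"
      using that(1) vector_derivative_at[OF curled_splice(1), of "snd p"] by (simp add: tangent_def curl_params_def)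
    then show ?thesis
      using that(2) by (simp add: curled_deriv_def)
  qed
  note this[OF curl_params_curl_points(1)] this[OF curl_params_curl_points(2)]
  then show "tangent (shadow curled_link) upper_curl_point = Complex 4 (2 / sqrt 2) * y' s0"
    "tangent (shadow curled_link) lower_curl_point = Complex 4 (- 2 / sqrt 2) * y' s0"
    unfolding scaled_curl_points by (simp_all add: loop_bump_at_double_point complex_eq_iff algebra_simps)
qed

text \<open>
  The first factor belongs to the branch that is traversed later; it is the upper one because the
  height rises, so that the determinant decides the sign of the crossing.
\<close>

lemma curl_tangents_determinant:
  "Im (cnj (tangent (shadow curled_link) upper_curl_point) * tangent (shadow curled_link) lower_curl_point) < 0"
proof -
  have "cnj (Complex 4 r * v) * (Complex 4 (- r) * v) =
      (cnj (Complex 4 r) * Complex 4 (- r)) * of_real ((norm v)\<^sup>2)" for r v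
    by (simp only: complex_norm_square complex_cnj_mult mult_ac)
  then have "Im (cnj (Complex 4 r * v) * (Complex 4 (- r) * v)) = - (8 * r) * (norm v)\<^sup>2" for r v
    by (simp only:) (simp add: algebra_simps)
  from this[of "2 / sqrt 2" "y' s0"] have "Im (cnj (Complex 4 (2 / sqrt 2) * y' s0) * (Complex 4 (- 2 / sqrt 2) * y' s0)) =
      - (8 * (2 / sqrt 2)) * (norm (y' s0))\<^sup>2"
    by (simp only: minus_divide_left)
  moreover have "(norm (y' s0))\<^sup>2 > 0"
    using y'_nonzero by simp
  ultimately show ?thesis
    unfolding tangent_curl_points by (simp add: mult_neg_pos)
qed

lemma curled_link_projects_to:
  "projects_to curled_link (shadow curled_link)"
  "crossings (shadow curled_link) = insert (upper_curl_point, lower_curl_point) (crossings (shadow K))"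
proof -
  have reg': "regular_closed_curve (\<lambda>s. fst (strand curled_link i s))" if i: "i < link_comps curled_link" for i
  proof (cases "i = 0")
    case True
    have "regular_closed_curve (\<lambda>s. curled (frac s))"
    proof (rule regular_closed_curveI[OF _ curled_splice])
      show "curled (frac (s + 1)) = curled (frac s)" for s
        by (simp add: frac_1_eq)
      fix s :: real
      let ?s = "frac s"
      show "curled_deriv ?s \<noteq> 0"
      proof (cases "\<eta> \<le> \<bar>?s - s0\<bar>")
        case True
        then show ?thesis
          using curled_outside(2) y'_nonzero by simp
      next
        case False
        have foot: "\<bar>s0 + \<eta> * loop (scaled ?s) - s0\<bar> \<le> \<eta>0"
          using False \<eta> by (intro arc_foot) simp
        have R: "Re (cnj (y' s0) * curled_deriv ?s) = loop_deriv (scaled ?s) * Re (cnj (y' s0) * y' (s0 + \<eta> * loop (scaled ?s)))"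
          by (simp add: curled_deriv_def algebra_simps)
        show ?thesis
        proof
          assume z: "curled_deriv ?s = 0"
          then have "loop_deriv (scaled ?s) = 0"
            using R advancing[OF foot] by simp
          moreover from this have "bump_deriv (scaled ?s) = 0"
            using z y'_nonzero by (simp add: curled_deriv_def)
          ultimately show False
            using loop_bump_immersed by blast
        qed
      qed
    qed
    then show ?thesis
      using True by (simp add: curled_link_simps)
  next
    case False
    then show ?thesis
      using reg i by (simp add: curled_link_simps)
  qed
  have tan: "tangent (shadow curled_link) p = tangent (shadow K) p" "tangent (shadow curled_link) q = tangent (shadow K) q"
    if "(p, q) \<in> double_points (shadow K)" for p q
    using tangent_curled_link_outside[of p] tangent_curled_link_outside[of q] that
      not_curl_params_double_points[OF that] not_curl_params_double_points[OF double_points_sym[OF that]]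
    by (auto simp: double_points_def)
  have trans': "Im (cnj (tangent (shadow curled_link) p) * tangent (shadow curled_link) q) \<noteq> 0"
    if dp: "(p, q) \<in> double_points (shadow curled_link)" for p q
  proof -
    have sw: "Im (cnj v * w) = - Im (cnj w * v)" for v w
      by simp
    consider "(p, q) \<in> double_points (shadow K)" | "p = upper_curl_point" "q = lower_curl_point"
      | "p = lower_curl_point" "q = upper_curl_point"
      using dp unfolding double_points_curled_link by blast
    then show ?thesis
    proof cases
      case 1
      then show ?thesis
        using trans[OF 1] tan[OF 1] by simp
    next
      case 2
      then show ?thesis
        using curl_tangents_determinant by simp
    next
      case 3
      have "Im (cnj (tangent (shadow curled_link) lower_curl_point) * tangent (shadow curled_link) upper_curl_point) > 0"
        using curl_tangents_determinant
          sw[of "tangent (shadow curled_link) lower_curl_point" "tangent (shadow curled_link) upper_curl_point"]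
        by linarith
      then show ?thesis
        unfolding 3 by (metis less_irrefl)
    qed
  qed
  have uniq': "q = r"
    if "(p, q) \<in> double_points (shadow curled_link)" "(p, r) \<in> double_points (shadow curled_link)" for p q r
  proof (cases "curl_params p")
    case True
    have "upper_curl_point \<noteq> lower_curl_point"
      using curl_points_double by (simp add: double_points_def)
    then show ?thesis
      using curl_params_double_points[OF True that(1)] curl_params_double_points[OF True that(2)] by auto
  next
    case False
    then have "(p, q) \<in> double_points (shadow K)" "(p, r) \<in> double_points (shadow K)"
      using that curl_params_curl_points unfolding double_points_curled_link by auto
    then show ?thesis
      by (rule uniq)
  qed
  show "projects_to curled_link (shadow curled_link)"
    by (rule shadow_projects_to(1)[OF is_link_curled_link reg' trans' uniq'])
  have "crossings (shadow curled_link) = {(p, q) \<in> double_points (shadow curled_link). height K q < height K p}"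
    using shadow_projects_to(2)[OF is_link_curled_link reg' trans' uniq'] by (simp only: height_curled_link)
  moreover have "crossings (shadow K) = {(p, q) \<in> double_points (shadow K). height K q < height K p}"
    by (rule shadow_projects_to(2)[OF K reg trans uniq])
  moreover have "height K lower_curl_point < height K upper_curl_point"
  proof -
    have "h (snd lower_curl_point) < h (snd upper_curl_point)"
      using curl_params_curl_points \<eta>
      by (intro h_rises) (auto simp: curl_params_def upper_curl_point_def lower_curl_point_def)
    then show ?thesis
      by (simp add: height_def strand0 upper_curl_point_def lower_curl_point_def)
  qed
  ultimately show "crossings (shadow curled_link) = insert (upper_curl_point, lower_curl_point) (crossings (shadow K))"
    unfolding double_points_curled_link by auto
qed

lemma card_negative_crossings_curled_link:
  "card (negative_crossings (shadow curled_link)) = Suc (card (negative_crossings (shadow K)))"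
proof -
  have old: "crossing_sign (shadow curled_link) c = crossing_sign (shadow K) c" if c: "c \<in> crossings (shadow K)" for c
  proof -
    obtain p q where pq: "c = (p, q)" "(p, q) \<in> double_points (shadow K)"
      using c by (cases c) (auto simp: crossings_def)
    then have "p \<in> circle_params (link_comps K)" "q \<in> circle_params (link_comps K)"
      by (auto simp: double_points_def)
    then show ?thesis
      using tangent_curled_link_outside not_curl_params_double_points[OF pq(2)]
        not_curl_params_double_points[OF double_points_sym[OF pq(2)]]
      by (simp add: crossing_sign_def pq(1))
  qed
  moreover have "crossing_sign (shadow curled_link) (upper_curl_point, lower_curl_point) = - 1"
    using curl_tangents_determinant by (simp only: crossing_sign_def fst_conv snd_conv sgn_neg)
  ultimately have "negative_crossings (shadow curled_link) =
      insert (upper_curl_point, lower_curl_point) (negative_crossings (shadow K))"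
    unfolding negative_crossings_def curled_link_projects_to(2) by auto
  moreover have "(upper_curl_point, lower_curl_point) \<notin> negative_crossings (shadow K)"
    using not_curl_params_double_points[of upper_curl_point lower_curl_point] curl_params_curl_points(1)
    by (auto simp: negative_crossings_def crossings_def)
  moreover have "finite (negative_crossings (shadow K))"
    using shadow_projects_to(1)[OF K reg trans uniq] finite_negative_crossings by (simp add: projects_to_def)
  ultimately show ?thesis
    by simp
qed

end

section \<open>Two diagrams with different numbers of negative crossings\<close>

lemma periodic_C1_increases_somewhere:
  fixes h h' :: "real \<Rightarrow> real"
  assumes "h 1 = h 0" and h': "\<And>s. (h has_vector_derivative h' s) (at s)"
    and "0 < x" "x < 1" "h x \<noteq> h 0"
  shows "\<exists>s\<in>{0<..<1}. h' s > 0"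
proof -
  have d: "(h has_real_derivative h' s) (at s)" for s
    using h' by (simp add: has_real_derivative_iff_has_vector_derivative)
  obtain s where s: "0 < s" "s < x" "h x - h 0 = (x - 0) * h' s"
    using MVT2[of 0 x h h'] d assms(3) by blast
  obtain t where t: "x < t" "t < 1" "h 1 - h x = (1 - x) * h' t"
    using MVT2[of x 1 h h'] d assms(4) by blast
  show ?thesis
  proof (cases "h x > h 0")
    case True
    then have "x * h' s > 0"
      using s(3) by simp
    then have "h' s > 0"
      using zero_less_mult_pos[of x "h' s"] assms(3) by blast
    moreover have "s \<in> {0<..<1}"
      using s assms(4) by simp
    ultimately show ?thesis ..
  next
    case False
    then have "(1 - x) * h' t > 0"
      using t(3) assms(1,5) by linarith
    then have "h' t > 0"
      using zero_less_mult_pos[of "1 - x" "h' t"] assms(4) by simp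
    moreover have "t \<in> {0<..<1}"
      using t assms(3) by simp
    ultimately show ?thesis ..
  qed
qed

text \<open>
  The parameters at which the height rises form a nonempty open set, and only finitely many of
  them belong to crossings.
\<close>

lemma curl_insertion:
  assumes proj: "projects_to K (shadow K)"
    and reg: "\<And>i. i < link_comps K \<Longrightarrow> regular_closed_curve (\<lambda>s. fst (strand K i s))"
    and heights: "height K (0, 1 / 4) \<noteq> height K (0, 0)"
  obtains K' where "link_isotopic K K'" "projects_to K' (shadow K')"
    "card (negative_crossings (shadow K')) = Suc (card (negative_crossings (shadow K)))"
proof -
  have K: "is_link K" and D: "is_diagram (shadow K)"
    using proj by (auto simp: projects_to_def)
  have pos: "0 < link_comps K"
    using K by (simp add: is_link_def)
  define y where "y = (\<lambda>s. fst (strand K 0 s))"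
  define h where "h = (\<lambda>s. snd (strand K 0 s))"
  have strand0: "strand K 0 s = (y s, h s)" for s
    by (simp add: y_def h_def)
  have reg0: "regular_closed_curve (strand K 0)" and regy: "regular_closed_curve y"
    using K pos reg by (auto simp: is_link_def y_def)
  define y' where "y' = (\<lambda>s. vector_derivative y (at s))"
  define h' where "h' = (\<lambda>s. snd (vector_derivative (strand K 0) (at s)))"
  have y': "(y has_vector_derivative y' s) (at s)" for s
    using regular_closed_curveD(2)[OF regy] by (simp add: y'_def)
  have y'_cont: "continuous_on UNIV y'" and y_cont: "continuous_on UNIV y"
    using regular_closed_curveD(3,6)[OF regy] by (simp_all add: y'_def)
  have h': "(h has_vector_derivative h' s) (at s)" for s
    unfolding h_def h'_def using regular_closed_curveD(2)[OF reg0]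
    by (rule bounded_linear.has_vector_derivative[OF bounded_linear_snd])
  have h'_cont: "continuous_on UNIV h'"
    unfolding h'_def by (intro continuous_on_snd regular_closed_curveD(3)[OF reg0])
  have y_per: "y (s + 1) = y s" for s
    by (rule regular_closed_curveD(1)[OF regy])
  have y'_nz: "y' s \<noteq> 0" for s
    using regular_closed_curveD(4)[OF regy] by (simp add: y'_def)
  \<comment> \<open>a rising point that is not a crossing\<close>
  have "\<exists>s\<in>{0<..<1}. h' s > 0"
  proof (rule periodic_C1_increases_somewhere[where x = "1 / 4"])
    show "h 1 = h 0"
      using regular_closed_curveD(1)[OF reg0, of 0] by (simp add: h_def)
    show "h (1 / 4) \<noteq> h 0"
      using heights by (simp add: height_def h_def)
  qed (use h' in auto)
  moreover have "open ({0<..<1} \<inter> h' -` {0<..})"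
    by (intro open_Int open_vimage h'_cont) auto
  ultimately have "infinite ({0<..<1} \<inter> h' -` {0<..})"
    using finite_imp_not_open[of "{0<..<1} \<inter> h' -` {0<..}"] by auto
  moreover have "finite ((\<lambda>c. snd (fst c)) ` double_points (shadow K))"
    using is_diagramD(3)[OF D] by simp
  ultimately have "\<not> {0<..<1} \<inter> h' -` {0<..} \<subseteq> (\<lambda>c. snd (fst c)) ` double_points (shadow K)"
    using finite_subset by blast
  then obtain s0 where s0: "0 < s0" "s0 < 1" "h' s0 > 0"
    and nocross: "\<And>q. ((0, s0), q) \<notin> double_points (shadow K)"
    by force
  \<comment> \<open>near it, the curve advances and rises\<close>
  have "open {s. Re (cnj (y' s0) * y' s) > 0}"
    by (intro open_Collect_less continuous_intros y'_cont)
  moreover have "open {s. h' s > 0}"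
    by (intro open_Collect_less continuous_intros h'_cont)
  moreover define U where "U = {s. Re (cnj (y' s0) * y' s) > 0} \<inter> {s. h' s > 0} \<inter> {0<..<1}"
  ultimately have "open U"
    unfolding U_def by (intro open_Int) simp_all
  moreover have "Re (cnj (y' s0) * y' s0) > 0"
    using y'_nz[of s0] by (simp add: complex_eq_iff sum_power2_gt_zero_iff flip: power2_eq_square)
  then have "s0 \<in> U"
    using s0 by (simp add: U_def)
  ultimately obtain \<eta>0 where \<eta>0: "\<eta>0 > 0" "cball s0 \<eta>0 \<subseteq> U"
    using open_contains_cball_eq by metis
  have near: "Re (cnj (y' s0) * y' s) > 0 \<and> h' s > 0 \<and> 0 < s \<and> s < 1" if "\<bar>s - s0\<bar> \<le> \<eta>0" for s
  proof -
    have "s \<in> cball s0 \<eta>0"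
      using that by (simp add: dist_real_def abs_minus_commute)
    then have "s \<in> U"
      using \<eta>0(2) by blast
    then show ?thesis
      by (simp add: U_def)
  qed
  \<comment> \<open>the rest of the diagram keeps a positive distance\<close>
  define C where "C = y ` ({0..s0 - \<eta>0} \<union> {s0 + \<eta>0..1}) \<union> (\<Union>i\<in>{1..<link_comps K}. (\<lambda>s. fst (strand K i s)) ` {0..1})"
  have "compact C"
    unfolding C_def
  proof (intro compact_Un compact_UN finite_atLeastLessThan compact_continuous_image)
    show "continuous_on ({0..s0 - \<eta>0} \<union> {s0 + \<eta>0..1}) y"
      using y_cont continuous_on_subset by blast
    show "continuous_on {0..1} (\<lambda>s. fst (strand K i s))" if "i \<in> {1..<link_comps K}" for i
      using regular_closed_curveD(6)[OF reg[of i]] continuous_on_subset that by auto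
  qed auto
  moreover have "y s0 \<notin> C"
  proof
    assume "y s0 \<in> C"
    then consider t where "t \<in> {0..s0 - \<eta>0} \<union> {s0 + \<eta>0..1}" "y s0 = y t"
      | i t where "i \<in> {1..<link_comps K}" "y s0 = fst (strand K i t)"
      unfolding C_def by blast
    then obtain i t where it: "i < link_comps K" "(i, frac t) \<noteq> (0, s0)" "y s0 = fst (strand K i t)"
    proof cases
      case 1
      have "frac t \<noteq> s0"
      proof (cases "t = 1")
        case True
        then show ?thesis
          using s0(1) by simp
      next
        case False
        then have "0 \<le> t" "t < 1"
          using 1(1) s0 \<eta>0(1) by auto
        then show ?thesis
          using 1(1) \<eta>0(1) by (auto simp: frac_eq)
      qed
      then show ?thesis
        using that[of 0 t] 1(2) pos by (simp add: y_def)
    next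
      case 2
      then show ?thesis
        using that[of i t] by simp
    qed
    have "fst (strand K i (frac t)) = fst (strand K i t)"
      by (rule regular_closed_curve_tangent_frac(1)[OF reg[OF it(1)]])
    then have "((0, s0), (i, frac t)) \<in> double_points (shadow K)"
      using it s0 pos by (auto simp: double_points_def circle_params_def point_def frac_lt_1 y_def)
    then show False
      using nocross by blast
  qed
  ultimately obtain \<rho> where \<rho>: "\<rho> > 0" "\<And>x. x \<in> C \<Longrightarrow> \<rho> \<le> dist (y s0) x"
    using separate_point_closed[of C "y s0"] compact_imp_closed by blast
  have far: "\<rho> \<le> dist (fst (strand K i s)) (y s0)"
    if p: "(i, s) \<in> circle_params (link_comps K)" "i \<noteq> 0 \<or> \<eta>0 \<le> \<bar>s - s0\<bar>" for i s
  proof -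
    have is': "i < link_comps K" "0 \<le> s" "s < 1"
      using p(1) by (auto simp: circle_params_def)
    have "fst (strand K i s) \<in> C"
    proof (cases "i = 0")
      case True
      then have "s \<in> {0..s0 - \<eta>0} \<union> {s0 + \<eta>0..1}"
        using p(2) is' by auto
      then show ?thesis
        using True unfolding C_def y_def by blast
    next
      case False
      then have "i \<in> {1..<link_comps K}" "s \<in> {0..1}"
        using is' by auto
      then show ?thesis
        unfolding C_def by blast
    qed
    then have "\<rho> \<le> dist (y s0) (fst (strand K i s))"
      by (rule \<rho>(2))
    then show ?thesis
      by (simp only: dist_commute)
  qed
  have "isCont y s0"
    using y_cont by (simp add: continuous_on_eq_continuous_at)
  then obtain \<eta>1 where \<eta>1: "\<eta>1 > 0" "\<And>s. dist s s0 < \<eta>1 \<Longrightarrow> dist (y s) (y s0) < \<rho> / 2"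
    using \<rho>(1) unfolding continuous_at_eps_delta by (metis half_gt_zero)
  define \<eta> where "\<eta> = min (\<eta>0 / 3) (min (\<eta>1 / 4) (\<rho> / (4 * norm (y' s0))))"
  have ny: "norm (y' s0) > 0"
    using y'_nz by simp
  have \<eta>: "\<eta> > 0" "3 * \<eta> \<le> \<eta>0" "3 * \<eta> < \<eta>1" "\<eta> * norm (y' s0) < \<rho> / 2"
  proof -
    show "\<eta> > 0" "3 * \<eta> \<le> \<eta>0"
      using \<eta>0(1) \<eta>1(1) \<rho>(1) ny by (auto simp: \<eta>_def min_def)
    have "\<eta> \<le> \<eta>1 / 4" "\<eta> \<le> \<rho> / (4 * norm (y' s0))"
      by (simp_all add: \<eta>_def)
    then show "3 * \<eta> < \<eta>1" "\<eta> * norm (y' s0) < \<rho> / 2"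
      using \<eta>1(1) \<rho>(1) ny by (simp_all add: field_simps)
  qed
  interpret curl_site K y y' h h' s0 \<eta>0 \<eta> \<rho>
  proof
    show "is_link K" by (rule K)
    show "regular_closed_curve (\<lambda>s. fst (strand K i s))" if "i < link_comps K" for i
      using reg that .
    show "Im (cnj (tangent (shadow K) p) * tangent (shadow K) q) \<noteq> 0"
      if "(p, q) \<in> double_points (shadow K)" for p q
      using is_diagram_transversal(1)[OF D that] .
    show "q = r" if "(p, q) \<in> double_points (shadow K)" "(p, r) \<in> double_points (shadow K)" for p q r
      using is_diagramD(5)[OF D] that by blast
    show "0 < s0 - \<eta>0" "s0 + \<eta>0 < 1"
      using near[of "s0 - \<eta>0"] near[of "s0 + \<eta>0"] \<eta>0(1) by auto
    show "dist (y s) (y s0) < \<rho> / 2" if "\<bar>s - s0\<bar> \<le> 3 * \<eta>" for s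
      using \<eta>1(2) \<eta>(3) that by (simp add: dist_real_def)
  qed (use strand0 y' h' \<eta> near far in auto)
  show ?thesis
    using that[OF curled_link_isotopic curled_link_projects_to(1) card_negative_crossings_curled_link] .
qed

theorem theorem9:
  fixes L :: link and A :: "polyak_move set"
  assumes "is_link L" and "generating L A"
  shows "Omega2a_up \<in> A \<and> Omega2a_down \<in> A"
proof -
  obtain K where K: "link_isotopic L K" "projects_to K (shadow K)"
    "\<And>i. i < link_comps K \<Longrightarrow> regular_closed_curve (\<lambda>s. fst (strand K i s))"
    "height K (0, 1 / 4) \<noteq> height K (0, 0)"
    using link_isotopic_general_position[OF assms(1)] by blast
  obtain K' where K': "link_isotopic K K'" "projects_to K' (shadow K')"
    "card (negative_crossings (shadow K')) = Suc (card (negative_crossings (shadow K)))"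
    using curl_insertion[OF K(2-4)] by blast
  have "diagram_of L (shadow K)" "diagram_of L (shadow K')"
    using K(1,2) K'(1,2) link_isotopic_trans unfolding diagram_of_def by blast+
  then show ?thesis
    using generating_needs_omega2a[OF assms(2)] K'(3) by simp
qed

end
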